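(* Let $G=\mathrm{AC}_+(\mathbb S^1)$, let $K_\circ=\{k\in G : k(1)=1\}$ be equipped with the topology induced by the metric $d_*$, and let $\Omega:\mathbb S^1\times K_\circ\to G$ be the bijection $\Omega(h,k)=\lambda_h\circ k$, where $\lambda_h(x)=hx$ for $x\in\mathbb S^1$. Then the unique topology on $G$ which makes $\Omega$ a homeomorphism (with the product topology on $\mathbb S^1\times K_\circ$) makes $G$ a Polish group, and the metric $d_\infty+d_*$ on $G$ is compatible with this topology.
   Context: $\mathbb S^1$ is the group of complex numbers of norm $1$; $\pi:\mathbb R\to\mathbb S^1$ is $x\mapsto e^{2\pi i x}$; $d_{\mathbb S^1}(x,y)$ is the minimum distance between $\pi^{-1}(x)$ and $\pi^{-1}(y)$ in $\mathbb R$. For a homeomorphism $f:\mathbb S^1\to\mathbb S^1$, $\tilde f:\mathbb R\to\mathbb R$ is the unique homeomorphism with $\tilde f(0)\in[0,1)$ and $\pi\circ\tilde f=f\circ\pi$; $f$ is absolutely continuous if $\tilde f$ is locally absolutely continuous (absolutely continuous on every compact interval). $\mathrm{AC}_+(\mathbb S^1)$ is the group (under composition) of orientation-preserving homeomorphisms $f$ of $\mathbb S^1$ such that $f$ and $f^{-1}$ are absolutely continuous. On it, $d_\infty(f,g)=\sup_{x\in\mathbb S^1}d_{\mathbb S^1}(f(x),g(x))$ is a right-invariant metric and $d_*(f,g)=\int_0^1|\tilde f'(t)-\tilde g'(t)|\,dt$ is a right-invariant pseudometric. $\mathrm{AC}_+([0,1])$ is the group of orientation-preserving homeomorphisms $f$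 of $[0,1]$ with $f$ and $f^{-1}$ absolutely continuous; the formula $d_*(f,g)=\int_0^1|f'-g'|\,dt$ defines a right-invariant metric on it inducing a Polish group topology (Solecki). The map $k\mapsto\tilde k|_{[0,1]}$ is a group isomorphism $K_\circ\to\mathrm{AC}_+([0,1])$ preserving $d_*$, so $d_*$ is a right-invariant metric on $K_\circ$ which induces a Polish group topology on $K_\circ$. *)

theory Defs
  imports "HOL-Analysis.Analysis" "HOL-Algebra.Bij"
begin

definition circle :: "complex set"
  where "circle = sphere 0 1"

definition circle_cover :: "real \<Rightarrow> complex"
  where "circle_cover x = exp (2 * complex_of_real pi * \<i> * complex_of_real x)"

text \<open>The fibres are closed, discrete and differ from each other by a translation, so that for
  points of the circle the infimum in \<open>setdist\<close> is attained.\<close>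

definition d_circle :: "complex \<Rightarrow> complex \<Rightarrow> real"
  where "d_circle x y = setdist (circle_cover -` {x}) (circle_cover -` {y})"

definition circle_homeo :: "(complex \<Rightarrow> complex) \<Rightarrow> bool"
  where "circle_homeo f \<longleftrightarrow> homeomorphic_map (top_of_set circle) (top_of_set circle) f"

definition lift :: "(complex \<Rightarrow> complex) \<Rightarrow> real \<Rightarrow> real"
  where "lift f = (THE F. homeomorphic_map euclideanreal euclideanreal F \<and> F 0 \<in> {0..<1} \<and>
                          circle_cover \<circ> F = f \<circ> circle_cover)"

text \<open>Degenerate intervals \<open>s i = t i\<close> are admitted; they do not contribute to either sum.\<close>

definition absolutely_continuous_on :: "real \<Rightarrow> real \<Rightarrow> (real \<Rightarrow> real) \<Rightarrow> bool"
  where "absolutely_continuous_on a b F \<longleftrightarrow>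
    (\<forall>\<epsilon>>0. \<exists>\<delta>>0. \<forall>(n::nat) (s::nat \<Rightarrow> real) (t::nat \<Rightarrow> real).
       (\<forall>i<n. a \<le> s i \<and> s i \<le> t i \<and> t i \<le> b) \<longrightarrow>
       disjoint_family_on (\<lambda>i. {s i<..<t i}) {..<n} \<longrightarrow>
       (\<Sum>i<n. t i - s i) < \<delta> \<longrightarrow>
       (\<Sum>i<n. \<bar>F (t i) - F (s i)\<bar>) < \<epsilon>)"

definition locally_absolutely_continuous :: "(real \<Rightarrow> real) \<Rightarrow> bool"
  where "locally_absolutely_continuous F \<longleftrightarrow> (\<forall>a b. a \<le> b \<longrightarrow> absolutely_continuous_on a b F)"

definition circle_absolutely_continuous :: "(complex \<Rightarrow> complex) \<Rightarrow> bool"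
  where "circle_absolutely_continuous f \<longleftrightarrow> locally_absolutely_continuous (lift f)"

definition orientation_preserving :: "(complex \<Rightarrow> complex) \<Rightarrow> bool"
  where "orientation_preserving f \<longleftrightarrow> strict_mono (lift f)"

text \<open>A self-map of the circle is represented by the function on the complex plane which extends
  it by \<open>undefined\<close>, as in \<^const>\<open>BijGroup\<close>, whose multiplication is composition.\<close>

definition AC_circle :: "(complex \<Rightarrow> complex) monoid"
  where "AC_circle = BijGroup circle
    \<lparr>carrier := {f \<in> Bij circle. circle_homeo f \<and> orientation_preserving f \<and>
                   circle_absolutely_continuous f \<and>
                   circle_absolutely_continuous (restrict (inv_into circle f) circle)}\<rparr>"

definition d_infty :: "(complex \<Rightarrow> complex) \<Rightarrow> (complex \<Rightarrow> complex) \<Rightarrow> real"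
  where "d_infty f g = (SUP x\<in>circle. d_circle (f x) (g x))"

text \<open>Lifts of members of \<^const>\<open>AC_circle\<close> are differentiable almost everywhere;
  \<^const>\<open>deriv\<close> takes an irrelevant value elsewhere.\<close>

definition d_star :: "(complex \<Rightarrow> complex) \<Rightarrow> (complex \<Rightarrow> complex) \<Rightarrow> real"
  where "d_star f g = (LINT t:{0..1}|lebesgue. \<bar>deriv (lift f) t - deriv (lift g) t\<bar>)"

definition AC_circle_fix :: "(complex \<Rightarrow> complex) set"
  where "AC_circle_fix = {k \<in> carrier AC_circle. k 1 = 1}"

definition rotation :: "complex \<Rightarrow> complex \<Rightarrow> complex"
  where "rotation h = (\<lambda>x\<in>circle. h * x)"

definition Omega :: "complex \<times> (complex \<Rightarrow> complex) \<Rightarrow> complex \<Rightarrow> complex"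
  where "Omega = (\<lambda>(h, k). compose circle (rotation h) k)"

definition topological_group :: "('a, 'b) monoid_scheme \<Rightarrow> 'a topology \<Rightarrow> bool"
  where "topological_group G T \<longleftrightarrow>
    group G \<and> topspace T = carrier G \<and>
    continuous_map (prod_topology T T) T (\<lambda>(x, y). x \<otimes>\<^bsub>G\<^esub> y) \<and>
    continuous_map T T (\<lambda>x. inv\<^bsub>G\<^esub> x)"

definition polish_group :: "('a, 'b) monoid_scheme \<Rightarrow> 'a topology \<Rightarrow> bool"
  where "polish_group G T \<longleftrightarrow>
    topological_group G T \<and> separable_space T \<and> completely_metrizable_space T"

definition compatible_metric :: "'a topology \<Rightarrow> ('a \<Rightarrow> 'a \<Rightarrow> real) \<Rightarrow> bool"
  where "compatible_metric T d \<longleftrightarrow>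
    Metric_space (topspace T) d \<and> Metric_space.mtopology (topspace T) d = T"

definition Omega_topology :: "(complex \<Rightarrow> complex) topology \<Rightarrow> bool"
  where "Omega_topology T \<longleftrightarrow>
    topspace T = carrier AC_circle \<and>
    homeomorphic_map
      (prod_topology (top_of_set circle) (Metric_space.mtopology AC_circle_fix d_star)) T Omega"

end

theory Submission
  imports Defs
begin

text \<open>
  A circle homeomorphism is studied through a lift \<open>F\<close> to the line with \<open>F (x + 1) = F x + 1\<close>.
  Absolute continuity of \<open>F\<close> means that \<open>F\<close> has a Radon-Nikodym density, which is almost everywhere
  its derivative by Lebesgue differentiation; so \<open>d_star\<close> is the L1 distance of densities over a
  period, and the substitution rule for \<open>F\<close> makes it right invariant. Since \<open>d_star\<close> ignores
  rotations and bounds the variation of the difference of two lifts, \<open>\<Omega>\<close> is bi-Lipschitz from the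
  sum of the circle metric and \<open>d_star\<close> to \<open>d_infty + d_star\<close>. Left translations are continuous
  because continuous functions are dense in L1; for a right-invariant metric this makes the group
  operations continuous. Finally \<open>d_star(f, g) + d_star(f\<^sup>-\<^sup>1, g\<^sup>-\<^sup>1)\<close> is a complete compatible metric on
  the stabiliser of 1: the L1 limits of the densities of a Cauchy sequence and of its inverses
  integrate to mutually inverse lifts.
\<close>

subsection \<open>Absolutely continuous functions on the line\<close>

text \<open>Lifts are monotone, so densities are nonnegative and every integral can be a
  \<open>nn_integral\<close>: L1 distances live in \<open>ennreal\<close>, and triangle
  inequalities, substitution and limits carry no integrability side conditions. The real-valued
  \<open>d_star\<close> is tied to them once, in \<open>ennreal_d_star\<close>. The normalised
  \<open>lift\<close> does not respect composition, since the value at 0 leaves the unit interval.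
  Hence the relation \<open>is_lift\<close>, which admits every integer translate: a density does
  not see the translate, and \<open>d_circle\<close> is computed by picking the best one. Right
  invariance is exact, but a left translation evaluates a merely integrable density at a moving
  point; this is where approximation by continuous functions becomes necessary. The obstacle to
  completeness is that an L1 limit of densities may vanish on a set of positive measure. The limit
  of the lifts then fails to be injective or to have an absolutely continuous inverse. Controlling
  the inverses at the same time excludes this. That the stronger metric induces the same topology
  follows from continuity of inversion, so the group topology is settled before
  completeness.\<close>

lemma absolutely_continuous_on_imp_continuous_on:
  assumes "absolutely_continuous_on a b F"
  shows "continuous_on {a..b} F"
  unfolding continuous_on_iff
proof (intro ballI allI impI)
  fix x e :: real assume x: "x \<in> {a..b}" and "e > 0"
  then obtain d where "d > 0" and d: "\<And>(n::nat) (s::nat \<Rightarrow> real) t.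
       (\<forall>i<n. a \<le> s i \<and> s i \<le> t i \<and> t i \<le> b) \<Longrightarrow>
       disjoint_family_on (\<lambda>i. {s i<..<t i}) {..<n} \<Longrightarrow>
       (\<Sum>i<n. t i - s i) < d \<Longrightarrow> (\<Sum>i<n. \<bar>F (t i) - F (s i)\<bar>) < e"
    using assms unfolding absolutely_continuous_on_def by meson
  have "dist (F y) (F x) < e" if y: "y \<in> {a..b}" "dist y x < d" for y
  proof (cases "x \<le> y")
    case True
    then show ?thesis
      using d[of 1 "\<lambda>_. x" "\<lambda>_. y"] x y by (auto simp: disjoint_family_on_def dist_real_def)
  next
    case False
    then show ?thesis
      using d[of 1 "\<lambda>_. y" "\<lambda>_. x"] x y
      by (auto simp: disjoint_family_on_def dist_real_def abs_minus_commute)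
  qed
  then show "\<exists>d>0. \<forall>y\<in>{a..b}. dist y x < d \<longrightarrow> dist (F y) (F x) < e"
    using \<open>d > 0\<close> by blast
qed

lemma locally_absolutely_continuous_imp_continuous_on:
  assumes "locally_absolutely_continuous F"
  shows "continuous_on UNIV F"
proof -
  have "isCont F x" for x
  proof -
    have "continuous_on {x-1..x+1} F"
      using assms absolutely_continuous_on_imp_continuous_on
      unfolding locally_absolutely_continuous_def by (smt (verit))
    then show ?thesis
      by (rule continuous_on_interior) simp
  qed
  then show ?thesis
    by (simp add: continuous_at_imp_continuous_on)
qed

lemma absolutely_continuous_on_add_const:
  "absolutely_continuous_on a b (\<lambda>x. F x + c) \<longleftrightarrow> absolutely_continuous_on a b F"
  by (simp add: absolutely_continuous_on_def)

lemma locally_absolutely_continuous_add_const: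
  "locally_absolutely_continuous (\<lambda>x. F x + c) \<longleftrightarrow> locally_absolutely_continuous F"
  by (simp add: locally_absolutely_continuous_def absolutely_continuous_on_add_const)

text \<open>Components of a bounded open set are such intervals; \<open>Inf\<close> and
  \<open>Sup\<close> recover the endpoints that the definition of absolute continuity wants as
  sequences \<open>s\<close> and \<open>t\<close>.\<close>

lemma open_connected_eq_greaterThanLessThan:
  fixes I :: "real set"
  assumes "open I" "connected I" "I \<noteq> {}" and sub: "I \<subseteq> {a<..<b}"
  shows "Inf I < Sup I" and "I = {Inf I<..<Sup I}" and "a \<le> Inf I" and "Sup I \<le> b"
proof -
  have bd: "bdd_above I" "bdd_below I"
    using sub by (auto intro!: bdd_aboveI[of _ b] bdd_belowI[of _ a] dest!: subsetD)
  show I: "I = {Inf I<..<Sup I}"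
  proof
    show "I \<subseteq> {Inf I<..<Sup I}"
    proof
      fix x assume x: "x \<in> I"
      then obtain e where e: "e > 0" "ball x e \<subseteq> I" using assms(1) openE by blast
      then have "x - e/2 \<in> I" "x + e/2 \<in> I"
        by (auto intro!: subsetD[OF e(2)] simp: dist_real_def)
      then have "Inf I \<le> x - e/2" "x + e/2 \<le> Sup I"
        using bd by (auto intro: cInf_lower cSup_upper)
      then show "x \<in> {Inf I<..<Sup I}" using e by simp
    qed
    show "{Inf I<..<Sup I} \<subseteq> I"
    proof
      fix x assume x: "x \<in> {Inf I<..<Sup I}"
      then obtain y z where "y \<in> I" "y < x" "z \<in> I" "x < z"
        using cInf_lessD[OF assms(3)] less_cSupD[OF assms(3)] by (metis greaterThanLessThan_iff)
      then show "x \<in> I"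
        using assms(2) by (meson connectedD_interval less_imp_le)
    qed
  qed
  show "Inf I < Sup I"
    using I assms(3) by (metis greaterThanLessThan_empty_iff not_le_imp_less)
  show "a \<le> Inf I"
    by (rule cInf_greatest[OF assms(3)]) (use sub in force)
  show "Sup I \<le> b"
    by (rule cSup_least[OF assms(3)]) (use sub in force)
qed

text \<open>The definition recast for finite sets of open intervals instead of indexed endpoints.
  Smallness is measured by \<open>lborel\<close> of the union, the form in which outer regularity
  will deliver it; monotonicity removes the absolute values.\<close>

lemma absolutely_continuous_on_finite_open_intervals:
  assumes ac: "absolutely_continuous_on a b F" and mono: "mono F" and "e > 0"
  shows "\<exists>d>0. \<forall>D. finite D \<longrightarrow> disjoint D \<longrightarrow>
      (\<forall>I\<in>D. open I \<and> connected I \<and> I \<noteq> {} \<and> I \<subseteq> {a<..<b}) \<longrightarrow> emeasure lborel (\<Union>D) < ennreal d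
      \<longrightarrow> (\<Sum>I\<in>D. F (Sup I) - F (Inf I)) < e"
proof -
  obtain d where "d > 0" and d: "\<And>(n::nat) (s::nat \<Rightarrow> real) t.
       (\<forall>i<n. a \<le> s i \<and> s i \<le> t i \<and> t i \<le> b) \<Longrightarrow>
       disjoint_family_on (\<lambda>i. {s i<..<t i}) {..<n} \<Longrightarrow>
       (\<Sum>i<n. t i - s i) < d \<Longrightarrow> (\<Sum>i<n. \<bar>F (t i) - F (s i)\<bar>) < e"
    using ac \<open>e > 0\<close> unfolding absolutely_continuous_on_def by meson
  show ?thesis
  proof (intro exI[of _ d] conjI[OF \<open>d > 0\<close>] allI impI)
    fix D :: "real set set"
    assume D: "finite D" "disjoint D" "\<forall>I\<in>D. open I \<and> connected I \<and> I \<noteq> {} \<and> I \<subseteq> {a<..<b}"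
      "emeasure lborel (\<Union>D) < ennreal d"
    have iv: "Inf I < Sup I" "I = {Inf I<..<Sup I}" "a \<le> Inf I" "Sup I \<le> b" if "I \<in> D" for I
      by (intro open_connected_eq_greaterThanLessThan[of I a b]; use bspec[OF D(3) that] in blast)+
    obtain h where h: "bij_betw h {..<card D} D"
      using ex_bij_betw_nat_finite[OF D(1)] by (auto simp: atLeast0LessThan)
    then have hD: "h i \<in> D" if "i < card D" for i
      using that bij_betwE by fastforce
    have len: "(\<Sum>I\<in>D. ennreal (Sup I - Inf I)) = emeasure lborel (\<Union>D)"
    proof -
      have "(\<Sum>I\<in>D. ennreal (Sup I - Inf I)) = (\<Sum>I\<in>D. emeasure lborel I)"
      proof (rule sum.cong[OF refl])
        fix I assume "I \<in> D"
        then show "ennreal (Sup I - Inf I) = emeasure lborel I"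
          using iv(1,2) emeasure_lborel_Ioo[of "Inf I" "Sup I"] by (metis less_imp_le)
      qed
      also have "\<dots> = emeasure lborel (\<Union>I\<in>D. I)"
        using D(1,2,3) by (intro sum_emeasure)
          (auto simp: disjoint_def disjoint_family_on_def intro: borel_open)
      finally show ?thesis by simp
    qed
    have "(\<Sum>i<card D. \<bar>F (Sup (h i)) - F (Inf (h i))\<bar>) < e"
    proof (rule d)
      show "\<forall>i<card D. a \<le> Inf (h i) \<and> Inf (h i) \<le> Sup (h i) \<and> Sup (h i) \<le> b"
        using iv(1,3,4) hD by (meson less_imp_le)
      show "disjoint_family_on (\<lambda>i. {Inf (h i)<..<Sup (h i)}) {..<card D}"
        unfolding disjoint_family_on_def
      proof (intro ballI impI)
        fix i j assume ij: "i \<in> {..<card D}" "j \<in> {..<card D}" "i \<noteq> j"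
        then have "h i \<noteq> h j" using h by (metis bij_betw_inv_into_left)
        then have "h i \<inter> h j = {}" using D(2) hD ij by (auto simp: disjoint_def)
        then show "{Inf (h i)<..<Sup (h i)} \<inter> {Inf (h j)<..<Sup (h j)} = {}"
          using iv(2)[of "h i"] iv(2)[of "h j"] hD ij by simp
      qed
      have "ennreal (\<Sum>i<card D. Sup (h i) - Inf (h i)) = ennreal (\<Sum>I\<in>D. Sup I - Inf I)"
        using sum.reindex_bij_betw[OF h, of "\<lambda>I. Sup I - Inf I"] by simp
      also have "\<dots> = (\<Sum>I\<in>D. ennreal (Sup I - Inf I))"
        by (rule sum_ennreal[symmetric]) (use iv(1) in force)
      also have "\<dots> < ennreal d" using len D(4) by simp
      finally show "(\<Sum>i<card D. Sup (h i) - Inf (h i)) < d"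
        by (metis ennreal_leI not_le)
    qed
    also have "(\<Sum>i<card D. \<bar>F (Sup (h i)) - F (Inf (h i))\<bar>) = (\<Sum>I\<in>D. \<bar>F (Sup I) - F (Inf I)\<bar>)"
      using sum.reindex_bij_betw[OF h, of "\<lambda>I. \<bar>F (Sup I) - F (Inf I)\<bar>"] by simp
    also have "\<dots> = (\<Sum>I\<in>D. F (Sup I) - F (Inf I))"
      using iv(1) mono by (intro sum.cong refl) (simp add: monoD less_imp_le)
    finally show "(\<Sum>I\<in>D. F (Sup I) - F (Inf I)) < e" .
  qed
qed

text \<open>Finite unions of components of \<open>U\<close> are covered by the preceding lemma with
  a \<open>d\<close> that does not depend on their number. Continuity from below passes to all of
  \<open>U\<close>, and only \<open>\<le>\<close> survives the supremum.\<close>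

lemma emeasure_interval_measure_open_le:
  assumes ac: "absolutely_continuous_on a b F" and mono: "mono F" and cont: "continuous_on UNIV F" and "e > 0"
  shows "\<exists>d>0. \<forall>U. open U \<longrightarrow> U \<subseteq> {a<..<b} \<longrightarrow> emeasure lborel U < ennreal d
      \<longrightarrow> emeasure (interval_measure F) U \<le> ennreal e"
proof -
  obtain d where "d > 0" and d: "\<forall>D. finite D \<longrightarrow> disjoint D \<longrightarrow>
      (\<forall>I\<in>D. open I \<and> connected I \<and> I \<noteq> {} \<and> I \<subseteq> {a<..<b}) \<longrightarrow> emeasure lborel (\<Union>D) < ennreal d
      \<longrightarrow> (\<Sum>I\<in>D. F (Sup I) - F (Inf I)) < e"
    using absolutely_continuous_on_finite_open_intervals[OF ac mono \<open>e > 0\<close>] by blast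
  have mon: "\<And>x y. x \<le> y \<Longrightarrow> F x \<le> F y" using mono by (simp add: monoD)
  have rc: "\<And>a. continuous (at_right a) F"
    using cont continuous_on_eq_continuous_at continuous_at_imp_continuous_within by blast
  show ?thesis
  proof (intro exI[of _ d] conjI[OF \<open>d > 0\<close>] allI impI)
    fix U :: "real set" assume U: "open U" "U \<subseteq> {a<..<b}" "emeasure lborel U < ennreal d"
    let ?C = "components U"
    have C: "open I \<and> connected I \<and> I \<noteq> {} \<and> I \<subseteq> {a<..<b}" if "I \<in> ?C" for I
      using open_components[OF U(1) that] in_components_connected[OF that]
        in_components_nonempty[OF that] in_components_subset[OF that] U(2) by simp
    have iv: "Inf I < Sup I" "I = {Inf I<..<Sup I}" if "I \<in> ?C" for I
      using C[OF that] open_connected_eq_greaterThanLessThan(1,2)[of I a b] by simp_all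
    have disjC: "disjoint ?C"
      using pairwise_disjoint_components[of U] by (simp add: pairwise_def disjnt_def)
    have cnt: "countable ?C"
      by (rule countable_disjoint_open_subsets[OF _ disjC]) (rule C[THEN conjunct1])
    have fin: "emeasure (interval_measure F) (\<Union>D) \<le> ennreal e" if "finite D" "D \<subseteq> ?C" for D
    proof -
      have "I \<in> sets (interval_measure F)" if "I \<in> D" for I
        using C[of I] that \<open>D \<subseteq> ?C\<close> by auto
      then have "emeasure (interval_measure F) (\<Union>D) \<le> (\<Sum>I\<in>D. emeasure (interval_measure F) I)"
        using emeasure_subadditive_finite[OF that(1), of "\<lambda>I. I" "interval_measure F"] by auto
      also have "\<dots> \<le> (\<Sum>I\<in>D. ennreal (F (Sup I) - F (Inf I)))"
      proof (rule sum_mono)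
        fix I assume "I \<in> D"
        then have I: "I \<in> ?C" using that(2) by (rule subsetD[rotated])
        have "emeasure (interval_measure F) I \<le> emeasure (interval_measure F) {Inf I<..Sup I}"
          by (intro emeasure_mono subset_trans[OF equalityD1[OF iv(2)[OF I]]]) auto
        also have "\<dots> = ennreal (F (Sup I) - F (Inf I))"
          using iv(1)[OF I] by (intro emeasure_interval_measure_Ioc mon rc) auto
        finally show "emeasure (interval_measure F) I \<le> ennreal (F (Sup I) - F (Inf I))" .
      qed
      also have "\<dots> = ennreal (\<Sum>I\<in>D. F (Sup I) - F (Inf I))"
      proof (rule sum_ennreal)
        fix I assume "I \<in> D"
        then have "Inf I < Sup I"
          using that(2) by (intro iv(1)) (rule subsetD)
        then show "0 \<le> F (Sup I) - F (Inf I)" using mon by simp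
      qed
      also have "\<dots> \<le> ennreal e"
      proof (intro ennreal_leI less_imp_le d[rule_format] that(1))
        show "disjoint D"
          using disjC that(2) by (rule pairwise_subset)
        show "emeasure lborel (\<Union>D) < ennreal d"
        proof (rule le_less_trans[OF emeasure_mono U(3)])
          show "\<Union>D \<subseteq> U" using that(2) in_components_subset by blast
        qed (use U(1) in auto)
      qed (rule C[OF subsetD[OF that(2)]])
      finally show ?thesis .
    qed
    show "emeasure (interval_measure F) U \<le> ennreal e"
    proof (cases "?C = {}")
      case True
      then show ?thesis by (simp add: components_eq_empty)
    next
      case False
      \<comment> \<open>\<open>from_nat_into\<close> enumerates a countable nonempty set, possibly
        with repetitions; these do no harm, since \<open>A n\<close> is a union over an
        image.\<close>
      define A where "A n = \<Union>(from_nat_into ?C ` {..<n})" for n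
      have sub: "from_nat_into ?C ` {..<n} \<subseteq> ?C" for n
        using False from_nat_into by blast
      have "(\<Union>n. A n) = \<Union>?C"
      proof
        show "(\<Union>n. A n) \<subseteq> \<Union>?C" unfolding A_def using sub by blast
        show "\<Union>?C \<subseteq> (\<Union>n. A n)"
        proof
          fix x assume "x \<in> \<Union>?C"
          then obtain I where I: "I \<in> ?C" "x \<in> I" by blast
          then obtain n where "from_nat_into ?C n = I" using cnt from_nat_into_surj by metis
          then have "x \<in> A (Suc n)" unfolding A_def using I by blast
          then show "x \<in> (\<Union>n. A n)" by blast
        qed
      qed
      then have "U = (\<Union>n. A n)" by simp
      moreover have "(SUP n. emeasure (interval_measure F) (A n)) = emeasure (interval_measure F) (\<Union>n. A n)"
      proof (rule SUP_emeasure_incseq)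
        show "range A \<subseteq> sets (interval_measure F)"
          unfolding A_def using sub C by (auto intro!: borel_open open_Union)
        show "incseq A" unfolding A_def incseq_def by (force)
      qed
      moreover have "(SUP n. emeasure (interval_measure F) (A n)) \<le> ennreal e"
        unfolding A_def by (intro SUP_least fin sub) auto
      ultimately show ?thesis by simp
    qed
  qed
qed

text \<open>A null set lies in open sets of arbitrarily small length, whose Stieltjes measure is
  then arbitrarily small too. The modulus \<open>d\<close> belongs to a bounded interval, so null
  sets are first taken inside \<open>{a<..<b}\<close> and the line is exhausted at the end.\<close>

lemma interval_measure_absolutely_continuous:
  assumes lac: "locally_absolutely_continuous F" and mono: "mono F"
  shows "absolutely_continuous lborel (interval_measure F)"
proof -
  have cont: "continuous_on UNIV F"
    using lac by (rule locally_absolutely_continuous_imp_continuous_on)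
  have bd: "N \<in> null_sets (interval_measure F)"
    if N: "N \<in> null_sets lborel" "N \<subseteq> {a<..<b}" and "a \<le> b" for N a b
  proof -
    have sN: "N \<in> sets borel" using N by auto
    have "emeasure (interval_measure F) N \<le> 0 + ennreal e" if "e > 0" for e
    proof -
      have "absolutely_continuous_on a b F"
        using lac \<open>a \<le> b\<close> unfolding locally_absolutely_continuous_def by blast
      then obtain d where d: "d > 0"
        "\<forall>U. open U \<longrightarrow> U \<subseteq> {a<..<b} \<longrightarrow> emeasure lborel U < ennreal d
          \<longrightarrow> emeasure (interval_measure F) U \<le> ennreal e"
        using emeasure_interval_measure_open_le[OF _ mono cont \<open>e > 0\<close>] by blast
      \<comment> \<open>Outer regularity bounds \<open>U - N\<close>; as \<open>N\<close> is null,
        this bounds \<open>U\<close> itself.\<close>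
      obtain U where U: "open U" "N \<subseteq> U" "emeasure lborel (U - N) < ennreal d"
        using outer_regular_lborel[OF sN d(1)] .
      have "emeasure lborel (U \<inter> {a<..<b}) \<le> emeasure lborel ((U - N) \<union> N)"
        using U sN by (intro emeasure_mono) auto
      also have "\<dots> \<le> emeasure lborel (U - N) + emeasure lborel N"
        using U sN by (intro emeasure_subadditive) auto
      also have "\<dots> < ennreal d" using U(3) N(1) by (simp add: null_setsD1)
      finally have "emeasure (interval_measure F) (U \<inter> {a<..<b}) \<le> ennreal e"
        using d(2) U(1) by (meson Int_lower2 open_Int open_greaterThanLessThan)
      moreover have "emeasure (interval_measure F) N \<le> emeasure (interval_measure F) (U \<inter> {a<..<b})"
        using U N(2) sN by (intro emeasure_mono) auto
      ultimately show ?thesis by simp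
    qed
    then have "emeasure (interval_measure F) N \<le> 0"
      by (rule ennreal_le_epsilon) auto
    then show ?thesis using sN by auto
  qed
  have "N \<in> null_sets (interval_measure F)" if N: "N \<in> null_sets lborel" for N
  proof -
    have "N \<inter> {-real n<..<real n} \<in> null_sets (interval_measure F)" for n
      using N by (intro bd[of _ "- real n" "real n"]) (auto intro: null_set_Int2)
    then have "(\<Union>n. N \<inter> {-real n<..<real n}) \<in> null_sets (interval_measure F)"
      by (rule null_sets_UN)
    moreover have "(\<Union>n. N \<inter> {-real n<..<real n}) = N"
    proof -
      have "\<exists>n. x \<in> {-real n<..<real n}" for x
        using reals_Archimedean2[of "\<bar>x\<bar>"] by (metis abs_less_iff greaterThanLessThan_iff minus_less_iff)
      then show ?thesis by blast
    qed
    ultimately show ?thesis by simp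
  qed
  then show ?thesis unfolding absolutely_continuous_def by blast
qed

subsection \<open>Densities\<close>

text \<open>A density is a representative, fixed only almost everywhere, but it is asked to be Borel
  and nonnegative at every point, so that it can be composed with lifts and fed to
  \<open>nn_integral\<close>. The finite right-hand side makes it locally integrable.\<close>

definition has_density :: "(real \<Rightarrow> real) \<Rightarrow> (real \<Rightarrow> real) \<Rightarrow> bool"
  where "has_density F \<phi> \<longleftrightarrow> mono F \<and> \<phi> \<in> borel_measurable borel \<and> (\<forall>t. 0 \<le> \<phi> t) \<and>
    (\<forall>a b. a \<le> b \<longrightarrow> (\<integral>\<^sup>+t. ennreal (\<phi> t) * indicator {a..b} t \<partial>lborel) = ennreal (F b - F a))"

lemma has_densityD:
  assumes "has_density F \<phi>"
  shows "mono F" and "\<phi> \<in> borel_measurable borel" and "0 \<le> \<phi> t"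
    and "a \<le> b \<Longrightarrow> (\<integral>\<^sup>+t. ennreal (\<phi> t) * indicator {a..b} t \<partial>lborel) = ennreal (F b - F a)"
  using assms by (auto simp: has_density_def)

lemma has_density_shift: "has_density F \<phi> \<Longrightarrow> has_density (\<lambda>x. F x + c) \<phi>"
  by (auto simp: has_density_def mono_def)

text \<open>Radon-Nikodym for the Stieltjes measure of \<open>F\<close>.\<close>

lemma locally_absolutely_continuous_imp_has_density:
  assumes lac: "locally_absolutely_continuous F" and mono: "mono F"
  obtains \<phi> where "has_density F \<phi>"
proof -
  have cont: "continuous_on UNIV F"
    using lac by (rule locally_absolutely_continuous_imp_continuous_on)
  have mon: "\<And>x y. x \<le> y \<Longrightarrow> F x \<le> F y" using mono by (simp add: monoD)
  have rc: "\<And>a. continuous (at_right a) F"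
    using cont continuous_on_eq_continuous_at continuous_at_imp_continuous_within by blast
  obtain f where f[measurable]: "f \<in> borel_measurable lborel" and dens: "density lborel f = interval_measure F"
    using sigma_finite_measure.Radon_Nikodym[OF sigma_finite_lborel interval_measure_absolutely_continuous[OF lac mono]] by auto
  \<comment> \<open>Sigma-finiteness of the Stieltjes measure forces the
    \<open>ennreal\<close>-valued derivative to be finite almost everywhere, so
    \<open>enn2real\<close> changes no integral.\<close>
  have fin: "AE x in lborel. f x \<noteq> \<infinity>"
    using sigma_finite_measure.sigma_finite_iff_density_finite[OF sigma_finite_lborel f] dens sigma_finite_interval_measure[of F] mon rc
    by simp
  have "has_density F (\<lambda>x. enn2real (f x))"
    unfolding has_density_def
  proof (intro conjI allI impI mono)
    show "(\<lambda>x. enn2real (f x)) \<in> borel_measurable borel" using f by simp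
    fix a b :: real assume "a \<le> b"
    have "(\<integral>\<^sup>+t. ennreal (enn2real (f t)) * indicator {a..b} t \<partial>lborel) = (\<integral>\<^sup>+t. f t * indicator {a..b} t \<partial>lborel)"
      using fin by (intro nn_integral_cong_AE) (auto simp: less_top)
    also have "\<dots> = emeasure (interval_measure F) {a..b}"
      unfolding dens[symmetric] by (simp add: emeasure_density)
    also have "\<dots> = ennreal (F b - F a)"
      by (rule emeasure_interval_measure_Icc[OF \<open>a \<le> b\<close> mon cont])
    finally show "(\<integral>\<^sup>+t. ennreal (enn2real (f t)) * indicator {a..b} t \<partial>lborel) = ennreal (F b - F a)" .
  qed simp
  then show thesis by (rule that)
qed

text \<open>Bridge to the gauge integral, the setting of the differentiation theorem
  \<open>integrable_ccontinuous_explicit\<close>.\<close>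

lemma has_density_has_integral:
  assumes "has_density F \<phi>" and "a \<le> b"
  shows "(\<phi> has_integral (F b - F a)) {a..b}"
proof -
  have "((\<lambda>t. \<phi> t * indicator {a..b} t) has_integral (F b - F a)) UNIV"
  proof (rule nn_integral_has_integral)
    show "(\<lambda>t. \<phi> t * indicator {a..b} t) \<in> borel_measurable borel"
      using has_densityD(2)[OF assms(1)] by measurable
    show "(\<integral>\<^sup>+t. ennreal (\<phi> t * indicator {a..b} t) \<partial>lborel) = ennreal (F b - F a)"
      using has_densityD(4)[OF assms] by (simp add: ennreal_mult'' ennreal_indicator)
    show "0 \<le> F b - F a"
      using has_densityD(1)[OF assms(1)] assms(2) by (simp add: mono_def)
  qed (use has_densityD(3)[OF assms(1)] in auto)
  then have "((\<lambda>t. if t \<in> {a..b} then \<phi> t else 0) has_integral (F b - F a)) UNIV"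
    by (rule has_integral_eq[rotated]) auto
  then show ?thesis
    by (simp only: has_integral_restrict_UNIV)
qed

text \<open>Exchanges left and right difference quotients.\<close>

lemma has_density_reflect:
  assumes "has_density F \<phi>"
  shows "has_density (\<lambda>x. - F (- x)) (\<lambda>x. \<phi> (- x))"
  unfolding has_density_def
proof (intro conjI allI impI)
  note [measurable] = has_densityD(2)[OF assms]
  show "mono (\<lambda>x. - F (- x))" using has_densityD(1)[OF assms] by (simp add: mono_def)
  show "(\<lambda>x. \<phi> (- x)) \<in> borel_measurable borel" by measurable
  show "0 \<le> \<phi> (- t)" for t by (rule has_densityD(3)[OF assms])
  fix a b :: real assume "a \<le> b"
  have "(\<integral>\<^sup>+t. ennreal (\<phi> (- t)) * indicator {a..b} t \<partial>lborel)
      = (\<integral>\<^sup>+t. ennreal (\<phi> (- t)) * indicator {-b.. -a} (-t) \<partial>distr lborel borel uminus)"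
    by (simp add: lborel_distr_uminus indicator_def minus_le_iff le_minus_iff conj_commute)
  also have "\<dots> = (\<integral>\<^sup>+t. ennreal (\<phi> t) * indicator {-b.. -a} t \<partial>lborel)"
    by (subst nn_integral_distr) auto
  also have "\<dots> = ennreal (F (- a) - F (- b))"
    using \<open>a \<le> b\<close> by (intro has_densityD(4)[OF assms]) simp
  finally show "(\<integral>\<^sup>+t. ennreal (\<phi> (- t)) * indicator {a..b} t \<partial>lborel) = ennreal (- F (- b) - - F (- a))"
    by simp
qed

lemma has_density_right_derivative:
  assumes "has_density F \<phi>"
  obtains N where "negligible N" and
    "\<And>x e. \<lbrakk>x \<notin> N; 0 < e\<rbrakk> \<Longrightarrow> \<exists>d>0. \<forall>h. 0 < h \<and> h < d \<longrightarrow> \<bar>(F (x + h) - F x) / h - \<phi> x\<bar> < e"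
proof -
  have "\<phi> integrable_on cbox a b" for a b
  proof (cases "a \<le> b")
    case True
    then show ?thesis using has_density_has_integral[OF assms] by (auto intro: has_integral_integrable)
  qed auto
  \<comment> \<open>Lebesgue differentiation over the intervals \<open>{x..x + h}\<close> with
    \<open>h > 0\<close>; hence only right quotients are reached.\<close>
  then obtain N where N: "negligible N"
    "\<And>x e. \<lbrakk>x \<notin> N; 0 < e\<rbrakk> \<Longrightarrow> \<exists>d>0. \<forall>h. 0 < h \<and> h < d \<longrightarrow>
       norm (integral (cbox x (x + h *\<^sub>R One)) \<phi> /\<^sub>R h ^ DIM(real) - \<phi> x) < e"
    by (rule integrable_ccontinuous_explicit) blast
  show thesis
  proof (rule that[OF N(1)])
    fix x e :: real assume "x \<notin> N" "0 < e"
    then obtain d where d: "d > 0" "\<And>h. 0 < h \<Longrightarrow> h < d \<Longrightarrow>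
       norm (integral (cbox x (x + h *\<^sub>R One)) \<phi> /\<^sub>R h ^ DIM(real) - \<phi> x) < e"
      using N(2)[OF \<open>x \<notin> N\<close> \<open>0 < e\<close>] by blast
    have "\<bar>(F (x + h) - F x) / h - \<phi> x\<bar> < e" if "0 < h" "h < d" for h
      using d(2)[OF that] integral_unique[OF has_density_has_integral[OF assms, of x "x + h"]] that
      by (simp add: divide_inverse mult.commute)
    then show "\<exists>d>0. \<forall>h. 0 < h \<and> h < d \<longrightarrow> \<bar>(F (x + h) - F x) / h - \<phi> x\<bar> < e"
      using d(1) by blast
  qed
qed

text \<open>Right quotients converge by the preceding lemma; applied to the reflected function, it
  also yields the left ones, off the reflected exceptional set.\<close>

theorem has_density_AE_deriv:
  assumes "has_density F \<phi>"
  shows "AE x in lborel. (F has_real_derivative \<phi> x) (at x)"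
proof -
  obtain N where N: "negligible N"
    "\<And>x e. \<lbrakk>x \<notin> N; 0 < e\<rbrakk> \<Longrightarrow> \<exists>d>0. \<forall>h. 0 < h \<and> h < d \<longrightarrow> \<bar>(F (x + h) - F x) / h - \<phi> x\<bar> < e"
    using has_density_right_derivative[OF assms] by blast
  obtain N' where N': "negligible N'"
    "\<And>x e. \<lbrakk>x \<notin> N'; 0 < e\<rbrakk> \<Longrightarrow> \<exists>d>0. \<forall>h. 0 < h \<and> h < d \<longrightarrow> \<bar>(- F (- (x + h)) - - F (- x)) / h - \<phi> (- x)\<bar> < e"
    using has_density_right_derivative[OF has_density_reflect[OF assms]] by blast
  have "negligible (uminus ` N')"
    by (rule negligible_differentiable_image_negligible[OF order_refl N'(1)]) (auto intro!: derivative_intros)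
  then have "negligible (N \<union> uminus ` N')" using N(1) negligible_Un by blast
  moreover have "(F has_real_derivative \<phi> x) (at x)" if "x \<notin> N \<union> uminus ` N'" for x
    unfolding DERIV_def
  proof (rule LIM_I)
    fix e :: real assume "e > 0"
    have "- x \<notin> N'" using that by force
    then obtain d1 where d1: "d1 > 0" "\<And>h. 0 < h \<Longrightarrow> h < d1 \<Longrightarrow> \<bar>(- F (- (- x + h)) - - F (- (- x))) / h - \<phi> (- (- x))\<bar> < e"
      using N'(2)[OF \<open>- x \<notin> N'\<close> \<open>e > 0\<close>] by blast
    have "x \<notin> N" using that by blast
    then obtain d2 where d2: "d2 > 0" "\<And>h. 0 < h \<Longrightarrow> h < d2 \<Longrightarrow> \<bar>(F (x + h) - F x) / h - \<phi> x\<bar> < e"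
      using N(2)[OF \<open>x \<notin> N\<close> \<open>e > 0\<close>] by blast
    have "norm ((F (x + h) - F x) / h - \<phi> x) < e" if "h \<noteq> 0" "norm (h - 0) < min d1 d2" for h
    proof (cases "h > 0")
      case True
      then show ?thesis using d2(2)[of h] that by simp
    next
      case False
      have "(- F (- (- x + - h)) - - F (- (- x))) / (- h) = (F (x + h) - F x) / h"
        by (simp add: algebra_simps diff_divide_distrib)
      then show ?thesis using d1(2)[of "- h"] that False by simp
    qed
    then show "\<exists>s>0. \<forall>h. h \<noteq> 0 \<and> norm (h - 0) < s \<longrightarrow> norm ((F (x + h) - F x) / h - \<phi> x) < e"
      using d1(1) d2(1) by (intro exI[of _ "min d1 d2"]) auto
  qed
  ultimately have "AE x in lebesgue. (F has_real_derivative \<phi> x) (at x)"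
    by (intro AE_I'[of "N \<union> uminus ` N'"]) (auto simp: negligible_iff_null_sets)
  then show ?thesis by (simp add: AE_completion_iff)
qed

text \<open>The excess over height \<open>n\<close> vanishes pointwise from some \<open>n\<close> on
  and is dominated by the function itself.\<close>

lemma nn_integral_truncation_tendsto_0:
  fixes \<phi> :: "real \<Rightarrow> real"
  assumes [measurable]: "\<phi> \<in> borel_measurable borel"
    and "(\<integral>\<^sup>+t. ennreal (\<phi> t) * indicator {a..b} t \<partial>lborel) < \<infinity>"
  shows "(\<lambda>n. \<integral>\<^sup>+t. ennreal (max 0 (\<phi> t - real n)) * indicator {a..b} t \<partial>lborel) \<longlonglongrightarrow> 0"
proof -
  have "(\<lambda>n. \<integral>\<^sup>+t. ennreal (max 0 (\<phi> t - real n)) * indicator {a..b} t \<partial>lborel)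
      \<longlonglongrightarrow> integral\<^sup>N lborel (\<lambda>t::real. 0)"
  proof (rule nn_integral_dominated_convergence[where w = "\<lambda>t. ennreal (\<phi> t) * indicator {a..b} t"])
    show "AE t in lborel. (\<lambda>n. ennreal (max 0 (\<phi> t - real n)) * indicator {a..b} t) \<longlonglongrightarrow> 0"
    proof (rule AE_I2)
      fix t
      obtain m where "\<phi> t \<le> real m" using real_arch_simple by blast
      then have "\<forall>n\<ge>m. ennreal (max 0 (\<phi> t - real n)) * indicator {a..b} t = 0"
        by (auto simp: max_def)
      then show "(\<lambda>n. ennreal (max 0 (\<phi> t - real n)) * indicator {a..b} t) \<longlonglongrightarrow> 0"
        by (intro tendsto_eventually eventually_sequentiallyI) blast
    qed
    show "AE t in lborel. ennreal (max 0 (\<phi> t - real n)) * indicator {a..b} t \<le> ennreal (\<phi> t) * indicator {a..b} t" for n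
    proof (rule AE_I2, rule mult_right_mono)
      fix t
      have "max 0 (\<phi> t - real n) \<le> max 0 (\<phi> t)" by auto
      then have "ennreal (max 0 (\<phi> t - real n)) \<le> ennreal (max 0 (\<phi> t))" by (rule ennreal_leI)
      then show "ennreal (max 0 (\<phi> t - real n)) \<le> ennreal (\<phi> t)"
        by (auto simp: max_def ennreal_neg split: if_splits)
    qed simp
  qed (use assms in auto)
  then show ?thesis by simp
qed

lemma nn_integral_Icc_eq_Ioo:
  fixes f :: "real \<Rightarrow> ennreal"
  shows "(\<integral>\<^sup>+t. f t * indicator {a..b} t \<partial>lborel) = (\<integral>\<^sup>+t. f t * indicator {a<..<b} t \<partial>lborel)"
proof (rule nn_integral_cong_AE)
  show "AE t in lborel. f t * indicator {a..b} t = f t * indicator {a<..<b} t"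
    using AE_lborel_singleton[of a] AE_lborel_singleton[of b]
    by eventually_elim (auto simp: indicator_def)
qed

text \<open>Uniform integrability: above height \<open>n\<close> the density has integral below
  \<open>e/2\<close>, and up to that height a set of length less than \<open>d\<close> contributes
  at most \<open>n * d\<close>.\<close>

lemma has_density_imp_locally_absolutely_continuous:
  assumes "has_density F \<phi>"
  shows "locally_absolutely_continuous F"
  unfolding locally_absolutely_continuous_def absolutely_continuous_on_def
proof (intro allI impI)
  note [measurable] = has_densityD(2)[OF assms]
  fix a b e :: real assume "a \<le> b" "e > 0"
  have "(\<integral>\<^sup>+t. ennreal (\<phi> t) * indicator {a..b} t \<partial>lborel) < \<infinity>"
    using has_densityD(4)[OF assms \<open>a \<le> b\<close>] by simp
  then have "(\<lambda>n. \<integral>\<^sup>+t. ennreal (max 0 (\<phi> t - real n)) * indicator {a..b} t \<partial>lborel) \<longlonglongrightarrow> 0"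
    by (rule nn_integral_truncation_tendsto_0[rotated]) measurable
  then have "\<forall>\<^sub>F n in sequentially. (\<integral>\<^sup>+t. ennreal (max 0 (\<phi> t - real n)) * indicator {a..b} t \<partial>lborel) < ennreal (e/2)"
    using \<open>e > 0\<close> by (intro order_tendstoD) auto
  then obtain n where n: "(\<integral>\<^sup>+t. ennreal (max 0 (\<phi> t - real n)) * indicator {a..b} t \<partial>lborel) < ennreal (e/2)"
    by (auto simp: eventually_sequentially)
  \<comment> \<open>Gives \<open>real n * d \<le> e/2\<close>; the added 1 keeps the denominator
    positive when \<open>n = 0\<close>.\<close>
  define d where "d = e / (2 * (real n + 1))"
  have "d > 0" using \<open>e > 0\<close> by (simp add: d_def)
  show "\<exists>\<delta>>0. \<forall>(m::nat) s t. (\<forall>i<m. a \<le> s i \<and> s i \<le> t i \<and> t i \<le> b) \<longrightarrow>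
          disjoint_family_on (\<lambda>i. {s i<..<t i}) {..<m} \<longrightarrow>
          (\<Sum>i<m. t i - s i) < \<delta> \<longrightarrow> (\<Sum>i<m. \<bar>F (t i) - F (s i)\<bar>) < e"
  proof (intro exI[of _ d] conjI[OF \<open>d > 0\<close>] allI impI)
    fix m :: nat and s t :: "nat \<Rightarrow> real"
    assume st: "\<forall>i<m. a \<le> s i \<and> s i \<le> t i \<and> t i \<le> b"
      and disj: "disjoint_family_on (\<lambda>i. {s i<..<t i}) {..<m}"
      and len: "(\<Sum>i<m. t i - s i) < d"
    define U where "U = (\<Union>i<m. {s i<..<t i})"
    have U[measurable]: "U \<in> sets borel" unfolding U_def by auto
    have ind: "(\<Sum>i<m. indicator {s i<..<t i} x) = (indicator U x :: ennreal)" for x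
      unfolding U_def by (subst indicator_UN_disjoint) (use disj in auto)
    have UI: "(\<Sum>i<m. \<integral>\<^sup>+x. f x * indicator {s i<..<t i} x \<partial>lborel) = (\<integral>\<^sup>+x. f x * indicator U x \<partial>lborel)"
      if [measurable]: "f \<in> borel_measurable borel" for f :: "real \<Rightarrow> ennreal"
      by (subst nn_integral_sum[symmetric]) (auto simp: ind simp flip: sum_distrib_left)
    have "ennreal (\<Sum>i<m. \<bar>F (t i) - F (s i)\<bar>) = (\<Sum>i<m. ennreal (F (t i) - F (s i)))"
      using st has_densityD(1)[OF assms] by (subst sum_ennreal[symmetric]) (auto intro!: sum.cong simp: monoD)
    also have "\<dots> = (\<Sum>i<m. \<integral>\<^sup>+x. ennreal (\<phi> x) * indicator {s i<..<t i} x \<partial>lborel)"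
      using st by (intro sum.cong refl) (simp flip: has_densityD(4)[OF assms] add: nn_integral_Icc_eq_Ioo)
    also have "\<dots> = (\<integral>\<^sup>+x. ennreal (\<phi> x) * indicator U x \<partial>lborel)"
      by (rule UI) measurable
    also have "\<dots> \<le> (\<integral>\<^sup>+x. ennreal (max 0 (\<phi> x - real n)) * indicator {a..b} x + ennreal (real n) * indicator U x \<partial>lborel)"
    proof (rule nn_integral_mono)
      fix x
      have "U \<subseteq> {a..b}" unfolding U_def using st by force
      moreover have "ennreal (\<phi> x) \<le> ennreal (max 0 (\<phi> x - real n)) + ennreal (real n)"
        by (cases "\<phi> x \<le> real n") (auto simp: max_def ennreal_leI simp flip: ennreal_plus)
      ultimately show "ennreal (\<phi> x) * indicator U x \<le> ennreal (max 0 (\<phi> x - real n)) * indicator {a..b} x + ennreal (real n) * indicator U x"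
        by (auto simp: indicator_def)
    qed
    also have "\<dots> = (\<integral>\<^sup>+x. ennreal (max 0 (\<phi> x - real n)) * indicator {a..b} x \<partial>lborel)
        + (\<integral>\<^sup>+x. ennreal (real n) * indicator U x \<partial>lborel)"
      by (intro nn_integral_add) measurable
    also have "(\<integral>\<^sup>+x. ennreal (real n) * indicator U x \<partial>lborel) = (\<Sum>i<m. \<integral>\<^sup>+x. ennreal (real n) * indicator {s i<..<t i} x \<partial>lborel)"
      by (rule UI[symmetric]) measurable
    also have "\<dots> = (\<Sum>i<m. ennreal (real n * (t i - s i)))"
      using st by (intro sum.cong refl) (simp add: nn_integral_cmult_indicator ennreal_mult')
    also have "\<dots> = ennreal (real n * (\<Sum>i<m. t i - s i))"
      using st by (subst sum_ennreal) (auto simp: sum_distrib_left)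
    also have "\<dots> \<le> ennreal (e/2)"
    proof (rule ennreal_leI)
      have "real n * (\<Sum>i<m. t i - s i) \<le> real n * d"
        using len by (intro mult_left_mono) auto
      also have "\<dots> \<le> e/2"
        using \<open>e > 0\<close> by (simp add: d_def field_simps)
      finally show "real n * (\<Sum>i<m. t i - s i) \<le> e/2" .
    qed
    finally have "ennreal (\<Sum>i<m. \<bar>F (t i) - F (s i)\<bar>)
       \<le> (\<integral>\<^sup>+x. ennreal (max 0 (\<phi> x - real n)) * indicator {a..b} x \<partial>lborel) + ennreal (e/2)"
      by (auto intro: add_left_mono)
    also have "\<dots> < ennreal (e/2) + ennreal (e/2)"
      using n by (simp add: ennreal_add_left_cancel_less add.commute)
    also have "\<dots> = ennreal e"
      using \<open>e > 0\<close> by (simp flip: ennreal_plus)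
    finally show "(\<Sum>i<m. \<bar>F (t i) - F (s i)\<bar>) < e"
      by (metis ennreal_leI not_le)
  qed
qed

section \<open>Substitution and the chain rule for densities\<close>

text \<open>Both measures give the interval with ends \<open>G a\<close> and \<open>G b\<close> the
  mass \<open>G b - G a\<close>, every bounded interval has this form by surjectivity, and intervals
  determine the measure.\<close>

lemma has_density_distr:
  assumes "has_density G \<gamma>" and "strict_mono G" and "surj G"
  shows "distr (density lborel (\<lambda>t. ennreal (\<gamma> t))) borel G = lborel"
proof (rule lborel_eqI[symmetric])
  note [measurable] = has_densityD(2)[OF assms(1)]
  have [measurable]: "G \<in> borel_measurable borel"
    using has_densityD(1)[OF assms(1)] by (rule borel_measurable_mono)
  fix l u :: real assume lu: "\<And>b. b \<in> Basis \<Longrightarrow> l \<bullet> b \<le> u \<bullet> b"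
  obtain a b where ab: "G a = l" "G b = u" using assms(3) by (metis surjD)
  then have "a \<le> b" using lu[of 1] strict_mono_less_eq[OF assms(2), of a b] by simp
  have vim: "G -` {l<..<u} = {a<..<b}"
    using assms(2) by (auto simp: ab[symmetric] strict_mono_less)
  have "emeasure (distr (density lborel (\<lambda>t. ennreal (\<gamma> t))) borel G) (box l u)
      = (\<integral>\<^sup>+t. ennreal (\<gamma> t) * indicator {a<..<b} t \<partial>lborel)"
    by (subst emeasure_distr) (auto simp: vim emeasure_density)
  also have "\<dots> = ennreal (G b - G a)"
    by (simp add: has_densityD(4)[OF assms(1) \<open>a \<le> b\<close>] flip: nn_integral_Icc_eq_Ioo)
  finally show "emeasure (distr (density lborel (\<lambda>t. ennreal (\<gamma> t))) borel G) (box l u)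
      = ennreal (\<Prod>b\<in>Basis. (u - l) \<bullet> b)"
    by (simp add: ab)
qed simp

lemma nn_integral_density_subst:
  assumes "has_density G \<gamma>" and "strict_mono G" and "surj G"
    and [measurable]: "w \<in> borel_measurable borel"
  shows "(\<integral>\<^sup>+t. w (G t) * ennreal (\<gamma> t) * indicator {a..b} t \<partial>lborel)
    = (\<integral>\<^sup>+y. w y * indicator {G a..G b} y \<partial>lborel)"
proof -
  note [measurable] = has_densityD(2)[OF assms(1)]
  have [measurable]: "G \<in> borel_measurable borel"
    using has_densityD(1)[OF assms(1)] by (rule borel_measurable_mono)
  have "(\<integral>\<^sup>+y. w y * indicator {G a..G b} y \<partial>lborel)
      = (\<integral>\<^sup>+y. w y * indicator {G a..G b} y \<partial>distr (density lborel (\<lambda>t. ennreal (\<gamma> t))) borel G)"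
    by (simp only: has_density_distr[OF assms(1-3)])
  also have "\<dots> = (\<integral>\<^sup>+t. w (G t) * indicator {G a..G b} (G t) \<partial>density lborel (\<lambda>t. ennreal (\<gamma> t)))"
    by (rule nn_integral_distr) measurable
  also have "\<dots> = (\<integral>\<^sup>+t. ennreal (\<gamma> t) * (w (G t) * indicator {G a..G b} (G t)) \<partial>lborel)"
    by (rule nn_integral_density) measurable
  also have "\<dots> = (\<integral>\<^sup>+t. w (G t) * ennreal (\<gamma> t) * indicator {a..b} t \<partial>lborel)"
    using assms(2) by (intro nn_integral_cong) (auto simp: indicator_def strict_mono_less_eq mult.commute)
  finally show ?thesis by simp
qed

text \<open>The substitution rule with the density of \<open>F\<close> as integrand.\<close>

lemma has_density_compose:
  assumes F: "has_density F \<phi>" and G: "has_density G \<gamma>" "strict_mono G" "surj G"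
  shows "has_density (F \<circ> G) (\<lambda>t. \<phi> (G t) * \<gamma> t)"
  unfolding has_density_def
proof (intro conjI allI impI)
  note [measurable] = has_densityD(2)[OF F] has_densityD(2)[OF G(1)]
  have [measurable]: "G \<in> borel_measurable borel"
    using has_densityD(1)[OF G(1)] by (rule borel_measurable_mono)
  show "(\<lambda>t. \<phi> (G t) * \<gamma> t) \<in> borel_measurable borel" by measurable
  show "mono (F \<circ> G)"
    using has_densityD(1)[OF F] has_densityD(1)[OF G(1)] by (simp add: mono_def)
  show "0 \<le> \<phi> (G t) * \<gamma> t" for t
    using has_densityD(3)[OF F] has_densityD(3)[OF G(1)] by simp
  fix a b :: real assume "a \<le> b"
  have "(\<integral>\<^sup>+t. ennreal (\<phi> (G t) * \<gamma> t) * indicator {a..b} t \<partial>lborel)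
      = (\<integral>\<^sup>+t. ennreal (\<phi> (G t)) * ennreal (\<gamma> t) * indicator {a..b} t \<partial>lborel)"
    by (intro nn_integral_cong) (simp add: ennreal_mult has_densityD(3)[OF F] has_densityD(3)[OF G(1)])
  also have "\<dots> = (\<integral>\<^sup>+y. ennreal (\<phi> y) * indicator {G a..G b} y \<partial>lborel)"
    by (rule nn_integral_density_subst[OF G]) measurable
  also have "\<dots> = ennreal (F (G b) - F (G a))"
    using G(2) \<open>a \<le> b\<close> by (intro has_densityD(4)[OF F]) (simp add: strict_mono_less_eq)
  finally show "(\<integral>\<^sup>+t. ennreal (\<phi> (G t) * \<gamma> t) * indicator {a..b} t \<partial>lborel) = ennreal ((F \<circ> G) b - (F \<circ> G) a)"
    by simp
qed

section \<open>Approximation in L1\<close>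

lemma nn_integral_abs_triangle:
  fixes f g h :: "real \<Rightarrow> real"
  assumes [measurable]: "f \<in> borel_measurable borel" "g \<in> borel_measurable borel" "h \<in> borel_measurable borel"
    "w \<in> borel_measurable borel"
  shows "(\<integral>\<^sup>+t. ennreal \<bar>f t - h t\<bar> * w t \<partial>lborel)
    \<le> (\<integral>\<^sup>+t. ennreal \<bar>f t - g t\<bar> * w t \<partial>lborel) + (\<integral>\<^sup>+t. ennreal \<bar>g t - h t\<bar> * w t \<partial>lborel)"
proof -
  have "(\<integral>\<^sup>+t. ennreal \<bar>f t - h t\<bar> * w t \<partial>lborel)
     \<le> (\<integral>\<^sup>+t. ennreal \<bar>f t - g t\<bar> * w t + ennreal \<bar>g t - h t\<bar> * w t \<partial>lborel)"
  proof (rule nn_integral_mono)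
    fix t
    have "ennreal \<bar>f t - h t\<bar> \<le> ennreal (\<bar>f t - g t\<bar> + \<bar>g t - h t\<bar>)" by (intro ennreal_leI) linarith
    then have "ennreal \<bar>f t - h t\<bar> \<le> ennreal \<bar>f t - g t\<bar> + ennreal \<bar>g t - h t\<bar>" by simp
    then show "ennreal \<bar>f t - h t\<bar> * w t \<le> ennreal \<bar>f t - g t\<bar> * w t + ennreal \<bar>g t - h t\<bar> * w t"
      by (metis distrib_right mult_right_mono zero_le)
  qed
  also have "\<dots> = (\<integral>\<^sup>+t. ennreal \<bar>f t - g t\<bar> * w t \<partial>lborel) + (\<integral>\<^sup>+t. ennreal \<bar>g t - h t\<bar> * w t \<partial>lborel)"
    by (intro nn_integral_add) measurable
  finally show ?thesis .
qed

abbreviation L1_dist :: "real \<Rightarrow> real \<Rightarrow> (real \<Rightarrow> real) \<Rightarrow> (real \<Rightarrow> real) \<Rightarrow> ennreal"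
  where "L1_dist a b f g \<equiv> \<integral>\<^sup>+t. ennreal \<bar>f t - g t\<bar> * indicator {a..b} t \<partial>lborel"

text \<open>Truncation at height \<open>n\<close> costs \<open>e/2\<close>; the truncated function
  is an almost everywhere limit of continuous functions. The bound \<open>M\<close> is recorded for
  \<open>d_star_left_continuous\<close>, where it multiplies a distance of densities.\<close>

lemma continuous_dense_in_L1:
  fixes \<phi> :: "real \<Rightarrow> real"
  assumes [measurable]: "\<phi> \<in> borel_measurable borel" and nn: "\<And>t. 0 \<le> \<phi> t"
    and fin: "(\<integral>\<^sup>+t. ennreal (\<phi> t) * indicator {a..b} t \<partial>lborel) < \<infinity>" and "0 < e"
  obtains \<psi> M where "continuous_on UNIV \<psi>" and "\<And>t. 0 \<le> \<psi> t \<and> \<psi> t \<le> M"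
    and "L1_dist a b \<phi> \<psi> < ennreal e"
proof -
  have "\<forall>\<^sub>F n in sequentially. (\<integral>\<^sup>+t. ennreal (max 0 (\<phi> t - real n)) * indicator {a..b} t \<partial>lborel) < ennreal (e/2)"
    using nn_integral_truncation_tendsto_0[OF assms(1) fin] \<open>e > 0\<close> by (intro order_tendstoD) auto
  then obtain n where n: "(\<integral>\<^sup>+t. ennreal (max 0 (\<phi> t - real n)) * indicator {a..b} t \<partial>lborel) < ennreal (e/2)"
    by (auto simp: eventually_sequentially)
  define f where "f t = min (\<phi> t) (real n)" for t
  have [measurable]: "f \<in> borel_measurable borel" unfolding f_def by measurable
  have "f \<in> borel_measurable lebesgue"
    by (simp add: measurable_completion)
  then have "f measurable_on UNIV"
    by (intro lebesgue_measurable_imp_measurable_on) (simp add: measurable_restrict_space1)+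
  then obtain N g where N: "negligible N" and g: "\<And>k. continuous_on UNIV (g k)"
    "\<And>x. x \<notin> N \<Longrightarrow> (\<lambda>k. g k x) \<longlonglongrightarrow> f x"
    unfolding measurable_on_def by auto
  have gm[measurable]: "g k \<in> borel_measurable borel" for k
    using g(1) by (rule borel_measurable_continuous_onI)
  \<comment> \<open>Clamping to values between 0 and \<open>n\<close> preserves continuity and the
    limit, and provides a dominating constant.\<close>
  define h where "h k t = max 0 (min (g k t) (real n))" for k t
  have [measurable]: "h k \<in> borel_measurable borel" for k unfolding h_def by measurable
  have "(\<lambda>k. L1_dist a b f (h k)) \<longlonglongrightarrow> integral\<^sup>N lborel (\<lambda>t::real. 0)"
  proof (rule nn_integral_dominated_convergence[where w = "\<lambda>t. ennreal (real n) * indicator {a..b} t"])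
    have "AE t in lborel. t \<notin> N"
      using AE_not_in[of N lebesgue] N by (simp add: AE_completion_iff negligible_iff_null_sets)
    then show "AE t in lborel. (\<lambda>k. ennreal \<bar>f t - h k t\<bar> * indicator {a..b} t) \<longlonglongrightarrow> 0"
    proof eventually_elim
      case (elim t)
      have "(\<lambda>k. h k t) \<longlonglongrightarrow> max 0 (min (f t) (real n))"
        unfolding h_def by (intro tendsto_intros g(2) elim)
      also have "max 0 (min (f t) (real n)) = f t" using nn[of t] by (simp add: f_def)
      finally have "(\<lambda>k. \<bar>f t - h k t\<bar>) \<longlonglongrightarrow> \<bar>f t - f t\<bar>" by (intro tendsto_intros)
      then have "(\<lambda>k. ennreal \<bar>f t - h k t\<bar>) \<longlonglongrightarrow> ennreal 0" by (intro tendsto_ennrealI) simp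
      then show ?case by (auto simp: indicator_def)
    qed
    show "AE t in lborel. ennreal \<bar>f t - h k t\<bar> * indicator {a..b} t \<le> ennreal (real n) * indicator {a..b} t" for k
    proof (rule AE_I2, rule mult_right_mono)
      show "ennreal \<bar>f t - h k t\<bar> \<le> ennreal (real n)" for t
        using nn[of t] by (intro ennreal_leI) (auto simp: f_def h_def)
    qed simp
    show "(\<integral>\<^sup>+t. ennreal (real n) * indicator {a..b} t \<partial>lborel) < \<infinity>"
      by (cases "a \<le> b") (simp_all add: nn_integral_cmult_indicator ennreal_mult_less_top)
  qed measurable
  then have "\<forall>\<^sub>F k in sequentially. L1_dist a b f (h k) < ennreal (e/2)"
    using \<open>e > 0\<close> by (intro order_tendstoD) auto
  then obtain k where k: "L1_dist a b f (h k) < ennreal (e/2)"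
    by (auto simp: eventually_sequentially)
  show thesis
  proof (rule that[of "h k" "real n"])
    show "continuous_on UNIV (h k)" unfolding h_def by (intro continuous_intros g)
    show "0 \<le> h k t \<and> h k t \<le> real n" for t by (auto simp: h_def)
    have "\<bar>\<phi> t - f t\<bar> = max 0 (\<phi> t - real n)" for t by (simp add: f_def min_def max_def)
    then have "L1_dist a b \<phi> f < ennreal (e/2)" using n by simp
    then have "L1_dist a b \<phi> f
      + L1_dist a b f (h k) < ennreal (e/2) + ennreal (e/2)"
      using k by (rule add_strict_mono)
    also have "\<dots> = ennreal e" using \<open>e > 0\<close> by (simp flip: ennreal_plus)
    finally show "L1_dist a b \<phi> (h k) < ennreal e"
      by (rule le_less_trans[rotated]) (rule nn_integral_abs_triangle; measurable)
  qed
qed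

text \<open>Constant on the cells of a grid of mesh \<open>1/n\<close>, with rational values. The
  parameters range over a countable type, which is what separability uses; beyond the end of the
  list the value is unspecified.\<close>

definition step_function :: "nat \<Rightarrow> rat list \<Rightarrow> real \<Rightarrow> real"
  where "step_function n q t = of_rat (q ! nat \<lfloor>real n * t\<rfloor>)"

lemma step_function_borel_measurable [measurable]: "step_function n q \<in> borel_measurable borel"
proof -
  have "(\<lambda>t::real. \<lfloor>real n * t\<rfloor>) \<in> measurable borel (count_space UNIV)" by measurable
  then have "(\<lambda>t. (\<lambda>i. of_rat (q ! nat i) :: real) \<lfloor>real n * t\<rfloor>) \<in> borel_measurable borel"
    by (rule measurable_compose) simp
  then show ?thesis by (simp add: step_function_def[abs_def])
qed

lemma step_functions_dense_in_L1:
  fixes \<phi> :: "real \<Rightarrow> real"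
  assumes [measurable]: "\<phi> \<in> borel_measurable borel" and "\<And>t. 0 \<le> \<phi> t"
    and "(\<integral>\<^sup>+t. ennreal (\<phi> t) * indicator {0..1} t \<partial>lborel) < \<infinity>" and "0 < e"
  obtains n q where "L1_dist 0 1 \<phi> (step_function n q) < ennreal e"
proof -
  obtain \<psi> M where \<psi>: "continuous_on UNIV \<psi>"
    "L1_dist 0 1 \<phi> \<psi> < ennreal (e/2)"
    using continuous_dense_in_L1[OF assms(1-3), of "e/2"] \<open>e > 0\<close> by auto
  have [measurable]: "\<psi> \<in> borel_measurable borel"
    using \<psi>(1) by (rule borel_measurable_continuous_onI)
  have "uniformly_continuous_on {0..1} \<psi>"
    using \<psi>(1) by (intro compact_uniformly_continuous) (auto intro: continuous_on_subset)
  then obtain d where "d > 0" and d: "\<And>s t. s \<in> {0..1} \<Longrightarrow> t \<in> {0..1} \<Longrightarrow> dist s t < d \<Longrightarrow> dist (\<psi> s) (\<psi> t) < e/4"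
    unfolding uniformly_continuous_on_def using \<open>e > 0\<close>
    by (metis zero_less_divide_iff zero_less_numeral)
  \<comment> \<open>The grid has \<open>Suc n\<close> cells on the unit interval, each shorter than
    \<open>d\<close>.\<close>
  obtain n where n: "real (Suc n) > 1 / d" using reals_Archimedean2 by (meson less_trans lessI of_nat_less_iff)
  have "\<exists>r. \<bar>of_rat r - \<psi> (real i / real (Suc n))\<bar> < e/4" for i
  proof -
    obtain r where "\<psi> (real i / real (Suc n)) - e/4 < of_rat r" "of_rat r < \<psi> (real i / real (Suc n)) + e/4"
      using of_rat_dense[of "\<psi> (real i / real (Suc n)) - e/4" "\<psi> (real i / real (Suc n)) + e/4"] \<open>e > 0\<close> by auto
    then show ?thesis unfolding abs_less_iff by (intro exI[of _ r] conjI) linarith+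
  qed
  then obtain r where r: "\<And>i. \<bar>of_rat (r i) - \<psi> (real i / real (Suc n))\<bar> < e/4" by metis
  \<comment> \<open>One value more than there are cells: at \<open>t = 1\<close> the index is
    \<open>Suc n\<close> itself.\<close>
  define q where "q = map r [0..<Suc (Suc n)]"
  \<comment> \<open>One \<open>e/4\<close> is the oscillation of \<open>\<psi>\<close> on a cell,
    the other the rounding of its value to a rational.\<close>
  have close: "\<bar>\<psi> t - step_function (Suc n) q t\<bar> \<le> e/2" if t: "t \<in> {0..1}" for t
  proof -
    define i where "i = nat \<lfloor>real (Suc n) * t\<rfloor>"
    have i: "real i \<le> real (Suc n) * t" "real (Suc n) * t < real i + 1"
      unfolding i_def using t by (auto simp: of_nat_nat)
    have "real (Suc n) * t \<le> real (Suc n)" using t by (simp add: mult_left_le)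
    then have "real i \<le> real (Suc n)" using i(1) by linarith
    then have iN: "i \<le> Suc n" by linarith
    have "real i / real (Suc n) \<in> {0..1}" using iN by simp
    moreover have "dist t (real i / real (Suc n)) < d"
    proof -
      have "t - real i / real (Suc n) = (real (Suc n) * t - real i) / real (Suc n)" by (simp add: field_simps)
      moreover have "0 \<le> (real (Suc n) * t - real i) / real (Suc n)" using i(1) by simp
      moreover have "(real (Suc n) * t - real i) / real (Suc n) < 1 / real (Suc n)"
        using i(2) by (intro divide_strict_right_mono) auto
      moreover have "1 / real (Suc n) < d" using n \<open>d > 0\<close> by (simp add: field_simps)
      ultimately show ?thesis by (simp add: dist_real_def)
    qed
    ultimately have "\<bar>\<psi> t - \<psi> (real i / real (Suc n))\<bar> < e/4" using d[OF t] by (simp add: dist_real_def)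
    moreover have "step_function (Suc n) q t = of_rat (r i)"
      using iN unfolding step_function_def q_def i_def[symmetric] by (simp del: upt_Suc)
    ultimately show ?thesis using r[of i] by linarith
  qed
  have "L1_dist 0 1 \<psi> (step_function (Suc n) q)
      \<le> (\<integral>\<^sup>+t. ennreal (e/2) * indicator {0..1::real} t \<partial>lborel)"
    by (intro nn_integral_mono) (auto simp: indicator_def intro!: ennreal_leI close)
  also have "\<dots> = ennreal (e/2)" by (simp add: nn_integral_cmult_indicator)
  finally have "L1_dist 0 1 \<phi> \<psi>
     + L1_dist 0 1 \<psi> (step_function (Suc n) q)
     \<le> L1_dist 0 1 \<phi> \<psi> + ennreal (e/2)"
    by (rule add_left_mono)
  also have "\<dots> < ennreal (e/2) + ennreal (e/2)"
    using \<psi>(2) by (simp add: ennreal_add_left_cancel_less add.commute)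
  also have "\<dots> = ennreal e" using \<open>e > 0\<close> by (simp flip: ennreal_plus)
  finally have "L1_dist 0 1 \<phi> (step_function (Suc n) q) < ennreal e"
    by (rule le_less_trans[rotated]) (rule nn_integral_abs_triangle; measurable)
  then show thesis by (rule that)
qed

section \<open>Integrals of periodic functions\<close>

text \<open>Periodicity holds almost everywhere in the hypothesis because this is what
  \<open>has_density_AE_periodic\<close> gives for the density of a lift.\<close>

lemma nn_integral_AE_periodic_shift:
  fixes w :: "real \<Rightarrow> ennreal"
  assumes [measurable]: "w \<in> borel_measurable borel" and "AE t in lborel. w (t + 1) = w t"
  shows "(\<integral>\<^sup>+t. w t * indicator {a + 1..b + 1} t \<partial>lborel) = (\<integral>\<^sup>+t. w t * indicator {a..b} t \<partial>lborel)"
proof -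
  have "(\<integral>\<^sup>+t. w t * indicator {a + 1..b + 1} t \<partial>lborel)
      = (\<integral>\<^sup>+t. w t * indicator {a + 1..b + 1} t \<partial>distr lborel borel ((+) 1))"
    by (simp add: lborel_distr_plus)
  also have "\<dots> = (\<integral>\<^sup>+t. w (1 + t) * indicator {a + 1..b + 1} (1 + t) \<partial>lborel)"
    by (rule nn_integral_distr) measurable
  also have "\<dots> = (\<integral>\<^sup>+t. w t * indicator {a..b} t \<partial>lborel)"
  proof (rule nn_integral_cong_AE)
    show "AE t in lborel. w (1 + t) * indicator {a + 1..b + 1} (1 + t) = w t * indicator {a..b} t"
      using assms(2) by eventually_elim (auto simp: indicator_def add.commute)
  qed
  finally show ?thesis .
qed

lemma nn_integral_split_Icc:
  fixes w :: "real \<Rightarrow> ennreal"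
  assumes [measurable]: "w \<in> borel_measurable borel" and "a \<le> c" "c \<le> b"
  shows "(\<integral>\<^sup>+t. w t * indicator {a..b} t \<partial>lborel)
    = (\<integral>\<^sup>+t. w t * indicator {a..c} t \<partial>lborel) + (\<integral>\<^sup>+t. w t * indicator {c..b} t \<partial>lborel)"
proof -
  have "(\<integral>\<^sup>+t. w t * indicator {a..b} t \<partial>lborel)
     = (\<integral>\<^sup>+t. w t * indicator {a..c} t + w t * indicator {c..b} t \<partial>lborel)"
  proof (rule nn_integral_cong_AE)
    show "AE t in lborel. w t * indicator {a..b} t = w t * indicator {a..c} t + w t * indicator {c..b} t"
      using AE_lborel_singleton[of c] by eventually_elim (use assms(2,3) in \<open>auto simp: indicator_def\<close>)
  qed
  also have "\<dots> = (\<integral>\<^sup>+t. w t * indicator {a..c} t \<partial>lborel) + (\<integral>\<^sup>+t. w t * indicator {c..b} t \<partial>lborel)"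
    by (intro nn_integral_add) measurable
  finally show ?thesis .
qed

text \<open>Substitution by a lift \<open>H\<close> produces the interval
  \<open>{H 0..H 0 + 1}\<close>, and with \<open>H 0\<close> in \<open>{0..<1}\<close> this moves it
  back to the standard period.\<close>

lemma nn_integral_AE_periodic_unit:
  fixes w :: "real \<Rightarrow> ennreal"
  assumes w[measurable]: "w \<in> borel_measurable borel" and p: "AE t in lborel. w (t + 1) = w t"
    and h: "0 \<le> h" "h \<le> 1"
  shows "(\<integral>\<^sup>+t. w t * indicator {h..h + 1} t \<partial>lborel) = (\<integral>\<^sup>+t. w t * indicator {0..1} t \<partial>lborel)"
proof -
  have "(\<integral>\<^sup>+t. w t * indicator {h..h + 1} t \<partial>lborel)
      = (\<integral>\<^sup>+t. w t * indicator {h..1} t \<partial>lborel) + (\<integral>\<^sup>+t. w t * indicator {0 + 1..h + 1} t \<partial>lborel)"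
    using nn_integral_split_Icc[OF w, of h 1 "h + 1"] h by simp
  also have "\<dots> = (\<integral>\<^sup>+t. w t * indicator {h..1} t \<partial>lborel) + (\<integral>\<^sup>+t. w t * indicator {0..h} t \<partial>lborel)"
    by (simp only: nn_integral_AE_periodic_shift[OF w p])
  also have "\<dots> = (\<integral>\<^sup>+t. w t * indicator {0..1} t \<partial>lborel)"
    using nn_integral_split_Icc[OF w, of 0 h 1] h by (simp add: add.commute)
  finally show ?thesis .
qed

text \<open>Carries L1 convergence over one period to every bounded interval.\<close>

lemma nn_integral_AE_periodic_symmetric:
  fixes w :: "real \<Rightarrow> ennreal"
  assumes w[measurable]: "w \<in> borel_measurable borel" and p: "AE t in lborel. w (t + 1) = w t"
  shows "(\<integral>\<^sup>+t. w t * indicator {- real N..real N} t \<partial>lborel)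
    = of_nat (2 * N) * (\<integral>\<^sup>+t. w t * indicator {0..1} t \<partial>lborel)"
proof -
  let ?I = "\<lambda>a b. \<integral>\<^sup>+t. w t * indicator {a..b} t \<partial>lborel"
  have pos: "?I (real n) (real n + 1) = ?I 0 1" for n
  proof (induction n)
    case (Suc n)
    then show ?case using nn_integral_AE_periodic_shift[OF w p, of "real n" "real n + 1"] by (simp add: add.commute)
  qed simp
  have neg: "?I (- real n) (- real n + 1) = ?I 0 1" for n
  proof (induction n)
    case (Suc n)
    then show ?case using nn_integral_AE_periodic_shift[OF w p, of "- real (Suc n)" "- real (Suc n) + 1"]
      by simp
  qed simp
  show ?thesis
  proof (induction N)
    case 0
    have "?I 0 0 = integral\<^sup>N lborel (\<lambda>t::real. 0)"
    proof (rule nn_integral_cong_AE)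
      show "AE t in lborel. w t * indicator {0..0} t = 0"
        using AE_lborel_singleton[of "0::real"] by eventually_elim (auto simp: indicator_def)
    qed
    then show ?case by simp
  next
    case (Suc N)
    have "?I (- real (Suc N)) (real (Suc N)) = ?I (- real (Suc N)) (- real N) + (?I (- real N) (real N) + ?I (real N) (real (Suc N)))"
      using nn_integral_split_Icc[OF w, of "- real (Suc N)" "- real N" "real (Suc N)"]
        nn_integral_split_Icc[OF w, of "- real N" "real N" "real (Suc N)"] by simp
    also have "?I (- real (Suc N)) (- real N) = ?I 0 1" using neg[of "Suc N"] by simp
    also have "?I (real N) (real (Suc N)) = ?I 0 1" using pos[of N] by (simp add: add.commute)
    finally show ?case using Suc by (simp add: algebra_simps)
  qed
qed

lemma AE_shift_lborel:
  assumes "AE t in lborel. P (t::real)"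
  shows "AE t in lborel. P (t + 1)"
proof -
  obtain N where N: "{t \<in> space lborel. \<not> P t} \<subseteq> N" "emeasure lborel N = 0" "N \<in> sets lborel"
    using assms by (rule AE_E)
  have "AE t in distr lborel borel ((+) 1). t \<notin> N"
    using N by (simp add: lborel_distr_plus AE_not_in null_setsI)
  then have "AE t in lborel. 1 + t \<notin> N"
    by (subst (asm) AE_distr_iff) (use N(3) in \<open>auto simp: Collect_neg_eq\<close>)
  then show ?thesis
    by eventually_elim (use N(1) in \<open>auto simp: add.commute\<close>)
qed

text \<open>At almost every \<open>t\<close> both sides are the derivative of \<open>F\<close> at
  \<open>t\<close>: one directly, the other through \<open>F (x + 1)\<close>, which differs from
  \<open>F x\<close> by a constant.\<close>

lemma has_density_AE_periodic:
  assumes F: "has_density F \<phi>" and p: "\<And>x. F (x + 1) = F x + 1"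
  shows "AE t in lborel. \<phi> (t + 1) = \<phi> t"
  using has_density_AE_deriv[OF F] AE_shift_lborel[OF has_density_AE_deriv[OF F]]
proof eventually_elim
  case (elim t)
  have "((\<lambda>x. F (x + 1)) has_real_derivative \<phi> (t + 1)) (at t)"
    using elim(2) by (simp add: DERIV_shift)
  then have "((\<lambda>x. F x + 1) has_real_derivative \<phi> (t + 1)) (at t)" by (simp only: p)
  then have "(F has_real_derivative \<phi> (t + 1)) (at t)"
    using DERIV_add[OF _ DERIV_const[of "-1"]] by force
  then show ?case using elim(1) by (rule DERIV_unique)
qed

text \<open>Riesz-Fischer: a sequence that is Cauchy in mean has an almost everywhere convergent
  subsequence, and by Fatou's lemma the whole sequence converges in mean to its limit. The limit is
  arranged to be nonnegative everywhere, as \<open>has_density\<close> demands.\<close>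

lemma L1_Icc_complete:
  fixes \<phi> :: "nat \<Rightarrow> real \<Rightarrow> real"
  assumes \<phi>[measurable]: "\<And>n. \<phi> n \<in> borel_measurable borel"
    and nn: "\<And>n t. 0 \<le> \<phi> n t"
    and fin: "\<And>n. (\<integral>\<^sup>+t. ennreal (\<phi> n t) * indicator {a..b} t \<partial>lborel) < \<infinity>"
    and cauchy: "\<And>e. e > 0 \<Longrightarrow> \<exists>N. \<forall>i\<ge>N. \<forall>j\<ge>N.
      L1_dist a b (\<phi> i) (\<phi> j) < ennreal e"
  obtains \<phi>' where "\<phi>' \<in> borel_measurable borel" and "\<And>t. 0 \<le> \<phi>' t"
    and "(\<lambda>n. L1_dist a b (\<phi> n) \<phi>') \<longlonglongrightarrow> 0"
proof -
  \<comment> \<open>Cutting off outside \<open>{a..b}\<close> turns the claim into one about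
    integrable functions on the line.\<close>
  define s where "s n t = \<phi> n t * indicator {a..b} t" for n t
  have sm[measurable]: "s n \<in> borel_measurable borel" for n unfolding s_def by measurable
  have eq: "ennreal (norm (s i t - s j t)) = ennreal \<bar>\<phi> i t - \<phi> j t\<bar> * indicator {a..b} t" for i j t
    by (auto simp: s_def indicator_def)
  have int: "integrable lborel (s n)" for n
  proof (rule integrableI_bounded)
    show "s n \<in> borel_measurable lborel" by simp
    have "(\<integral>\<^sup>+t. ennreal (norm (s n t)) \<partial>lborel) = (\<integral>\<^sup>+t. ennreal (\<phi> n t) * indicator {a..b} t \<partial>lborel)"
      by (intro nn_integral_cong) (auto simp: s_def indicator_def nn)
    then show "(\<integral>\<^sup>+t. ennreal (norm (s n t)) \<partial>lborel) < \<infinity>" using fin by simp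
  qed
  have LINT: "ennreal (LINT t|lborel. norm (s i t - s j t))
     = L1_dist a b (\<phi> i) (\<phi> j)" for i j
    unfolding eq[symmetric] by (rule nn_integral_eq_integral[symmetric])
      (intro integrable_norm Bochner_Integration.integrable_diff int, simp)
  have "\<exists>N. \<forall>i\<ge>N. \<forall>j\<ge>N. (LINT t|lborel. norm (s i t - s j t)) < e" if "e > 0" for e
    using cauchy[OF that] unfolding LINT[symmetric] by (simp add: ennreal_less_iff)
  then obtain r where r: "strict_mono r" "AE t in lborel. Cauchy (\<lambda>i. s (r i) t)"
    using cauchy_L1_AE_cauchy_subseq[of lborel s] int by blast
  \<comment> \<open>\<open>lim\<close> is arbitrary where the subsequence diverges; the maximum
    makes the function nonnegative there too.\<close>
  define \<phi>' where "\<phi>' t = max 0 (lim (\<lambda>i. s (r i) t))" for t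
  have [measurable]: "\<phi>' \<in> borel_measurable borel" unfolding \<phi>'_def by measurable
  have lim: "AE t in lborel. (\<lambda>i. s (r i) t) \<longlonglongrightarrow> \<phi>' t"
    using r(2)
  proof eventually_elim
    case (elim t)
    then have l: "(\<lambda>i. s (r i) t) \<longlonglongrightarrow> lim (\<lambda>i. s (r i) t)"
      using Cauchy_convergent_iff convergent_LIMSEQ_iff by blast
    moreover have "0 \<le> lim (\<lambda>i. s (r i) t)"
      by (rule LIMSEQ_le_const[OF l]) (auto simp: s_def nn)
    ultimately show ?case by (simp add: \<phi>'_def max_def)
  qed
  have "(\<lambda>n. L1_dist a b (\<phi> n) \<phi>') \<longlonglongrightarrow> 0"
  proof (rule order_tendstoI)
    fix y :: ennreal assume "0 < y"
    \<comment> \<open>\<open>y\<close> may be infinite; a \<open>z\<close> strictly below it is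
      finite and gives a real bound.\<close>
    then obtain z where z: "0 < z" "z < y" using dense by blast
    then obtain e where e: "0 < e" "ennreal e < y"
      by (cases z) (auto simp: top_unique)
    obtain N where N: "\<And>i j. i \<ge> N \<Longrightarrow> j \<ge> N \<Longrightarrow>
      L1_dist a b (\<phi> i) (\<phi> j) < ennreal e"
      using cauchy[OF e(1)] by blast
    have "L1_dist a b (\<phi> i) \<phi>' < y" if "i \<ge> N" for i
    proof -
      \<comment> \<open>For fixed \<open>i\<close>, Fatou's lemma along the subsequence
        \<open>r\<close> in the second index.\<close>
      have "L1_dist a b (\<phi> i) \<phi>'
         = (\<integral>\<^sup>+t. liminf (\<lambda>j. ennreal \<bar>\<phi> i t - \<phi> (r j) t\<bar> * indicator {a..b} t) \<partial>lborel)"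
      proof (rule nn_integral_cong_AE)
        show "AE t in lborel. ennreal \<bar>\<phi> i t - \<phi>' t\<bar> * indicator {a..b} t
          = liminf (\<lambda>j. ennreal \<bar>\<phi> i t - \<phi> (r j) t\<bar> * indicator {a..b} t)"
          using lim
        proof eventually_elim
          case (elim t)
          show ?case
          proof (cases "t \<in> {a..b}")
            case True
            then have "(\<lambda>j. \<phi> (r j) t) \<longlonglongrightarrow> \<phi>' t" using elim by (simp add: s_def)
            then have "(\<lambda>j. \<bar>\<phi> i t - \<phi> (r j) t\<bar>) \<longlonglongrightarrow> \<bar>\<phi> i t - \<phi>' t\<bar>" by (intro tendsto_intros)
            then have "(\<lambda>j. ennreal \<bar>\<phi> i t - \<phi> (r j) t\<bar>) \<longlonglongrightarrow> ennreal \<bar>\<phi> i t - \<phi>' t\<bar>" by (intro tendsto_ennrealI)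
            then show ?thesis using True lim_imp_Liminf[OF sequentially_bot] by fastforce
          qed (simp add: Liminf_const)
        qed
      qed
      also have "\<dots> \<le> liminf (\<lambda>j. L1_dist a b (\<phi> i) (\<phi> (r j)))"
        by (rule nn_integral_liminf) measurable
      also have "\<dots> \<le> ennreal e"
      proof (rule order_trans[OF Liminf_le_Limsup Limsup_bounded])
        show "\<forall>\<^sub>F j in sequentially. L1_dist a b (\<phi> i) (\<phi> (r j)) \<le> ennreal e"
        proof (rule eventually_sequentiallyI)
          fix j assume "j \<ge> N"
          then have "r j \<ge> N" using seq_suble[OF r(1), of j] by simp
          then show "L1_dist a b (\<phi> i) (\<phi> (r j)) \<le> ennreal e"
            using N[OF that] by (simp add: less_imp_le)
        qed
      qed simp
      finally show ?thesis using e(2) by (rule le_less_trans)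
    qed
    then show "\<forall>\<^sub>F n in sequentially. L1_dist a b (\<phi> n) \<phi>' < y"
      by (intro eventually_sequentiallyI)
  qed simp
  moreover have "0 \<le> \<phi>' t" for t by (simp add: \<phi>'_def)
  ultimately show thesis by (intro that) auto
qed

subsection \<open>The circle and lifts of its homeomorphisms\<close>

lemma circle_cover_eq_iff: "circle_cover x = circle_cover y \<longleftrightarrow> (\<exists>n::int. x = y + of_int n)"
proof -
  have "circle_cover x = circle_cover y \<longleftrightarrow>
    (\<exists>n::int. 2 * complex_of_real pi * \<i> * complex_of_real x = 2 * complex_of_real pi * \<i> * complex_of_real (y + of_int n))"
    unfolding circle_cover_def exp_eq by (simp add: algebra_simps)
  also have "\<dots> \<longleftrightarrow> (\<exists>n::int. complex_of_real x = complex_of_real (y + of_int n))"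
    by (simp only: mult_cancel_left) simp
  finally show ?thesis by (simp only: of_real_eq_iff)
qed

lemma circle_cover_add_int [simp]: "circle_cover (x + of_int n) = circle_cover x"
  using circle_cover_eq_iff by blast

lemma circle_cover_0 [simp]: "circle_cover 0 = 1"
  by (simp add: circle_cover_def)

lemma circle_cover_add: "circle_cover (x + y) = circle_cover x * circle_cover y"
  by (simp add: circle_cover_def distrib_left exp_add)

lemma circle_cover_in_circle [simp]: "circle_cover x \<in> circle"
  by (simp add: circle_def circle_cover_def)

lemma circle_cover_surj:
  assumes "z \<in> circle"
  obtains x where "0 \<le> x" "x < 1" "z = circle_cover x"
proof -
  have "norm z = 1" using assms by (simp add: circle_def)
  then obtain t where t: "z = exp (\<i> * complex_of_real t)" using complex_norm_eq_1_exp by metis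
  define x where "x = frac (t / (2 * pi))"
  have "t / (2 * pi) = x + of_int \<lfloor>t / (2 * pi)\<rfloor>" by (simp add: x_def frac_def)
  then have "circle_cover (t / (2 * pi)) = circle_cover x" by (metis circle_cover_add_int)
  moreover have "z = circle_cover (t / (2 * pi))"
    unfolding t circle_cover_def by simp
  ultimately show thesis using that[of x] by (simp add: x_def frac_lt_1)
qed

lemma continuous_on_circle_cover [continuous_intros]:
  "continuous_on S f \<Longrightarrow> continuous_on S (\<lambda>x. circle_cover (f x))"
  unfolding circle_cover_def by (intro continuous_intros)

text \<open>Fibres are cosets of the integers, so the infimum is the distance from
  \<open>x - y\<close> to the nearest integer.\<close>

lemma d_circle_cover: "d_circle (circle_cover x) (circle_cover y) = \<bar>x - y - of_int (round (x - y))\<bar>"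
proof (rule antisym)
  have "d_circle (circle_cover x) (circle_cover y) \<le> dist x (y + of_int (round (x - y)))"
    unfolding d_circle_def by (rule setdist_le_dist) auto
  then show "d_circle (circle_cover x) (circle_cover y) \<le> \<bar>x - y - of_int (round (x - y))\<bar>"
    by (simp add: dist_real_def algebra_simps)
  show "\<bar>x - y - of_int (round (x - y))\<bar> \<le> d_circle (circle_cover x) (circle_cover y)"
    unfolding d_circle_def
  proof (rule le_setdistI)
    fix a b assume "a \<in> circle_cover -` {circle_cover x}" "b \<in> circle_cover -` {circle_cover y}"
    then obtain m n :: int where "a = x + of_int m" "b = y + of_int n"
      by (auto simp: circle_cover_eq_iff)
    then have "dist a b = \<bar>x - y - of_int (n - m)\<bar>" by (simp add: dist_real_def algebra_simps)
    then show "\<bar>x - y - of_int (round (x - y))\<bar> \<le> dist a b"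
      using round_diff_minimal[of "x - y" "n - m"] by simp
  qed auto
qed

lemma d_circle_cover_le: "d_circle (circle_cover x) (circle_cover y) \<le> \<bar>x - y\<bar>"
  using round_diff_minimal[of "x - y" 0] by (simp add: d_circle_cover)

text \<open>The usual way into an estimate of \<open>d_circle\<close>: a representative of the
  second point realises the distance, and the rest is arithmetic on the line.\<close>

lemma d_circle_cover_attained:
  obtains n :: int where "d_circle (circle_cover x) (circle_cover y) = \<bar>x - (y + of_int n)\<bar>"
  by (rule that[of "round (x - y)"]) (simp add: d_circle_cover algebra_simps)

lemma d_circle_le_half: "x \<in> circle \<Longrightarrow> y \<in> circle \<Longrightarrow> d_circle x y \<le> 1/2"
  by (metis circle_cover_surj d_circle_cover of_int_round_abs_le abs_minus_commute)

lemma d_circle_metric: "Metric_space circle d_circle"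
proof
  fix x y z :: complex
  show "0 \<le> d_circle x y" by (simp add: d_circle_def setdist_pos_le)
  show "d_circle x y = d_circle y x" by (simp add: d_circle_def setdist_sym)
  assume x: "x \<in> circle" and y: "y \<in> circle"
  obtain a where a: "x = circle_cover a" using x circle_cover_surj by blast
  obtain b where b: "y = circle_cover b" using y circle_cover_surj by blast
  obtain m :: int where m: "d_circle x y = \<bar>a - (b + of_int m)\<bar>"
    unfolding a b by (rule d_circle_cover_attained)
  show "d_circle x y = 0 \<longleftrightarrow> x = y"
  proof
    assume "d_circle x y = 0"
    then show "x = y" using m a b by simp
  qed (use d_circle_cover_le[of a a] a in \<open>simp add: d_circle_def setdist_pos_le antisym\<close>)
  assume z: "z \<in> circle"
  obtain c where c: "z = circle_cover c" using z circle_cover_surj by blast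
  obtain n :: int where n: "d_circle y z = \<bar>b - (c + of_int n)\<bar>"
    unfolding b c by (rule d_circle_cover_attained)
  \<comment> \<open>The integers realising the two summands add up to a representative for the third
    pair, not necessarily the best one.\<close>
  have "d_circle x z \<le> \<bar>a - (c + of_int (n + m))\<bar>"
    using d_circle_cover_le[of a "c + of_int (n + m)"] by (simp only: a c circle_cover_add_int)
  also have "\<dots> \<le> d_circle x y + d_circle y z" unfolding m n by simp
  finally show "d_circle x z \<le> d_circle x y + d_circle y z" .
qed

interpretation circle: Metric_space circle d_circle
  by (rule d_circle_metric)

lemma dist_circle_cover: "dist (circle_cover x) (circle_cover y) = 2 * \<bar>sin (pi * (x - y))\<bar>"
proof -
  have "circle_cover x - circle_cover y = circle_cover y * (exp (\<i> * of_real (2 * pi * (x - y))) - 1)"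
    by (simp add: circle_cover_def right_diff_distrib exp_diff field_simps)
  then have "dist (circle_cover x) (circle_cover y) = norm (exp (\<i> * of_real (2 * pi * (x - y))) - 1)"
    using circle_cover_in_circle[of y] by (simp add: dist_norm norm_mult circle_def)
  also have "\<dots> = 2 * \<bar>sin (2 * pi * (x - y) / 2)\<bar>" by (rule dist_exp_i_1)
  finally show ?thesis by simp
qed

text \<open>With \<open>d_circle_le_dist\<close> this compares chord and arc in both directions, so
  that the two metrics give the circle the same topology.\<close>

lemma dist_le_d_circle:
  assumes "x \<in> circle" "y \<in> circle"
  shows "dist x y \<le> 2 * pi * d_circle x y"
proof -
  obtain a b where ab: "x = circle_cover a" "y = circle_cover b" using assms circle_cover_surj by metis
  obtain n :: int where n: "d_circle x y = \<bar>a - (b + of_int n)\<bar>"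
    unfolding ab by (rule d_circle_cover_attained)
  have "dist x y = 2 * \<bar>sin (pi * (a - (b + of_int n)))\<bar>"
    using dist_circle_cover[of a "b + of_int n"] ab by simp
  also have "\<dots> \<le> 2 * \<bar>pi * (a - (b + of_int n))\<bar>"
    using abs_sin_x_le_abs_x by (intro mult_left_mono) auto
  finally show ?thesis by (simp add: n abs_mult)
qed

text \<open>The cubic Taylor remainder is at most \<open>\<bar>u\<bar> ^ 3 / 6\<close>, hence at
  most two thirds of \<open>\<bar>u\<bar>\<close> in this range. The range covers half of pi, the
  largest argument that \<open>d_circle_le_half\<close> permits, and with \<open>pi > 3\<close> the
  factor 1/3 is enough for \<open>d_circle_le_dist\<close>.\<close>

lemma abs_sin_ge:
  fixes u :: real
  assumes "\<bar>u\<bar> \<le> 2"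
  shows "\<bar>u\<bar> / 3 \<le> \<bar>sin u\<bar>"
proof -
  have "\<bar>sin u - (\<Sum>m<3. sin_coeff m * u ^ m)\<bar> \<le> inverse (fact 3) * \<bar>u\<bar> ^ 3"
    by (rule Maclaurin_sin_bound)
  moreover have "(\<Sum>m<3. sin_coeff m * u ^ m) = u"
    by (simp add: sin_coeff_def numeral_3_eq_3)
  moreover have "inverse (fact 3) * \<bar>u\<bar> ^ 3 \<le> 2/3 * \<bar>u\<bar>"
  proof -
    have "\<bar>u\<bar> * \<bar>u\<bar> \<le> 2 * 2" using assms by (intro mult_mono) auto
    then have "\<bar>u\<bar> * (\<bar>u\<bar> * \<bar>u\<bar>) \<le> \<bar>u\<bar> * (2 * 2)" by (intro mult_left_mono) auto
    then show ?thesis by (simp add: fact_numeral power3_eq_cube)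
  qed
  ultimately show ?thesis by linarith
qed

lemma d_circle_le_dist:
  assumes "x \<in> circle" "y \<in> circle"
  shows "d_circle x y \<le> dist x y"
proof -
  obtain a b where ab: "x = circle_cover a" "y = circle_cover b" using assms circle_cover_surj by metis
  obtain n :: int where n: "d_circle x y = \<bar>a - (b + of_int n)\<bar>"
    unfolding ab by (rule d_circle_cover_attained)
  define u where "u = pi * (a - (b + of_int n))"
  have "\<bar>u\<bar> = pi * d_circle x y" by (simp add: u_def n abs_mult)
  moreover have "pi * d_circle x y \<le> pi * (1/2)"
    using d_circle_le_half[OF assms] by (intro mult_left_mono) auto
  ultimately have "\<bar>u\<bar> \<le> 2" using pi_less_4 by linarith
  then have "\<bar>u\<bar> / 3 \<le> \<bar>sin u\<bar>" by (rule abs_sin_ge)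
  moreover have "dist x y = 2 * \<bar>sin u\<bar>"
    using dist_circle_cover[of a "b + of_int n"] ab by (simp add: u_def)
  moreover have "3 * d_circle x y \<le> pi * d_circle x y"
    using pi_gt3 by (intro mult_right_mono) auto
  ultimately show ?thesis using \<open>\<bar>u\<bar> = pi * d_circle x y\<close> circle.nonneg[of x y] by linarith
qed

section \<open>Lifting maps of the circle to the line\<close>

text \<open>The difference of the two functions is continuous and integer-valued on a connected
  space.\<close>

lemma circle_cover_continuous_unique:
  fixes F G :: "real \<Rightarrow> real"
  assumes "continuous_on UNIV F" "continuous_on UNIV G" and "\<And>x. circle_cover (F x) = circle_cover (G x)"
  obtains n :: int where "\<And>x. F x = G x + of_int n"
proof -
  have int: "\<exists>n::int. F x - G x = of_int n" for x
    using assms(3)[of x] by (auto simp: circle_cover_eq_iff algebra_simps)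
  have "(\<lambda>x. F x - G x) constant_on UNIV"
  proof (rule continuous_discrete_range_constant)
    fix x :: real
    show "\<exists>e>0. \<forall>y. y \<in> UNIV \<and> F y - G y \<noteq> F x - G x \<longrightarrow> e \<le> norm (F y - G y - (F x - G x))"
    proof (intro exI[of _ 1] conjI allI impI)
      fix y assume ne: "y \<in> UNIV \<and> F y - G y \<noteq> F x - G x"
      obtain m n :: int where mn: "F x - G x = of_int m" "F y - G y = of_int n" using int by metis
      then have "n \<noteq> m" using ne by auto
      then have "1 \<le> \<bar>n - m\<bar>" by linarith
      then have "1 \<le> \<bar>real_of_int (n - m)\<bar>" by linarith
      then show "1 \<le> norm (F y - G y - (F x - G x))" by (simp add: mn)
    qed simp
  qed (intro continuous_intros assms connected_UNIV)+
  then obtain c where c: "\<And>x. F x - G x = c" by (auto simp: constant_on_def)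
  moreover obtain n :: int where "c = of_int n" using int c by metis
  ultimately show thesis using that[of n] by (simp add: algebra_simps)
qed

text \<open>A continuous logarithm exists because the line is contractible and the values avoid 0;
  norm 1 makes it purely imaginary, and division by \<open>2 * pi\<close> gives the lift.\<close>

lemma circle_continuous_lift:
  assumes "continuous_on circle f" "f \<in> circle \<rightarrow> circle"
  obtains F where "continuous_on UNIV F" "\<And>x. circle_cover (F x) = f (circle_cover x)"
proof -
  have fc: "f (circle_cover x) \<in> circle" for x using assms(2) by auto
  have "continuous_on UNIV (\<lambda>x. f (circle_cover x))"
    by (rule continuous_on_compose2[OF assms(1)]) (auto intro!: continuous_intros)
  moreover have "contractible (UNIV :: real set)" by simp
  moreover have "f (circle_cover x) \<noteq> 0" for x using fc[of x] by (auto simp: circle_def)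
  ultimately obtain g where g: "continuous_on UNIV g" "\<And>x. f (circle_cover x) = exp (g x)"
    by (rule continuous_logarithm_on_contractible) auto
  have "Re (g x) = 0" for x
    using fc[of x] by (simp add: circle_def g(2))
  then have gi: "g x = \<i> * of_real (Im (g x))" for x by (simp add: complex_eq_iff)
  show thesis
  proof (rule that[of "\<lambda>x. Im (g x) / (2 * pi)"])
    show "continuous_on UNIV (\<lambda>x. Im (g x) / (2 * pi))" by (intro continuous_intros g) simp
    show "circle_cover (Im (g x) / (2 * pi)) = f (circle_cover x)" for x
      unfolding g(2) by (subst (2) gi) (simp add: circle_cover_def)
  qed
qed

lemma circle_homeo_inverse:
  assumes "f \<in> Bij circle" "circle_homeo f"
  shows "continuous_on circle f" and "continuous_on circle (inv_into circle f)"
proof -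
  have h: "homeomorphic_map (top_of_set circle) (top_of_set circle) f"
    using assms(2) by (simp add: circle_homeo_def)
  then show "continuous_on circle f" by (auto dest: homeomorphic_imp_continuous_map)
  obtain g where g: "homeomorphic_maps (top_of_set circle) (top_of_set circle) f g"
    using h homeomorphic_map_maps by blast
  have b: "bij_betw f circle circle" using assms(1) by (simp add: Bij_def)
  have "continuous_on circle g" using g by (auto simp: homeomorphic_maps_def)
  moreover have "inv_into circle f z = g z" if "z \<in> circle" for z
  proof -
    have gz: "g z \<in> circle" "f (g z) = z" using g that
      by (auto simp: homeomorphic_maps_def continuous_map_def)
    then show ?thesis using b by (metis bij_betw_imp_inj_on inv_into_f_f)
  qed
  ultimately show "continuous_on circle (inv_into circle f)"
    by (metis (no_types, lifting) continuous_on_cong)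
qed

text \<open>The map and its inverse are lifted separately. Both composites cover the identity, so
  each is an integer translation, and correcting for it yields an inverse of
  \<open>F\<close>.\<close>

theorem circle_homeo_lift:
  assumes f: "f \<in> Bij circle" "circle_homeo f"
  obtains F where "homeomorphic_map euclideanreal euclideanreal F" "F 0 \<in> {0..<1}"
    "circle_cover \<circ> F = f \<circ> circle_cover"
proof -
  let ?f' = "inv_into circle f"
  have b: "bij_betw f circle circle" using f(1) by (simp add: Bij_def)
  have b': "bij_betw ?f' circle circle" by (rule bij_betw_inv_into[OF b])
  obtain F0 where F0: "continuous_on UNIV F0" "\<And>x. circle_cover (F0 x) = f (circle_cover x)"
    using circle_continuous_lift[OF circle_homeo_inverse(1)[OF f]] b by (auto simp: bij_betw_imp_funcset)
  define F where "F x = F0 x - of_int \<lfloor>F0 0\<rfloor>" for x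
  have F: "continuous_on UNIV F" unfolding F_def by (intro continuous_intros F0)
  have ccF: "circle_cover (F x) = f (circle_cover x)" for x
    using circle_cover_add_int[of "F0 x" "- \<lfloor>F0 0\<rfloor>"] by (simp add: F_def F0(2))
  have F00: "F 0 \<in> {0..<1}" unfolding F_def by (simp add: floor_less_cancel)
  obtain G where G: "continuous_on UNIV G" "\<And>x. circle_cover (G x) = ?f' (circle_cover x)"
    using circle_continuous_lift[OF circle_homeo_inverse(2)[OF f]] b' by (auto simp: bij_betw_imp_funcset)
  have "circle_cover (F (G x)) = circle_cover x" for x
    using b by (simp add: ccF G(2) bij_betw_inv_into_right)
  moreover have "continuous_on UNIV (\<lambda>x. F (G x))"
    by (rule continuous_on_compose2[OF F G(1)]) auto
  ultimately obtain m :: int where m: "\<And>x. F (G x) = x + of_int m"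
    using circle_cover_continuous_unique[of "\<lambda>x. F (G x)" "\<lambda>x. x"] by auto
  have "circle_cover (G (F x)) = circle_cover x" for x
    using b by (simp add: ccF G(2) bij_betw_inv_into_left)
  moreover have "continuous_on UNIV (\<lambda>x. G (F x))"
    by (rule continuous_on_compose2[OF G(1) F]) auto
  ultimately obtain n :: int where n: "\<And>x. G (F x) = x + of_int n"
    using circle_cover_continuous_unique[of "\<lambda>x. G (F x)" "\<lambda>x. x"] by auto
  have inj: "x = y" if "F x = F y" for x y 
  proof -
    have "x + of_int n = y + of_int n" unfolding n[symmetric] that ..
    then show ?thesis by simp
  qed
  have FG: "F (G (x - of_int m)) = x" for x by (simp add: m)
  \<comment> \<open>The correction by \<open>m\<close> makes a right inverse; injectivity turns it
    into a left inverse, without comparing \<open>m\<close> and \<open>n\<close>.\<close>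
  have GF: "G (F x - of_int m) = x" for x by (rule inj) (rule FG)
  have "homeomorphic_maps euclideanreal euclideanreal F (\<lambda>x. G (x - of_int m))"
    unfolding homeomorphic_maps_def
  proof (intro conjI ballI)
    show "continuous_map euclideanreal euclideanreal F" using F by simp
    have "continuous_on UNIV (\<lambda>x. G (x - of_int m))"
      by (rule continuous_on_compose2[OF G(1)]) (auto intro!: continuous_intros)
    then show "continuous_map euclideanreal euclideanreal (\<lambda>x. G (x - of_int m))" by simp
  qed (auto simp: FG GF)
  then have "homeomorphic_map euclideanreal euclideanreal F"
    by (rule homeomorphic_maps_imp_map)
  then show thesis using F00 by (rule that) (auto simp: ccF)
qed

text \<open>Discharges the definite description: two candidates differ by an integer, and values at
  0 in \<open>{0..<1}\<close> force it to be 0.\<close>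

lemma lift_eqI:
  assumes "homeomorphic_map euclideanreal euclideanreal F" "F 0 \<in> {0..<1}"
    "circle_cover \<circ> F = f \<circ> circle_cover"
  shows "lift f = F"
  unfolding lift_def
proof (rule the_equality)
  fix G assume G: "homeomorphic_map euclideanreal euclideanreal G \<and> G 0 \<in> {0..<1} \<and>
                          circle_cover \<circ> G = f \<circ> circle_cover"
  have cF: "continuous_on UNIV F" using homeomorphic_imp_continuous_map[OF assms(1)] by simp
  have cG: "continuous_on UNIV G" using homeomorphic_imp_continuous_map[of euclideanreal euclideanreal G] G by simp
  have "circle_cover (G x) = circle_cover (F x)" for x
    using G assms(3) by (metis comp_apply)
  then obtain n :: int where n: "\<And>x. G x = F x + of_int n"
    using circle_cover_continuous_unique[OF cG cF] by metis
  have "- 1 < real_of_int n" "real_of_int n < 1" using n[of 0] G assms(2) by auto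
  then have "n = 0" by linarith
  then show "G = F" using n by auto
qed (use assms in auto)

subsection \<open>The group of absolutely continuous circle homeomorphisms\<close>

text \<open>Nothing is fixed at 0, so that composites, inverses and translations stay in the class.
  The shift equation says degree one; absolute continuity in both directions enters as existence of
  densities.\<close>

definition circle_lift :: "(real \<Rightarrow> real) \<Rightarrow> bool"
  where "circle_lift F \<longleftrightarrow> strict_mono F \<and> surj F \<and> (\<forall>x. F (x + 1) = F x + 1) \<and>
    (\<exists>\<phi>. has_density F \<phi>) \<and> (\<exists>\<psi>. has_density (inv_into UNIV F) \<psi>)"

lemma circle_liftD:
  assumes "circle_lift F"
  shows "strict_mono F" and "surj F" and "bij F" and "F (x + 1) = F x + 1"
    and "\<exists>\<phi>. has_density F \<phi>" and "\<exists>\<psi>. has_density (inv_into UNIV F) \<psi>"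
  using assms by (auto simp: circle_lift_def bij_def strict_mono_imp_inj_on)

lemma degree_one_add_int:
  fixes F :: "real \<Rightarrow> real"
  assumes "\<And>x. F (x + 1) = F x + 1"
  shows "F (x + of_int n) = F x + of_int n"
proof -
  have nat: "F (x + of_nat k) = F x + of_nat k" for x k
  proof (induction k)
    case (Suc k)
    then show ?case using assms[of "x + of_nat k"] by (simp add: algebra_simps)
  qed simp
  show ?thesis
  proof (cases n rule: int_cases2)
    case (nonneg k)
    then show ?thesis using nat by simp
  next
    case (nonpos k)
    then show ?thesis using nat[of "x - of_nat k" k] by simp
  qed
qed

lemma circle_lift_add_int: "circle_lift F \<Longrightarrow> F (x + of_int n) = F x + of_int n"
  by (rule degree_one_add_int) (rule circle_liftD(4))

lemma circle_lift_continuous: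
  assumes "circle_lift F"
  shows "continuous_on UNIV F"
  using circle_liftD(5)[OF assms] has_density_imp_locally_absolutely_continuous
    locally_absolutely_continuous_imp_continuous_on by blast

lemma strict_mono_inv_real:
  fixes F :: "real \<Rightarrow> real"
  assumes "strict_mono F" "surj F"
  shows "strict_mono (inv_into UNIV F)"
  using assms by (metis strict_mono_inv surj_iff_all strict_mono_on_imp_inj_on inv_f_f surjD)

lemma circle_lift_inv:
  assumes "circle_lift F"
  shows "circle_lift (inv_into UNIV F)"
proof -
  note F = circle_liftD[OF assms]
  have "inv_into UNIV F (y + 1) = inv_into UNIV F y + 1" for y
    using F(3) F(4)[of "inv_into UNIV F y"] by (metis bij_inv_eq_iff)
  moreover have "inv_into UNIV (inv_into UNIV F) = F" using F(3) by (rule inv_inv_eq)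
  ultimately show ?thesis
    using F bij_imp_bij_inv[OF F(3)] strict_mono_inv_real[OF F(1,2)]
    by (auto simp: circle_lift_def bij_def)
qed

lemma circle_lift_compose:
  assumes "circle_lift F" "circle_lift G"
  shows "circle_lift (F \<circ> G)"
proof -
  note F = circle_liftD[OF assms(1)] and G = circle_liftD[OF assms(2)]
  note F' = circle_liftD[OF circle_lift_inv[OF assms(1)]]
  obtain \<phi> \<gamma> where "has_density F \<phi>" "has_density G \<gamma>" using F(5) G(5) by blast
  then have "has_density (F \<circ> G) (\<lambda>t. \<phi> (G t) * \<gamma> t)" using G(1,2) by (rule has_density_compose)
  moreover obtain \<phi>' \<gamma>' where "has_density (inv_into UNIV F) \<phi>'" "has_density (inv_into UNIV G) \<gamma>'" using F(6) G(6) by blast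
  then have "has_density (inv_into UNIV G \<circ> inv_into UNIV F) (\<lambda>t. \<gamma>' (inv_into UNIV F t) * \<phi>' t)" using F'(1,2)
    by (intro has_density_compose)
  then have "has_density (inv_into UNIV (F \<circ> G)) (\<lambda>t. \<gamma>' (inv_into UNIV F t) * \<phi>' t)"
    using o_inv_distrib[OF F(3) G(3)] by simp
  moreover have "strict_mono (F \<circ> G)" using F(1) G(1) by (simp add: strict_mono_def)
  moreover have "surj (F \<circ> G)" using F(2) G(2) by (rule comp_surj[rotated])
  ultimately show ?thesis
    using F(4) G(4) unfolding circle_lift_def by auto
qed

lemma has_density_translation: "has_density (\<lambda>x. x + c) (\<lambda>_. 1)"
  unfolding has_density_def
proof (intro conjI allI impI)
  fix a b :: real assume "a \<le> b"
  then show "(\<integral>\<^sup>+t. ennreal 1 * indicator {a..b} t \<partial>lborel) = ennreal ((b + c) - (a + c))"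
    by (simp add: nn_integral_cmult_indicator)
qed (auto simp: mono_def)

lemma circle_lift_translation: "circle_lift (\<lambda>x. x + c)"
proof -
  have "inv_into UNIV (\<lambda>x::real. x + c) = (\<lambda>x. x + (- c))"
    by (rule inv_unique_comp) (auto simp: fun_eq_iff)
  moreover have "surj (\<lambda>x::real. x + c)"
    by (rule surjI[of _ "\<lambda>x. x - c"]) simp
  moreover have "has_density (inv_into UNIV (\<lambda>x. x + c)) (\<lambda>_. 1)"
    unfolding calculation(1) by (rule has_density_translation)
  ultimately show ?thesis
    using has_density_translation[of c] unfolding circle_lift_def strict_mono_def by auto
qed

text \<open>A relation and not a function: all integer translates of a lift are lifts, and the one
  that fits a computation may be chosen. Extensionality makes the circle map determined by
  \<open>F\<close>.\<close>

definition is_lift :: "(real \<Rightarrow> real) \<Rightarrow> (complex \<Rightarrow> complex) \<Rightarrow> bool"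
  where "is_lift F f \<longleftrightarrow> circle_lift F \<and> f \<in> extensional circle \<and> (\<forall>x. f (circle_cover x) = circle_cover (F x))"

lemma is_liftD:
  assumes "is_lift F f"
  shows "circle_lift F" and "f \<in> extensional circle" and "f (circle_cover x) = circle_cover (F x)"
  using assms by (auto simp: is_lift_def)

text \<open>The choice of a preimage under \<open>circle_cover\<close> does not matter, because
  \<open>F\<close> commutes with integer translations.\<close>

lemma is_lift_exists:
  assumes "circle_lift F"
  obtains f where "is_lift F f"
proof -
  define f where "f = (\<lambda>z\<in>circle. circle_cover (F (SOME x. circle_cover x = z)))"
  have "f (circle_cover x) = circle_cover (F x)" for x
  proof -
    define y where "y = (SOME y. circle_cover y = circle_cover x)"
    have "circle_cover y = circle_cover x" unfolding y_def by (rule someI) simp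
    then obtain n :: int where "y = x + of_int n" by (auto simp: circle_cover_eq_iff)
    then have "F y = F x + of_int n" using circle_lift_add_int[OF assms] by simp
    then show ?thesis by (simp add: f_def flip: y_def)
  qed
  then show thesis using that[of f] assms by (auto simp: is_lift_def f_def)
qed

lemma is_lift_shift:
  assumes "is_lift F f"
  shows "is_lift (\<lambda>x. F x + of_int n) f"
proof -
  have "circle_lift ((\<lambda>x. x + of_int n) \<circ> F)"
    using circle_lift_translation is_liftD(1)[OF assms] by (rule circle_lift_compose)
  then show ?thesis using assms by (auto simp: is_lift_def comp_def)
qed

lemma is_lift_circle: "is_lift F f \<Longrightarrow> z \<in> circle \<Longrightarrow> f z \<in> circle"
  by (metis circle_cover_surj circle_cover_in_circle is_liftD(3))

lemma is_lift_eqI: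
  assumes "is_lift F f" "is_lift F g"
  shows "f = g"
proof (rule extensionalityI[of _ circle])
  fix z assume "z \<in> circle"
  then obtain x where "z = circle_cover x" using circle_cover_surj by blast
  then show "f z = g z" using is_liftD(3)[OF assms(1)] is_liftD(3)[OF assms(2)] by simp
qed (use assms in \<open>auto simp: is_lift_def\<close>)

lemma is_lift_bij_betw:
  assumes "is_lift F f"
  shows "bij_betw f circle circle"
proof (rule bij_betw_imageI)
  note F = circle_liftD[OF is_liftD(1)[OF assms]]
  show "inj_on f circle"
  proof (rule inj_onI)
    fix z w assume "z \<in> circle" "w \<in> circle" and eq: "f z = f w"
    then obtain x y where xy: "z = circle_cover x" "w = circle_cover y" using circle_cover_surj by metis
    then have "circle_cover (F x) = circle_cover (F y)" using eq is_liftD(3)[OF assms] by simp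
    then obtain n :: int where "F x = F y + of_int n" by (auto simp: circle_cover_eq_iff)
    then have "F x = F (y + of_int n)" using circle_lift_add_int[OF is_liftD(1)[OF assms]] by simp
    then have "x = y + of_int n" using F(3) by (simp add: bij_def inj_eq)
    then show "z = w" using xy by simp
  qed
  show "f ` circle = circle"
  proof
    show "f ` circle \<subseteq> circle" using is_lift_circle[OF assms] by blast
    show "circle \<subseteq> f ` circle"
    proof
      fix z assume "z \<in> circle"
      then obtain y where y: "z = circle_cover y" using circle_cover_surj by blast
      obtain x where "F x = y" using F(2) by (metis surjD)
      then have "z = f (circle_cover x)" using y is_liftD(3)[OF assms] by simp
      then show "z \<in> f ` circle" by simp
    qed
  qed
qed

lemma is_lift_Bij: "is_lift F f \<Longrightarrow> f \<in> Bij circle"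
  using is_lift_bij_betw is_liftD(2) by (simp add: Bij_def)

lemma is_lift_compose:
  assumes "is_lift F f" "is_lift G g"
  shows "is_lift (F \<circ> G) (compose circle f g)"
  using circle_lift_compose[OF is_liftD(1)[OF assms(1)] is_liftD(1)[OF assms(2)]] assms
  by (auto simp: is_lift_def compose_def)

lemma is_lift_inv:
  assumes "is_lift F f"
  shows "is_lift (inv_into UNIV F) (restrict (inv_into circle f) circle)"
  unfolding is_lift_def
proof (intro conjI allI)
  note F = circle_liftD[OF is_liftD(1)[OF assms]]
  show "circle_lift (inv_into UNIV F)" by (rule circle_lift_inv[OF is_liftD(1)[OF assms]])
  fix x
  have "f (circle_cover (inv_into UNIV F x)) = circle_cover x"
    using is_liftD(3)[OF assms] F(3) by (simp add: bij_is_surj surj_f_inv_f)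
  then show "restrict (inv_into circle f) circle (circle_cover x) = circle_cover (inv_into UNIV F x)"
    using is_lift_bij_betw[OF assms]
    by (metis bij_betw_imp_inj_on circle_cover_in_circle inv_into_f_f restrict_apply')
qed simp

lemma is_lift_rotation: "is_lift (\<lambda>x. x + c) (rotation (circle_cover c))"
  using circle_lift_translation[of c] by (simp add: is_lift_def rotation_def circle_cover_add mult.commute)

lemma is_lift_id: "is_lift id (\<lambda>z\<in>circle. z)"
  using circle_lift_translation[of 0] by (simp add: is_lift_def id_def)

text \<open>Continuity of \<open>F\<close> at one preimage of \<open>z\<close> suffices: a nearby
  point of the circle has a preimage just as near, by the choice of \<open>n\<close>. The factor
  \<open>2 * pi\<close> compares chord with arc.\<close>

lemma is_lift_continuous_on:
  assumes "is_lift F f"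
  shows "continuous_on circle f"
  unfolding continuous_on_iff
proof (intro ballI allI impI)
  fix z :: complex and e :: real assume "z \<in> circle" "0 < e"
  obtain x where x: "z = circle_cover x" using \<open>z \<in> circle\<close> circle_cover_surj by blast
  have "isCont F x"
    using circle_lift_continuous[OF is_liftD(1)[OF assms]] by (simp add: continuous_on_eq_continuous_at)
  moreover have "0 < e / (2 * pi)" using \<open>0 < e\<close> by simp
  ultimately obtain d where d: "d > 0" "\<And>y. \<bar>y - x\<bar> < d \<Longrightarrow> \<bar>F y - F x\<bar> < e / (2 * pi)"
    unfolding continuous_at_eps_delta dist_real_def by blast
  have "dist (f w) (f z) < e" if w: "w \<in> circle" "dist w z < d" for w
  proof -
    obtain y where y: "w = circle_cover y" using w circle_cover_surj by blast
    obtain n :: int where n: "d_circle z w = \<bar>x - (y + of_int n)\<bar>"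
      unfolding x y by (rule d_circle_cover_attained)
    have "d_circle z w < d" using d_circle_le_dist[OF \<open>z \<in> circle\<close> w(1)] w(2) by (simp add: dist_commute)
    then have Fd: "\<bar>F (y + of_int n) - F x\<bar> < e / (2 * pi)" using n by (intro d) (simp add: abs_minus_commute)
    have fw: "f w = circle_cover (F (y + of_int n))"
      using is_liftD(3)[OF assms, of "y + of_int n"] y by simp
    have fz: "f z = circle_cover (F x)" using is_liftD(3)[OF assms] x by simp
    have "dist (f w) (f z) \<le> 2 * pi * d_circle (f w) (f z)"
      by (intro dist_le_d_circle) (simp_all add: fw fz)
    also have "\<dots> \<le> 2 * pi * \<bar>F (y + of_int n) - F x\<bar>"
      unfolding fw fz by (intro mult_left_mono d_circle_cover_le) simp
    also have "\<dots> < e" using Fd by (simp add: field_simps)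
    finally show ?thesis .
  qed
  then show "\<exists>d>0. \<forall>w\<in>circle. dist w z < d \<longrightarrow> dist (f w) (f z) < e" using d(1) by blast
qed

text \<open>A continuous bijection from a compact to a Hausdorff space.\<close>

lemma is_lift_circle_homeo:
  assumes "is_lift F f"
  shows "circle_homeo f"
  unfolding circle_homeo_def
proof (rule continuous_imp_homeomorphic_map)
  show "compact_space (top_of_set circle)" by (simp add: circle_def compact_space_subtopology)
  show "Hausdorff_space (top_of_set circle)" by (simp add: Hausdorff_space_subtopology)
  have b: "bij_betw f circle circle" by (rule is_lift_bij_betw[OF assms])
  show "continuous_map (top_of_set circle) (top_of_set circle) f"
    using is_lift_continuous_on[OF assms] b by (auto simp: bij_betw_def)
  show "f ` topspace (top_of_set circle) = topspace (top_of_set circle)"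
    "inj_on f (topspace (top_of_set circle))"
    using b by (auto simp: bij_betw_def)
qed

lemma circle_lift_homeomorphic_map:
  assumes "circle_lift F"
  shows "homeomorphic_map euclideanreal euclideanreal F"
proof -
  have "homeomorphic_maps euclideanreal euclideanreal F (inv_into UNIV F)"
    using circle_lift_continuous[OF assms] circle_lift_continuous[OF circle_lift_inv[OF assms]] circle_liftD(3)[OF assms]
    by (simp add: homeomorphic_maps_def bij_is_inj bij_is_surj surj_f_inv_f)
  then show ?thesis by (rule homeomorphic_maps_imp_map)
qed

text \<open>Only an integer constant separates \<open>lift f\<close> from any other lift, so they
  share their densities.\<close>

lemma lift_eq_shift:
  assumes "is_lift F f"
  shows "lift f = (\<lambda>x. F x + of_int (- \<lfloor>F 0\<rfloor>))"
proof (rule lift_eqI)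
  let ?G = "\<lambda>x. F x + of_int (- \<lfloor>F 0\<rfloor>)"
  have G: "is_lift ?G f" by (rule is_lift_shift[OF assms])
  show "homeomorphic_map euclideanreal euclideanreal ?G"
    by (rule circle_lift_homeomorphic_map[OF is_liftD(1)[OF G]])
  show "circle_cover \<circ> ?G = f \<circ> circle_cover"
    using is_liftD(3)[OF G] by (simp add: fun_eq_iff)
  show "?G 0 \<in> {0..<1}" by simp linarith
qed

lemma is_lift_lift:
  assumes "is_lift F f"
  shows "is_lift (lift f) f" and "lift f 0 \<in> {0..<1}"
proof -
  show "is_lift (lift f) f" unfolding lift_eq_shift[OF assms] by (rule is_lift_shift[OF assms])
  show "lift f 0 \<in> {0..<1}" unfolding lift_eq_shift[OF assms] by simp linarith
qed

lemma is_lift_circle_absolutely_continuous: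
  assumes "is_lift F f"
  shows "circle_absolutely_continuous f"
  using circle_liftD(5)[OF is_liftD(1)[OF is_lift_lift(1)[OF assms]]]
    has_density_imp_locally_absolutely_continuous
  unfolding circle_absolutely_continuous_def by blast

lemma is_lift_imp_AC_circle:
  assumes "is_lift F f"
  shows "f \<in> carrier AC_circle"
  using is_lift_Bij[OF assms] is_lift_circle_homeo[OF assms] is_lift_circle_absolutely_continuous[OF assms]
    is_lift_circle_absolutely_continuous[OF is_lift_inv[OF assms]]
    circle_liftD(1)[OF is_liftD(1)[OF is_lift_lift(1)[OF assms]]]
  by (simp add: AC_circle_def orientation_preserving_def)

text \<open>What needs proof is that the lift has degree exactly one, and that the normalised lift
  of the inverse map is the inverse of \<open>F\<close> up to an integer, so that its absolute
  continuity passes to the latter.\<close>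

lemma AC_circle_imp_is_lift:
  assumes "f \<in> carrier AC_circle"
  shows "is_lift (lift f) f"
proof -
  have f: "f \<in> Bij circle" "circle_homeo f" "orientation_preserving f" "circle_absolutely_continuous f"
    "circle_absolutely_continuous (restrict (inv_into circle f) circle)"
    using assms by (auto simp: AC_circle_def)
  have b: "bij_betw f circle circle" using f(1) by (simp add: Bij_def)
  obtain F where F: "homeomorphic_map euclideanreal euclideanreal F" "F 0 \<in> {0..<1}"
    "circle_cover \<circ> F = f \<circ> circle_cover"
    using circle_homeo_lift[OF f(1,2)] .
  have lF: "lift f = F" by (rule lift_eqI[OF F])
  have cov: "circle_cover (F x) = f (circle_cover x)" for x using F(3) by (metis comp_apply)
  have sm: "strict_mono F" using f(3) by (simp add: orientation_preserving_def lF)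
  have bF: "bij F" using F(1) by (simp add: homeomorphic_eq_everything_map bij_def)
  have cF: "continuous_on UNIV F" using homeomorphic_imp_continuous_map[OF F(1)] by simp
  have per: "F (x + 1) = F x + 1" for x
  proof -
    have "circle_cover (F (x + 1)) = circle_cover (F x)" for x
      using circle_cover_add_int[of x 1] by (simp add: cov)
    moreover have "continuous_on UNIV (\<lambda>x. F (x + 1))"
      by (rule continuous_on_compose2[OF cF]) (auto intro!: continuous_intros)
    ultimately obtain n :: int where n: "\<And>x. F (x + 1) = F x + of_int n"
      using circle_cover_continuous_unique[of "\<lambda>x. F (x + 1)" F] cF by blast
    have "F x < F (x + 1)" using sm by (simp add: strict_mono_less)
    then have "0 < real_of_int n" using n by simp
    then have "1 \<le> n" by linarith
    \<comment> \<open>A larger degree would make \<open>F\<close> pass through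
      \<open>F x + 1\<close> strictly inside a period, against injectivity of
      \<open>f\<close>.\<close>
    moreover have "\<not> 2 \<le> n"
    proof
      assume "2 \<le> n"
      obtain y where y: "F y = F x + 1" using bF by (metis bij_is_surj surjD)
      have "F x < F y" "F y < F (x + 1)" using y n[of x] \<open>2 \<le> n\<close> by auto
      then have xy: "x < y" "y < x + 1" using sm by (auto simp: strict_mono_less)
      have "circle_cover (F y) = circle_cover (F x)"
        using circle_cover_add_int[of "F x" 1] by (simp add: y)
      then have "f (circle_cover y) = f (circle_cover x)" by (simp add: cov)
      then have "circle_cover y = circle_cover x"
        using b by (meson bij_betw_imp_inj_on circle_cover_in_circle inj_onD)
      then obtain k :: int where "y = x + of_int k" by (auto simp: circle_cover_eq_iff)
      then have "0 < k" "k < 1" using xy by auto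
      then show False by linarith
    qed
    ultimately have "n = 1" by linarith
    then show ?thesis using n by simp
  qed
  have "locally_absolutely_continuous F" using f(4) by (simp add: circle_absolutely_continuous_def lF)
  then have dF: "\<exists>\<phi>. has_density F \<phi>"
    using locally_absolutely_continuous_imp_has_density strict_mono_mono[OF sm] by blast
  let ?f' = "restrict (inv_into circle f) circle"
  have smI: "strict_mono (inv_into UNIV F)" using sm bF by (intro strict_mono_inv_real bij_is_surj)
  have hI: "homeomorphic_map euclideanreal euclideanreal (inv_into UNIV F)"
  proof -
    obtain G where G: "homeomorphic_maps euclideanreal euclideanreal F G" using F(1) homeomorphic_map_maps by blast
    then have "inv_into UNIV F = G" using bF by (intro inv_equality) (auto simp: homeomorphic_maps_def)
    then show ?thesis using G homeomorphic_maps_map by blast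
  qed
  \<comment> \<open>The inverse of \<open>F\<close> need not take 0 into the unit interval; this
    integer repairs it, so that \<open>lift_eqI\<close> applies.\<close>
  define n where "n = - \<lfloor>inv_into UNIV F 0\<rfloor>"
  have covI: "circle_cover (inv_into UNIV F x) = ?f' (circle_cover x)" for x
  proof -
    have "f (circle_cover (inv_into UNIV F x)) = circle_cover x" using cov[of "inv_into UNIV F x"] bF by (simp add: bij_is_surj surj_f_inv_f)
    then show ?thesis using b by (metis bij_betw_imp_inj_on circle_cover_in_circle inv_into_f_f restrict_apply')
  qed
  have "lift ?f' = (\<lambda>x. inv_into UNIV F x + of_int n)"
  proof (rule lift_eqI)
    have tr: "homeomorphic_map euclideanreal euclideanreal (\<lambda>x. x + of_int n)"
      by (rule circle_lift_homeomorphic_map[OF circle_lift_translation])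
    show "homeomorphic_map euclideanreal euclideanreal (\<lambda>x. inv_into UNIV F x + of_int n)"
      using homeomorphic_map_compose[OF hI tr] by (simp add: comp_def)
    show "inv_into UNIV F 0 + of_int n \<in> {0..<1}" unfolding n_def by simp linarith
    show "circle_cover \<circ> (\<lambda>x. inv_into UNIV F x + of_int n) = ?f' \<circ> circle_cover"
      by (simp add: fun_eq_iff covI del: restrict_apply)
  qed
  then have "locally_absolutely_continuous (\<lambda>x. inv_into UNIV F x + of_int n)"
    using f(5) by (simp add: circle_absolutely_continuous_def)
  then have "locally_absolutely_continuous (inv_into UNIV F)" by (simp add: locally_absolutely_continuous_add_const)
  then have "\<exists>\<psi>. has_density (inv_into UNIV F) \<psi>"
    using locally_absolutely_continuous_imp_has_density strict_mono_mono[OF smI] by blast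
  then have "circle_lift F" using sm bF per dF by (auto simp: circle_lift_def bij_is_surj)
  then show ?thesis using f(1) cov by (simp add: is_lift_def lF Bij_imp_extensional)
qed

section \<open>The group structure in terms of lifts\<close>

lemma AC_circle_iff: "f \<in> carrier AC_circle \<longleftrightarrow> (\<exists>F. is_lift F f)"
  using is_lift_imp_AC_circle AC_circle_imp_is_lift by blast

lemma AC_circle_subgroup: "subgroup (carrier AC_circle) (BijGroup circle)"
proof (rule subgroup.intro)
  show "carrier AC_circle \<subseteq> carrier (BijGroup circle)"
    by (auto simp: AC_circle_def BijGroup_def)
next
  fix f g assume fg: "f \<in> carrier AC_circle" "g \<in> carrier AC_circle"
  then have "compose circle f g \<in> carrier AC_circle"
    using is_lift_compose by (meson AC_circle_iff)
  moreover have "f \<in> Bij circle" "g \<in> Bij circle" using fg AC_circle_iff is_lift_Bij by blast+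
  ultimately show "f \<otimes>\<^bsub>BijGroup circle\<^esub> g \<in> carrier AC_circle" by (simp add: BijGroup_def)
next
  show "\<one>\<^bsub>BijGroup circle\<^esub> \<in> carrier AC_circle"
    using is_lift_id AC_circle_iff by (auto simp: BijGroup_def)
next
  fix f assume f: "f \<in> carrier AC_circle"
  then have "f \<in> Bij circle" using AC_circle_iff is_lift_Bij by blast
  moreover have "restrict (inv_into circle f) circle \<in> carrier AC_circle"
    using f is_lift_inv by (meson AC_circle_iff)
  ultimately show "inv\<^bsub>BijGroup circle\<^esub> f \<in> carrier AC_circle" by (simp only: inv_BijGroup)
qed

text \<open>Brings the record into the shape in which general facts on subgroups of
  \<open>BijGroup circle\<close> apply.\<close>

lemma AC_circle_eq: "AC_circle = BijGroup circle\<lparr>carrier := carrier AC_circle\<rparr>"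
  by (simp add: AC_circle_def)

lemma group_AC_circle: "group AC_circle"
  using subgroup.subgroup_is_group[OF AC_circle_subgroup group_BijGroup] AC_circle_eq by simp

lemma AC_circle_mult:
  assumes "f \<in> carrier AC_circle" "g \<in> carrier AC_circle"
  shows "f \<otimes>\<^bsub>AC_circle\<^esub> g = compose circle f g"
proof -
  have "f \<in> Bij circle" "g \<in> Bij circle" using assms AC_circle_iff is_lift_Bij by blast+
  then show ?thesis by (simp add: AC_circle_def BijGroup_def)
qed

lemma AC_circle_inv:
  assumes "f \<in> carrier AC_circle"
  shows "inv\<^bsub>AC_circle\<^esub> f = restrict (inv_into circle f) circle"
proof -
  have "inv\<^bsub>AC_circle\<^esub> f = inv\<^bsub>BijGroup circle\<^esub> f"
    using group.m_inv_consistent[OF group_BijGroup AC_circle_subgroup assms] AC_circle_eq by simp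
  moreover have "f \<in> Bij circle" using assms AC_circle_iff is_lift_Bij by blast
  ultimately show ?thesis by (simp only: inv_BijGroup)
qed

subsection \<open>The metrics\<close>

lemma AC_circle_obtain:
  assumes "f \<in> carrier AC_circle"
  obtains F \<phi> where "is_lift F f" "has_density F \<phi>" "F 0 \<in> {0..<1}"
proof -
  have l: "is_lift (lift f) f" by (rule AC_circle_imp_is_lift[OF assms])
  then obtain \<phi> where "has_density (lift f) \<phi>" using circle_liftD(5)[OF is_liftD(1)[OF l]] by blast
  then show thesis using that l is_lift_lift(2)[OF l] by blast
qed

lemma has_density_unit:
  assumes "circle_lift F" "has_density F \<phi>"
  shows "(\<integral>\<^sup>+t. ennreal (\<phi> t) * indicator {0..1} t \<partial>lborel) = 1"
  using has_densityD(4)[OF assms(2), of 0 1] circle_liftD(4)[OF assms(1), of 0] by simp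

text \<open>Any lifts and any densities may be used: an integer shift leaves a density unchanged,
  and the density agrees with the derivative of \<open>lift\<close> almost everywhere. Computations
  with \<open>d_star\<close> between group members go through this formula.\<close>

lemma ennreal_d_star:
  assumes f: "is_lift F f" "has_density F \<phi>" and g: "is_lift G g" "has_density G \<gamma>"
  shows "ennreal (d_star f g) = L1_dist 0 1 \<phi> \<gamma>"
proof -
  note [measurable] = has_densityD(2)[OF f(2)] has_densityD(2)[OF g(2)]
  have d: "AE t in lborel. deriv (lift h) t = \<eta> t" if "is_lift H h" "has_density H \<eta>" for H h \<eta>
  proof -
    have "has_density (lift h) \<eta>"
      unfolding lift_eq_shift[OF that(1)] using that(2) by (rule has_density_shift)
    from has_density_AE_deriv[OF this] show ?thesis
      by eventually_elim (rule DERIV_imp_deriv)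
  qed
  let ?u = "\<lambda>t. indicator {0..1} t *\<^sub>R \<bar>\<phi> t - \<gamma> t\<bar>"
  let ?v = "\<lambda>t. indicator {0..1} t *\<^sub>R \<bar>deriv (lift f) t - deriv (lift g) t\<bar>"
  have [measurable]: "?u \<in> borel_measurable borel" by measurable
  have "AE t in lborel. ?u t = ?v t"
    using d[OF f] d[OF g] by eventually_elim simp
  then have ae: "AE t in lebesgue. ?u t = ?v t" by (rule AE_completion)
  have um: "?u \<in> borel_measurable lebesgue" by (rule measurable_completion) simp
  have "d_star f g = integral\<^sup>L lebesgue ?v" by (simp add: d_star_def set_lebesgue_integral_def)
  also have "\<dots> = integral\<^sup>L lebesgue ?u"
  proof (rule integral_cong_AE)
    \<comment> \<open>Measurability of the derivatives is inherited through the almost everywhere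
      equality, by completeness of the Lebesgue measure.\<close>
    show "?v \<in> borel_measurable lebesgue" using um ae by (rule borel_measurable_AE)
    show "AE t in lebesgue. ?v t = ?u t" using ae by eventually_elim (rule sym)
  qed (rule um)
  also have "\<dots> = integral\<^sup>L lborel ?u" by (rule integral_completion) simp
  finally have eq: "d_star f g = integral\<^sup>L lborel ?u" .
  have u: "ennreal (?u t) = ennreal \<bar>\<phi> t - \<gamma> t\<bar> * indicator {0..1} t" for t
    by (simp add: indicator_def)
  \<comment> \<open>Each density has integral 1 over a period, so the distance is at most 2; this
    finiteness allows the passage from \<open>nn_integral\<close> to the Bochner integral.\<close>
  have "L1_dist 0 1 \<phi> \<gamma>
      \<le> (\<integral>\<^sup>+t. ennreal \<bar>\<phi> t - 0\<bar> * indicator {0..1} t \<partial>lborel) + (\<integral>\<^sup>+t. ennreal \<bar>0 - \<gamma> t\<bar> * indicator {0..1} t \<partial>lborel)"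
    by (rule nn_integral_abs_triangle) measurable
  also have "\<dots> = 1 + 1"
    using has_density_unit[OF is_liftD(1)[OF f(1)] f(2)] has_density_unit[OF is_liftD(1)[OF g(1)] g(2)]
      has_densityD(3)[OF f(2)] has_densityD(3)[OF g(2)] by simp
  also have "\<dots> < \<infinity>" by simp
  finally have fin: "(\<integral>\<^sup>+t. ennreal (?u t) \<partial>lborel) < \<infinity>" by (simp only: u)
  have "integrable lborel ?u"
    by (rule integrableI_bounded) (use fin in auto)
  then have "(\<integral>\<^sup>+t. ennreal (?u t) \<partial>lborel) = ennreal (integral\<^sup>L lborel ?u)"
    by (rule nn_integral_eq_integral) auto
  then show ?thesis by (simp only: u eq)
qed

lemma d_star_nonneg: "0 \<le> d_star f g"
  by (auto simp: d_star_def set_lebesgue_integral_def intro!: integral_nonneg)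

lemma d_star_sym: "d_star f g = d_star g f"
  by (simp add: d_star_def abs_minus_commute)

lemma d_star_refl: "d_star f f = 0"
  by (simp add: d_star_def set_lebesgue_integral_def)

lemma d_star_triangle:
  assumes "f \<in> carrier AC_circle" "g \<in> carrier AC_circle" "h \<in> carrier AC_circle"
  shows "d_star f h \<le> d_star f g + d_star g h"
proof -
  obtain F \<phi> where f: "is_lift F f" "has_density F \<phi>" using AC_circle_obtain[OF assms(1)] .
  obtain G \<gamma> where g: "is_lift G g" "has_density G \<gamma>" using AC_circle_obtain[OF assms(2)] .
  obtain H \<eta> where h: "is_lift H h" "has_density H \<eta>" using AC_circle_obtain[OF assms(3)] .
  note [measurable] = has_densityD(2)[OF f(2)] has_densityD(2)[OF g(2)] has_densityD(2)[OF h(2)]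
  have "ennreal (d_star f h) \<le> ennreal (d_star f g) + ennreal (d_star g h)"
    unfolding ennreal_d_star[OF f h] ennreal_d_star[OF f g] ennreal_d_star[OF g h]
    by (rule nn_integral_abs_triangle) measurable
  also have "\<dots> = ennreal (d_star f g + d_star g h)" by (simp add: d_star_nonneg)
  finally show ?thesis by (subst (asm) ennreal_le_iff) (simp_all add: d_star_nonneg)
qed

text \<open>By the chain rule the density of \<open>H\<close> factors out of the difference, and
  substitution turns the integral into one over \<open>{H 0..H 1}\<close>, again a full
  period.\<close>

lemma d_star_right_invariant:
  assumes "f \<in> carrier AC_circle" "g \<in> carrier AC_circle" "h \<in> carrier AC_circle"
  shows "d_star (compose circle f h) (compose circle g h) = d_star f g"
proof -
  obtain F \<phi> where f: "is_lift F f" "has_density F \<phi>" using AC_circle_obtain[OF assms(1)] .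
  obtain G \<gamma> where g: "is_lift G g" "has_density G \<gamma>" using AC_circle_obtain[OF assms(2)] .
  obtain H \<eta> where h: "is_lift H h" "has_density H \<eta>" "H 0 \<in> {0..<1}" using AC_circle_obtain[OF assms(3)] .
  note [measurable] = has_densityD(2)[OF f(2)] has_densityD(2)[OF g(2)] has_densityD(2)[OF h(2)]
  note H = circle_liftD[OF is_liftD(1)[OF h(1)]]
  let ?w = "\<lambda>t. ennreal \<bar>\<phi> t - \<gamma> t\<bar>"
  have "ennreal (d_star (compose circle f h) (compose circle g h))
     = (\<integral>\<^sup>+t. ennreal \<bar>\<phi> (H t) * \<eta> t - \<gamma> (H t) * \<eta> t\<bar> * indicator {0..1} t \<partial>lborel)"
    by (rule ennreal_d_star[OF is_lift_compose[OF f(1) h(1)] has_density_compose[OF f(2) h(2) H(1,2)]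
          is_lift_compose[OF g(1) h(1)] has_density_compose[OF g(2) h(2) H(1,2)]])
  also have "\<dots> = (\<integral>\<^sup>+t. ?w (H t) * ennreal (\<eta> t) * indicator {0..1} t \<partial>lborel)"
  proof (rule nn_integral_cong)
    fix t
    have "\<bar>\<phi> (H t) * \<eta> t - \<gamma> (H t) * \<eta> t\<bar> = \<bar>\<phi> (H t) - \<gamma> (H t)\<bar> * \<eta> t"
      using has_densityD(3)[OF h(2), of t] by (simp add: abs_mult flip: left_diff_distrib)
    then show "ennreal \<bar>\<phi> (H t) * \<eta> t - \<gamma> (H t) * \<eta> t\<bar> * indicator {0..1} t = ?w (H t) * ennreal (\<eta> t) * indicator {0..1} t"
      using has_densityD(3)[OF h(2), of t] by (simp add: ennreal_mult)
  qed
  also have "\<dots> = (\<integral>\<^sup>+t. ?w t * indicator {H 0..H 1} t \<partial>lborel)"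
    by (rule nn_integral_density_subst[OF h(2) H(1,2)]) measurable
  also have "\<dots> = (\<integral>\<^sup>+t. ?w t * indicator {H 0..H 0 + 1} t \<partial>lborel)"
    using H(4)[of 0] by simp
  also have "\<dots> = (\<integral>\<^sup>+t. ?w t * indicator {0..1} t \<partial>lborel)"
  proof (rule nn_integral_AE_periodic_unit)
    show "AE t in lborel. ?w (t + 1) = ?w t"
      using has_density_AE_periodic[OF f(2) circle_liftD(4)[OF is_liftD(1)[OF f(1)]]]
        has_density_AE_periodic[OF g(2) circle_liftD(4)[OF is_liftD(1)[OF g(1)]]]
      by eventually_elim simp
  qed (use h(3) in auto)
  also have "\<dots> = ennreal (d_star f g)" by (rule ennreal_d_star[OF f g, symmetric])
  finally show ?thesis by (simp add: d_star_nonneg)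
qed

text \<open>The variation estimate for a difference. Subtraction is avoided in
  \<open>ennreal\<close>: each of the two signs comes from a triangle inequality with 0 as third
  function. An infinite right-hand side makes the claim trivial.\<close>

lemma abs_diff_increment_le:
  assumes F: "has_density F \<phi>" and G: "has_density G \<gamma>" and "a \<le> b"
  shows "ennreal \<bar>(F b - F a) - (G b - G a)\<bar> \<le> L1_dist a b \<phi> \<gamma>"
    (is "_ \<le> ?I")
proof (cases ?I)
  case (real i)
  have le: "F b - F a \<le> (G b - G a) + i"
    if F: "has_density F \<phi>" and G: "has_density G \<gamma>"
      and i: "L1_dist a b \<phi> \<gamma> = ennreal i" for F G \<phi> \<gamma>
  proof -
    note [measurable] = has_densityD(2)[OF F] has_densityD(2)[OF G]
    have nn: "0 \<le> G b - G a" using has_densityD(1)[OF G] \<open>a \<le> b\<close> by (simp add: monoD)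
    have "ennreal (F b - F a) = (\<integral>\<^sup>+t. ennreal \<bar>\<phi> t - 0\<bar> * indicator {a..b} t \<partial>lborel)"
      using has_densityD(4)[OF F \<open>a \<le> b\<close>] has_densityD(3)[OF F] by simp
    also have "\<dots> \<le> L1_dist a b \<phi> \<gamma>
       + (\<integral>\<^sup>+t. ennreal \<bar>\<gamma> t - 0\<bar> * indicator {a..b} t \<partial>lborel)"
      by (rule nn_integral_abs_triangle) measurable
    also have "\<dots> = ennreal i + ennreal (G b - G a)"
      unfolding i using has_densityD(4)[OF G \<open>a \<le> b\<close>] has_densityD(3)[OF G] by simp
    also have "\<dots> = ennreal ((G b - G a) + i)" using real(1) nn by (simp add: add.commute)
    finally show ?thesis using real(1) nn by (subst (asm) ennreal_le_iff) auto
  qed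
  have "F b - F a \<le> (G b - G a) + i" by (rule le[OF F G real(2)])
  moreover have "G b - G a \<le> (F b - F a) + i"
    by (rule le[OF G F]) (use real(2) in \<open>simp add: abs_minus_commute\<close>)
  ultimately show ?thesis unfolding real(2) by (intro ennreal_leI) linarith
qed simp

lemma lift_increment_le_d_star:
  assumes f: "is_lift F f" and g: "is_lift G g" and "0 \<le> x" "x \<le> 1"
  shows "\<bar>(F x - F 0) - (G x - G 0)\<bar> \<le> d_star f g"
proof -
  obtain \<phi> where \<phi>: "has_density F \<phi>" using circle_liftD(5)[OF is_liftD(1)[OF f]] by blast
  obtain \<gamma> where \<gamma>: "has_density G \<gamma>" using circle_liftD(5)[OF is_liftD(1)[OF g]] by blast
  have "ennreal \<bar>(F x - F 0) - (G x - G 0)\<bar> \<le> L1_dist 0 x \<phi> \<gamma>"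
    by (rule abs_diff_increment_le[OF \<phi> \<gamma> \<open>0 \<le> x\<close>])
  also have "\<dots> \<le> L1_dist 0 1 \<phi> \<gamma>"
    using \<open>x \<le> 1\<close> by (intro nn_integral_mono mult_left_mono) (auto simp: indicator_def)
  also have "\<dots> = ennreal (d_star f g)" by (rule ennreal_d_star[OF f \<phi> g \<gamma>, symmetric])
  finally show ?thesis by (simp add: d_star_nonneg)
qed

section \<open>Comparison of \<open>d_infty\<close> with \<open>d_star\<close>\<close>

text \<open>The integer \<open>n\<close> matches the two lifts optimally at 0; from there on their
  increments within one period differ by at most \<open>d_star\<close>.\<close>

lemma d_circle_le_d_star:
  assumes f: "f \<in> carrier AC_circle" and g: "g \<in> carrier AC_circle" and "z \<in> circle"
  shows "d_circle (f z) (g z) \<le> d_circle (f 1) (g 1) + d_star f g"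
proof -
  note lf = AC_circle_imp_is_lift[OF f] and lg = AC_circle_imp_is_lift[OF g]
  let ?F = "lift f" and ?G = "lift g"
  obtain x where x: "0 \<le> x" "x < 1" "z = circle_cover x" using circle_cover_surj[OF \<open>z \<in> circle\<close>] .
  have 1: "f 1 = circle_cover (?F 0)" "g 1 = circle_cover (?G 0)"
    using is_liftD(3)[OF lf, of 0] is_liftD(3)[OF lg, of 0] by auto
  obtain n :: int where n: "d_circle (f 1) (g 1) = \<bar>?F 0 - (?G 0 + of_int n)\<bar>"
    unfolding 1 by (rule d_circle_cover_attained)
  have "d_circle (f z) (g z) \<le> \<bar>?F x - (?G x + of_int n)\<bar>"
    using d_circle_cover_le[of "?F x" "?G x + of_int n"] is_liftD(3)[OF lf] is_liftD(3)[OF lg] x by simp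
  also have "\<dots> \<le> d_circle (f 1) (g 1) + d_star f g"
    unfolding n using lift_increment_le_d_star[OF lf lg, of x] x by linarith
  finally show ?thesis .
qed

lemma AC_circle_in_circle: "f \<in> carrier AC_circle \<Longrightarrow> z \<in> circle \<Longrightarrow> f z \<in> circle"
  using AC_circle_iff is_lift_circle by blast

lemma one_in_circle [simp]: "1 \<in> circle"
  by (simp add: circle_def)

lemma d_infty_le:
  assumes "\<And>z. z \<in> circle \<Longrightarrow> d_circle (f z) (g z) \<le> c"
  shows "d_infty f g \<le> c"
  unfolding d_infty_def
proof (rule cSUP_least)
  show "circle \<noteq> {}" using one_in_circle by blast
qed (rule assms)

lemma d_circle_le_d_infty:
  assumes "f \<in> carrier AC_circle" "g \<in> carrier AC_circle" "z \<in> circle"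
  shows "d_circle (f z) (g z) \<le> d_infty f g"
  unfolding d_infty_def
proof (rule cSUP_upper[OF assms(3)])
  show "bdd_above ((\<lambda>x. d_circle (f x) (g x)) ` circle)"
    by (rule bdd_aboveI2[of _ _ "1/2"])
      (rule d_circle_le_half[OF AC_circle_in_circle[OF assms(1)] AC_circle_in_circle[OF assms(2)]])
qed

lemma d_infty_right_invariant:
  assumes "h \<in> carrier AC_circle"
  shows "d_infty (compose circle f h) (compose circle g h) = d_infty f g"
proof -
  have "bij_betw h circle circle" using assms AC_circle_iff is_lift_bij_betw by blast
  then have h: "h ` circle = circle" by (simp add: bij_betw_def)
  have "(\<lambda>x. d_circle (compose circle f h x) (compose circle g h x)) ` circle
      = (\<lambda>x. d_circle (f x) (g x)) ` h ` circle"
    unfolding image_image by (intro image_cong) (simp_all add: compose_def)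
  then show ?thesis by (simp add: d_infty_def h)
qed

definition d_sum :: "(complex \<Rightarrow> complex) \<Rightarrow> (complex \<Rightarrow> complex) \<Rightarrow> real"
  where "d_sum f g = d_infty f g + d_star f g"

lemma d_infty_le_d_star:
  assumes "f \<in> carrier AC_circle" "g \<in> carrier AC_circle"
  shows "d_infty f g \<le> d_circle (f 1) (g 1) + d_star f g"
  by (intro d_infty_le d_circle_le_d_star assms)

text \<open>Together with \<open>d_sum_ge\<close>, this replaces the supremum in
  \<open>d_infty\<close> by evaluation at the single point 1, at the cost of counting
  \<open>d_star\<close> twice.\<close>

lemma d_sum_le:
  assumes "f \<in> carrier AC_circle" "g \<in> carrier AC_circle"
  shows "d_sum f g \<le> d_circle (f 1) (g 1) + 2 * d_star f g"
  using d_infty_le_d_star[OF assms] by (simp add: d_sum_def)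

lemma d_sum_ge:
  assumes "f \<in> carrier AC_circle" "g \<in> carrier AC_circle"
  shows "d_circle (f 1) (g 1) + d_star f g \<le> d_sum f g"
  using d_circle_le_d_infty[OF assms one_in_circle] by (simp add: d_sum_def)

lemma d_infty_eq_0_imp_eq:
  assumes f: "f \<in> carrier AC_circle" and g: "g \<in> carrier AC_circle" and "d_infty f g \<le> 0"
  shows "f = g"
proof (rule extensionalityI[of _ circle])
  show "f \<in> extensional circle" "g \<in> extensional circle"
    using f g AC_circle_iff is_liftD(2) by blast+
  fix z assume z: "z \<in> circle"
  have "d_circle (f z) (g z) = 0"
    using d_circle_le_d_infty[OF f g z] circle.nonneg[of "f z" "g z"] assms(3) by linarith
  then show "f z = g z" using AC_circle_in_circle[OF f z] AC_circle_in_circle[OF g z] by simp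
qed

text \<open>The locale \<open>Metric_space\<close> demands nonnegativity for all arguments, also
  outside the carrier. For points off the circle a fibre is empty and \<open>setdist\<close> is 0,
  so the family is always bounded and the supremum is genuine.\<close>

lemma d_infty_nonneg: "0 \<le> d_infty f g"
proof (cases "bdd_above ((\<lambda>x. d_circle (f x) (g x)) ` circle)")
  case True
  then have "d_circle (f 1) (g 1) \<le> d_infty f g"
    unfolding d_infty_def by (rule cSUP_upper[OF one_in_circle])
  then show ?thesis using circle.nonneg[of "f 1" "g 1"] by linarith
next
  case False
  have "d_circle x y \<le> 1/2" for x y
  proof (cases "x \<in> circle \<and> y \<in> circle")
    case True
    then show ?thesis using d_circle_le_half by blast
  next
    case False
    then have "circle_cover -` {x} = {} \<or> circle_cover -` {y} = {}"
      using circle_cover_in_circle by auto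
    then show ?thesis unfolding d_circle_def by auto
  qed
  then show ?thesis using False by (meson bdd_aboveI2)
qed

lemma d_sum_metric: "Metric_space (carrier AC_circle) d_sum"
proof
  fix f g h
  show "0 \<le> d_sum f g" by (simp add: d_sum_def d_infty_nonneg d_star_nonneg)
  show "d_sum f g = d_sum g f"
    unfolding d_sum_def d_infty_def by (simp add: circle.commute d_star_sym)
  assume f: "f \<in> carrier AC_circle" and g: "g \<in> carrier AC_circle"
  show "d_sum f g = 0 \<longleftrightarrow> f = g"
  proof
    assume "d_sum f g = 0"
    then show "f = g" using d_infty_eq_0_imp_eq[OF f g] d_star_nonneg[of f g] by (simp add: d_sum_def)
  next
    assume "f = g"
    then show "d_sum f g = 0"
      using d_infty_le[of f f 0] d_infty_nonneg[of f f] AC_circle_in_circle[OF f]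
      by (force simp: d_sum_def d_star_refl intro: antisym)
  qed
  assume h: "h \<in> carrier AC_circle"
  have "d_infty f h \<le> d_infty f g + d_infty g h"
  proof (rule d_infty_le)
    fix z assume z: "z \<in> circle"
    have "d_circle (f z) (h z) \<le> d_circle (f z) (g z) + d_circle (g z) (h z)"
      by (rule circle.triangle[OF AC_circle_in_circle[OF f z] AC_circle_in_circle[OF g z] AC_circle_in_circle[OF h z]])
    then show "d_circle (f z) (h z) \<le> d_infty f g + d_infty g h"
      using d_circle_le_d_infty[OF f g z] d_circle_le_d_infty[OF g h z] by linarith
  qed
  then show "d_sum f h \<le> d_sum f g + d_sum g h"
    using d_star_triangle[OF f g h] by (simp add: d_sum_def)
qed

lemma AC_circle_fix_D: "k \<in> AC_circle_fix \<Longrightarrow> k \<in> carrier AC_circle" "k \<in> AC_circle_fix \<Longrightarrow> k 1 = 1"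
  by (auto simp: AC_circle_fix_def)

text \<open>Members of the stabiliser agree at 1, so \<open>d_star\<close> alone bounds
  \<open>d_infty\<close> and separates them.\<close>

theorem d_star_metric: "Metric_space AC_circle_fix d_star"
proof
  fix f g h
  show "0 \<le> d_star f g" by (rule d_star_nonneg)
  show "d_star f g = d_star g f" by (rule d_star_sym)
  assume f: "f \<in> AC_circle_fix" and g: "g \<in> AC_circle_fix"
  show "d_star f g = 0 \<longleftrightarrow> f = g"
  proof
    assume "d_star f g = 0"
    then have "d_infty f g \<le> 0"
      using d_infty_le_d_star[of f g] AC_circle_fix_D[OF f] AC_circle_fix_D[OF g] by simp
    then show "f = g" using AC_circle_fix_D[OF f] AC_circle_fix_D[OF g] d_infty_eq_0_imp_eq by blast
  qed (simp add: d_star_refl)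
  assume h: "h \<in> AC_circle_fix"
  show "d_star f h \<le> d_star f g + d_star g h"
    using f g h by (intro d_star_triangle AC_circle_fix_D)
qed

lemma d_sum_right_invariant:
  assumes "f \<in> carrier AC_circle" "g \<in> carrier AC_circle" "h \<in> carrier AC_circle"
  shows "d_sum (compose circle f h) (compose circle g h) = d_sum f g"
  using d_star_right_invariant[OF assms] d_infty_right_invariant[OF assms(3)] by (simp add: d_sum_def)

lemma ennreal_add_strict_right_mono:
  fixes x y c :: ennreal
  assumes "x < y" "c \<noteq> \<infinity>"
  shows "x + c < y + c"
  using assms by (simp add: ennreal_add_left_cancel_less add.commute)

section \<open>Continuity of left translations\<close>

text \<open>The composite with \<open>g\<close> has density
  \<open>\<phi> (G t) * \<gamma> t\<close>. With a continuous \<open>\<psi>\<close> near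
  \<open>\<phi>\<close>, the passage to \<open>\<phi> (G' t) * \<gamma>' t\<close> takes four steps
  of \<open>e/4\<close>: from \<open>\<phi>\<close> to \<open>\<psi>\<close>, from \<open>G\<close>
  to \<open>G'\<close>, from \<open>\<gamma>\<close> to \<open>\<gamma>'\<close>, and back to
  \<open>\<phi>\<close>. By substitution the outer two errors are bounded independently of the group
  element, so \<open>\<psi>\<close> can be fixed before \<open>g'\<close>.\<close>

lemma d_star_left_continuous:
  assumes f: "f \<in> carrier AC_circle" and g: "g \<in> carrier AC_circle" and "0 < e"
  shows "\<exists>d>0. \<forall>g'\<in>carrier AC_circle. d_sum g g' < d \<longrightarrow>
    d_star (compose circle f g) (compose circle f g') < e"
proof -
  obtain F \<phi> where F: "is_lift F f" "has_density F \<phi>" using AC_circle_obtain[OF f] .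
  obtain G \<gamma> where G: "is_lift G g" "has_density G \<gamma>" "G 0 \<in> {0..<1}" using AC_circle_obtain[OF g] .
  note [measurable] = has_densityD(2)[OF F(2)] has_densityD(2)[OF G(2)]
  note GL = circle_liftD[OF is_liftD(1)[OF G(1)]]
  \<comment> \<open>On the unit interval \<open>G\<close> takes values in \<open>{0..2}\<close>, and
    any \<open>G'\<close> closer than 1 to it takes values in \<open>{-1..3}\<close>; both fit into
    \<open>{-2..3}\<close>.\<close>
  have "(\<integral>\<^sup>+t. ennreal (\<phi> t) * indicator {-2..3} t \<partial>lborel) < \<infinity>"
    using has_densityD(4)[OF F(2), of "-2" 3] by simp
  then obtain \<psi> M where \<psi>: "continuous_on UNIV \<psi>" "\<And>t. 0 \<le> \<psi> t \<and> \<psi> t \<le> M"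
    "L1_dist (-2) 3 \<phi> \<psi> < ennreal (e/4)"
    using continuous_dense_in_L1[of \<phi> "-2" 3 "e/4"] has_densityD(2,3)[OF F(2)] \<open>0 < e\<close> by auto
  have [measurable]: "\<psi> \<in> borel_measurable borel"
    using \<psi>(1) by (rule borel_measurable_continuous_onI)
  have M: "0 \<le> M" using \<psi>(2)[of 0] by linarith
  have "uniformly_continuous_on {-2..3} \<psi>"
    using \<psi>(1) by (intro compact_uniformly_continuous) (auto intro: continuous_on_subset)
  moreover have "0 < e/4" using \<open>0 < e\<close> by simp
  ultimately obtain \<eta> where \<eta>: "\<eta> > 0" "\<And>s t. s \<in> {-2..3} \<Longrightarrow> t \<in> {-2..3} \<Longrightarrow> dist s t < \<eta> \<Longrightarrow> dist (\<psi> s) (\<psi> t) < e/4"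
    unfolding uniformly_continuous_on_def by metis
  \<comment> \<open>\<open>\<eta>\<close> serves uniform continuity, 1 keeps the values of
    \<open>G'\<close> in range, and the last term makes \<open>M * d_star g g'\<close> at most
    \<open>e/4\<close>; the added 1 allows \<open>M = 0\<close>.\<close>
  define d where "d = min (min \<eta> 1) (e / (4 * (M + 1)))"
  have "d > 0" using \<eta>(1) \<open>0 < e\<close> M by (simp add: d_def)
  have "d_star (compose circle f g) (compose circle f g') < e"
    if g': "g' \<in> carrier AC_circle" and close: "d_sum g g' < d" for g'
  proof -
    note lg' = AC_circle_imp_is_lift[OF g']
    have 1: "g 1 = circle_cover (G 0)" "g' 1 = circle_cover (lift g' 0)"
      using is_liftD(3)[OF G(1), of 0] is_liftD(3)[OF lg', of 0] by auto
    \<comment> \<open>The lift of \<open>g'\<close> is chosen close to \<open>G\<close> at 0 on the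
      line, and not merely modulo integers.\<close>
    obtain n :: int where n: "d_circle (g 1) (g' 1) = \<bar>G 0 - (lift g' 0 + of_int n)\<bar>"
      unfolding 1 by (rule d_circle_cover_attained)
    define G' where "G' x = lift g' x + of_int n" for x
    have G': "is_lift G' g'" unfolding G'_def by (rule is_lift_shift[OF lg'])
    note GL' = circle_liftD[OF is_liftD(1)[OF G']]
    obtain \<gamma>' where \<gamma>': "has_density G' \<gamma>'" using GL'(5) by blast
    note [measurable] = has_densityD(2)[OF \<gamma>']
    have [measurable]: "G \<in> borel_measurable borel" "G' \<in> borel_measurable borel"
      using has_densityD(1)[OF G(2)] has_densityD(1)[OF \<gamma>'] by (auto intro: borel_measurable_mono)
    have GG': "\<bar>G x - G' x\<bar> < d" if "0 \<le> x" "x \<le> 1" for x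
    proof -
      have "\<bar>G x - G' x\<bar> \<le> d_circle (g 1) (g' 1) + d_star g g'"
        using lift_increment_le_d_star[OF G(1) G' that] n by (simp add: G'_def)
      then show ?thesis using d_sum_ge[OF g g'] close by linarith
    qed
    have Gr: "0 \<le> G x" "G x \<le> 2" if "0 \<le> x" "x \<le> 1" for x
      using that G(3) GL(4)[of 0] strict_mono_less_eq[OF GL(1), of 0 x] strict_mono_less_eq[OF GL(1), of x 1] by auto
    have Gr': "-1 \<le> G' x" "G' x \<le> 3" if "0 \<le> x" "x \<le> 1" for x
      using GG'[OF that] Gr[OF that] by (auto simp: d_def)
    \<comment> \<open>The uniform error: substitution gives the distance of \<open>\<phi>\<close>
      and \<open>\<psi>\<close> over \<open>{H 0..H 1}\<close>, for any such
      \<open>H\<close>.\<close>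
    have sub: "(\<integral>\<^sup>+t. ennreal \<bar>\<phi> (H t) * h t - \<psi> (H t) * h t\<bar> * indicator {0..1} t \<partial>lborel) < ennreal (e/4)"
      if H: "has_density H h" "strict_mono H" "surj H" "-2 \<le> H 0" "H 1 \<le> 3" for H h
    proof -
      have "(\<integral>\<^sup>+t. ennreal \<bar>\<phi> (H t) * h t - \<psi> (H t) * h t\<bar> * indicator {0..1} t \<partial>lborel)
        = (\<integral>\<^sup>+t. ennreal \<bar>\<phi> (H t) - \<psi> (H t)\<bar> * ennreal (h t) * indicator {0..1} t \<partial>lborel)"
      proof (rule nn_integral_cong)
        fix t
        have "\<bar>\<phi> (H t) * h t - \<psi> (H t) * h t\<bar> = \<bar>\<phi> (H t) - \<psi> (H t)\<bar> * h t"
          using has_densityD(3)[OF H(1), of t] by (simp add: abs_mult flip: left_diff_distrib)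
        then show "ennreal \<bar>\<phi> (H t) * h t - \<psi> (H t) * h t\<bar> * indicator {0..1} t
          = ennreal \<bar>\<phi> (H t) - \<psi> (H t)\<bar> * ennreal (h t) * indicator {0..1} t"
          using has_densityD(3)[OF H(1), of t] by (simp add: ennreal_mult)
      qed
      also have "\<dots> = L1_dist (H 0) (H 1) \<phi> \<psi>"
        by (rule nn_integral_density_subst[OF H(1-3)]) measurable
      also have "\<dots> \<le> L1_dist (-2) 3 \<phi> \<psi>"
        using H(4,5) by (intro nn_integral_mono mult_left_mono) (auto simp: indicator_def)
      also note \<psi>(3)
      finally show ?thesis .
    qed
    have T1: "(\<integral>\<^sup>+t. ennreal \<bar>\<phi> (G t) * \<gamma> t - \<psi> (G t) * \<gamma> t\<bar> * indicator {0..1} t \<partial>lborel) < ennreal (e/4)"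
      using Gr[of 0] Gr[of 1] by (intro sub G(2) GL(1,2)) auto
    have "(\<integral>\<^sup>+t. ennreal \<bar>\<phi> (G' t) * \<gamma>' t - \<psi> (G' t) * \<gamma>' t\<bar> * indicator {0..1} t \<partial>lborel) < ennreal (e/4)"
      using Gr'[of 0] Gr'[of 1] by (intro sub \<gamma>' GL'(1,2)) auto
    then have T4: "(\<integral>\<^sup>+t. ennreal \<bar>\<psi> (G' t) * \<gamma>' t - \<phi> (G' t) * \<gamma>' t\<bar> * indicator {0..1} t \<partial>lborel) < ennreal (e/4)"
      by (simp add: abs_minus_commute)
    have T2: "(\<integral>\<^sup>+t. ennreal \<bar>\<psi> (G t) * \<gamma> t - \<psi> (G' t) * \<gamma> t\<bar> * indicator {0..1} t \<partial>lborel) \<le> ennreal (e/4)"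
    proof -
      have "(\<integral>\<^sup>+t. ennreal \<bar>\<psi> (G t) * \<gamma> t - \<psi> (G' t) * \<gamma> t\<bar> * indicator {0..1} t \<partial>lborel)
        \<le> (\<integral>\<^sup>+t. ennreal (e/4) * (ennreal (\<gamma> t) * indicator {0..1} t) \<partial>lborel)"
      proof (rule nn_integral_mono)
        fix t
        show "ennreal \<bar>\<psi> (G t) * \<gamma> t - \<psi> (G' t) * \<gamma> t\<bar> * indicator {0..1} t
          \<le> ennreal (e/4) * (ennreal (\<gamma> t) * indicator {0..1} t)"
        proof (cases "t \<in> {0..1}")
          case True
          have "dist (\<psi> (G t)) (\<psi> (G' t)) < e/4"
            using True Gr[of t] Gr'[of t] GG'[of t] by (intro \<eta>(2)) (auto simp: dist_real_def d_def)
          then have "\<bar>\<psi> (G t) - \<psi> (G' t)\<bar> * \<gamma> t \<le> e/4 * \<gamma> t"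
            using has_densityD(3)[OF G(2), of t] by (intro mult_right_mono) (auto simp: dist_real_def)
          moreover have "\<bar>\<psi> (G t) * \<gamma> t - \<psi> (G' t) * \<gamma> t\<bar> = \<bar>\<psi> (G t) - \<psi> (G' t)\<bar> * \<gamma> t"
            using has_densityD(3)[OF G(2), of t] by (simp add: abs_mult flip: left_diff_distrib)
          ultimately have "ennreal \<bar>\<psi> (G t) * \<gamma> t - \<psi> (G' t) * \<gamma> t\<bar> \<le> ennreal (e/4 * \<gamma> t)"
            by (intro ennreal_leI) simp
          also have "\<dots> = ennreal (e/4) * ennreal (\<gamma> t)"
            using \<open>0 < e\<close> has_densityD(3)[OF G(2), of t] by (intro ennreal_mult) auto
          finally show ?thesis using True by simp
        qed simp
      qed
      also have "\<dots> = ennreal (e/4) * (\<integral>\<^sup>+t. ennreal (\<gamma> t) * indicator {0..1} t \<partial>lborel)"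
        by (rule nn_integral_cmult) measurable
      also have "\<dots> = ennreal (e/4)"
        by (simp add: has_density_unit[OF is_liftD(1)[OF G(1)] G(2)])
      finally show ?thesis .
    qed
    have T3: "(\<integral>\<^sup>+t. ennreal \<bar>\<psi> (G' t) * \<gamma> t - \<psi> (G' t) * \<gamma>' t\<bar> * indicator {0..1} t \<partial>lborel) \<le> ennreal (e/4)"
    proof -
      have "(\<integral>\<^sup>+t. ennreal \<bar>\<psi> (G' t) * \<gamma> t - \<psi> (G' t) * \<gamma>' t\<bar> * indicator {0..1} t \<partial>lborel)
        \<le> (\<integral>\<^sup>+t. ennreal M * (ennreal \<bar>\<gamma> t - \<gamma>' t\<bar> * indicator {0..1} t) \<partial>lborel)"
      proof (rule nn_integral_mono)
        fix t
        have "\<bar>\<psi> (G' t) * \<gamma> t - \<psi> (G' t) * \<gamma>' t\<bar> = \<psi> (G' t) * \<bar>\<gamma> t - \<gamma>' t\<bar>"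
          using \<psi>(2)[of "G' t"] by (simp add: abs_mult flip: right_diff_distrib)
        also have "\<dots> \<le> M * \<bar>\<gamma> t - \<gamma>' t\<bar>" using \<psi>(2)[of "G' t"] by (intro mult_right_mono) auto
        finally have "ennreal \<bar>\<psi> (G' t) * \<gamma> t - \<psi> (G' t) * \<gamma>' t\<bar> \<le> ennreal M * ennreal \<bar>\<gamma> t - \<gamma>' t\<bar>"
          using M by (simp add: ennreal_leI flip: ennreal_mult)
        then show "ennreal \<bar>\<psi> (G' t) * \<gamma> t - \<psi> (G' t) * \<gamma>' t\<bar> * indicator {0..1} t
          \<le> ennreal M * (ennreal \<bar>\<gamma> t - \<gamma>' t\<bar> * indicator {0..1} t)"
          by (simp add: indicator_def)
      qed
      also have "\<dots> = ennreal M * L1_dist 0 1 \<gamma> \<gamma>'"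
        by (rule nn_integral_cmult) measurable
      also have "\<dots> = ennreal (M * d_star g g')"
        using M by (simp add: ennreal_d_star[OF G(1,2) G' \<gamma>', symmetric] ennreal_mult d_star_nonneg)
      also have "\<dots> \<le> ennreal (e/4)"
      proof (rule ennreal_leI)
        have "d \<le> e / (4 * (M + 1))" by (simp add: d_def)
        then have "d_star g g' \<le> e / (4 * (M + 1))"
          using d_sum_ge[OF g g'] circle.nonneg[of "g 1" "g' 1"] close by linarith
        then have "M * d_star g g' \<le> M * (e / (4 * (M + 1)))" using M by (rule mult_left_mono)
        also have "\<dots> \<le> e/4" using M \<open>0 < e\<close> by (simp add: field_simps)
        finally show "M * d_star g g' \<le> e/4" .
      qed
      finally show ?thesis .
    qed
    have "ennreal (d_star (compose circle f g) (compose circle f g'))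
       = (\<integral>\<^sup>+t. ennreal \<bar>\<phi> (G t) * \<gamma> t - \<phi> (G' t) * \<gamma>' t\<bar> * indicator {0..1} t \<partial>lborel)"
      by (rule ennreal_d_star[OF is_lift_compose[OF F(1) G(1)] has_density_compose[OF F(2) G(2) GL(1,2)]
            is_lift_compose[OF F(1) G'] has_density_compose[OF F(2) \<gamma>' GL'(1,2)]])
    also have "\<dots> \<le> (\<integral>\<^sup>+t. ennreal \<bar>\<phi> (G t) * \<gamma> t - \<psi> (G t) * \<gamma> t\<bar> * indicator {0..1} t \<partial>lborel)
       + (\<integral>\<^sup>+t. ennreal \<bar>\<psi> (G t) * \<gamma> t - \<phi> (G' t) * \<gamma>' t\<bar> * indicator {0..1} t \<partial>lborel)"
      by (rule nn_integral_abs_triangle) measurable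
    also have "\<dots> \<le> (\<integral>\<^sup>+t. ennreal \<bar>\<phi> (G t) * \<gamma> t - \<psi> (G t) * \<gamma> t\<bar> * indicator {0..1} t \<partial>lborel)
       + ((\<integral>\<^sup>+t. ennreal \<bar>\<psi> (G t) * \<gamma> t - \<psi> (G' t) * \<gamma> t\<bar> * indicator {0..1} t \<partial>lborel)
       + (\<integral>\<^sup>+t. ennreal \<bar>\<psi> (G' t) * \<gamma> t - \<phi> (G' t) * \<gamma>' t\<bar> * indicator {0..1} t \<partial>lborel))"
      by (intro add_left_mono nn_integral_abs_triangle) measurable
    also have "\<dots> \<le> (\<integral>\<^sup>+t. ennreal \<bar>\<phi> (G t) * \<gamma> t - \<psi> (G t) * \<gamma> t\<bar> * indicator {0..1} t \<partial>lborel)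
       + ((\<integral>\<^sup>+t. ennreal \<bar>\<psi> (G t) * \<gamma> t - \<psi> (G' t) * \<gamma> t\<bar> * indicator {0..1} t \<partial>lborel)
       + ((\<integral>\<^sup>+t. ennreal \<bar>\<psi> (G' t) * \<gamma> t - \<psi> (G' t) * \<gamma>' t\<bar> * indicator {0..1} t \<partial>lborel)
       + (\<integral>\<^sup>+t. ennreal \<bar>\<psi> (G' t) * \<gamma>' t - \<phi> (G' t) * \<gamma>' t\<bar> * indicator {0..1} t \<partial>lborel)))"
      by (intro add_left_mono nn_integral_abs_triangle) measurable
    also have "\<dots> \<le> (\<integral>\<^sup>+t. ennreal \<bar>\<phi> (G t) * \<gamma> t - \<psi> (G t) * \<gamma> t\<bar> * indicator {0..1} t \<partial>lborel)
       + (ennreal (e/4) + (ennreal (e/4) + ennreal (e/4)))"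
      by (intro add_left_mono add_mono T2 T3 less_imp_le[OF T4])
    \<comment> \<open>The strict bound \<open>T1\<close> makes the whole estimate strict.\<close>
    also have "\<dots> < ennreal (e/4) + (ennreal (e/4) + (ennreal (e/4) + ennreal (e/4)))"
      by (rule ennreal_add_strict_right_mono[OF T1]) simp
    also have "\<dots> = ennreal e" using \<open>0 < e\<close> by (simp flip: ennreal_plus)
    finally show ?thesis using \<open>0 < e\<close> by (simp add: ennreal_less_iff d_star_nonneg)
  qed
  then show ?thesis using \<open>d > 0\<close> by blast
qed

text \<open>By \<open>d_sum_le\<close> it suffices to control the point 1, through continuity of
  \<open>f\<close> at \<open>g 1\<close>, and \<open>d_star\<close>, which counts twice; hence the
  thirds.\<close>

lemma d_sum_left_continuous:
  assumes f: "f \<in> carrier AC_circle" and g: "g \<in> carrier AC_circle" and "0 < e"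
  shows "\<exists>d>0. \<forall>g'\<in>carrier AC_circle. d_sum g g' < d \<longrightarrow>
    d_sum (compose circle f g) (compose circle f g') < e"
proof -
  obtain d1 where d1: "d1 > 0" "\<And>g'. g' \<in> carrier AC_circle \<Longrightarrow> d_sum g g' < d1 \<Longrightarrow>
    d_star (compose circle f g) (compose circle f g') < e/3"
    using d_star_left_continuous[OF f g, of "e/3"] \<open>0 < e\<close> by auto
  obtain F where "is_lift F f" using f AC_circle_iff by blast
  then have "continuous_on circle f" by (rule is_lift_continuous_on)
  moreover have g1: "g 1 \<in> circle" by (rule AC_circle_in_circle[OF g one_in_circle])
  moreover have "0 < e/3" using \<open>0 < e\<close> by simp
  ultimately obtain d2 where d2: "d2 > 0" "\<And>w. w \<in> circle \<Longrightarrow> dist w (g 1) < d2 \<Longrightarrow> dist (f w) (f (g 1)) < e/3"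
    unfolding continuous_on_iff by metis
  have "d_sum (compose circle f g) (compose circle f g') < e"
    if g': "g' \<in> carrier AC_circle" and close: "d_sum g g' < min d1 (d2 / (2 * pi))" for g'
  proof -
    have g1': "g' 1 \<in> circle" by (rule AC_circle_in_circle[OF g' one_in_circle])
    have "d_circle (g 1) (g' 1) < d2 / (2 * pi)"
      using d_sum_ge[OF g g'] d_star_nonneg[of g g'] close by linarith
    then have "2 * pi * d_circle (g 1) (g' 1) < d2" by (simp add: field_simps)
    then have "dist (g' 1) (g 1) < d2" using dist_le_d_circle[OF g1 g1'] by (simp add: dist_commute)
    then have "dist (f (g' 1)) (f (g 1)) < e/3" by (intro d2 g1')
    then have "d_circle (f (g 1)) (f (g' 1)) < e/3"
      using d_circle_le_dist[OF AC_circle_in_circle[OF f g1] AC_circle_in_circle[OF f g1']]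
      by (simp add: dist_commute)
    then have c: "d_circle (compose circle f g 1) (compose circle f g' 1) < e/3" by (simp add: compose_def)
    have G: "compose circle f g \<in> carrier AC_circle" "compose circle f g' \<in> carrier AC_circle"
      using f g g' is_lift_compose by (meson AC_circle_iff)+
    have "d_star (compose circle f g) (compose circle f g') < e/3" using close by (intro d1 g') simp
    then show ?thesis using d_sum_le[OF G] c by linarith
  qed
  moreover have "0 < min d1 (d2 / (2 * pi))" using d1(1) d2(1) by simp
  ultimately show ?thesis by blast
qed

subsection \<open>The topology of the group\<close>

text \<open>Products are compared through \<open>x \<otimes> y'\<close>: one step is left
  continuity, the other has length \<open>d x x'\<close> by right invariance. For inverses, right
  multiplication by \<open>y\<close> turns the distance into that of
  \<open>inv x \<otimes> x\<close> and \<open>inv x \<otimes> y\<close>, which is left continuity at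
  \<open>x\<close>.\<close>

lemma topological_group_right_invariant_metric:
  fixes G (structure)
  assumes G: "group G" and metric: "Metric_space (carrier G) d"
    and inv: "\<And>x y z. \<lbrakk>x \<in> carrier G; y \<in> carrier G; z \<in> carrier G\<rbrakk> \<Longrightarrow> d (x \<otimes> z) (y \<otimes> z) = d x y"
    and left: "\<And>x y e. \<lbrakk>x \<in> carrier G; y \<in> carrier G; 0 < e\<rbrakk> \<Longrightarrow>
      \<exists>r>0. \<forall>y'\<in>carrier G. d y y' < r \<longrightarrow> d (x \<otimes> y) (x \<otimes> y') < e"
  shows "topological_group G (Metric_space.mtopology (carrier G) d)"
proof -
  interpret group G by fact
  interpret M: Metric_space "carrier G" d by fact
  interpret MM: Metric_space12 "carrier G" d "carrier G" d ..
  have "continuous_map MM.Prod_metric.mtopology M.mtopology (\<lambda>(x, y). x \<otimes> y)"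
    unfolding MM.Prod_metric.metric_continuous_map[OF metric]
  proof (intro conjI ballI allI impI)
    show "(\<lambda>(x, y). x \<otimes> y) ` (carrier G \<times> carrier G) \<subseteq> carrier G" by auto
    fix a and e :: real assume "a \<in> carrier G \<times> carrier G" "0 < e"
    then obtain x y where a: "a = (x, y)" "x \<in> carrier G" "y \<in> carrier G" by auto
    obtain r where r: "r > 0" "\<And>y'. y' \<in> carrier G \<Longrightarrow> d y y' < r \<Longrightarrow> d (x \<otimes> y) (x \<otimes> y') < e/2"
      using left[OF a(2,3), of "e/2"] \<open>0 < e\<close> by auto
    have "d (x \<otimes> y) (x' \<otimes> y') < e"
      if x'y': "x' \<in> carrier G" "y' \<in> carrier G" "prod_dist d d (x, y) (x', y') < min r (e/2)" for x' y'
    proof -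
      have "d x x' < e/2" "d y y' < r"
        using MM.component_le_prod_metric(1)[of x x' y y'] MM.component_le_prod_metric(2)[of y y' x x'] x'y'(3)
        by linarith+
      then have "d (x \<otimes> y) (x \<otimes> y') < e/2" "d (x \<otimes> y') (x' \<otimes> y') < e/2"
        using r(2) inv a x'y' by auto
      moreover have "d (x \<otimes> y) (x' \<otimes> y') \<le> d (x \<otimes> y) (x \<otimes> y') + d (x \<otimes> y') (x' \<otimes> y')"
        using a x'y' by (intro M.triangle) auto
      ultimately show ?thesis by linarith
    qed
    then show "\<exists>\<delta>>0. \<forall>z. z \<in> carrier G \<times> carrier G \<and> prod_dist d d a z < \<delta> \<longrightarrow>
      d (case a of (x, y) \<Rightarrow> x \<otimes> y) (case z of (x, y) \<Rightarrow> x \<otimes> y) < e"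
      using r(1) \<open>0 < e\<close> a(1) by (intro exI[of _ "min r (e/2)"]) auto
  qed
  moreover have "continuous_map M.mtopology M.mtopology (\<lambda>x. inv x)"
    unfolding M.metric_continuous_map[OF metric]
  proof (intro conjI ballI allI impI)
    fix x and e :: real assume x: "x \<in> carrier G" and "0 < e"
    obtain r where r: "r > 0" "\<And>y. y \<in> carrier G \<Longrightarrow> d x y < r \<Longrightarrow> d (inv x \<otimes> x) (inv x \<otimes> y) < e"
      using left[of "inv x" x e] x \<open>0 < e\<close> by auto
    have "d (inv x) (inv y) < e" if y: "y \<in> carrier G" "d x y < r" for y
    proof -
      have "d (inv x) (inv y) = d (inv x \<otimes> y) (inv y \<otimes> y)"
        using x y by (intro inv[symmetric]) auto
      also have "\<dots> = d (inv x \<otimes> x) (inv x \<otimes> y)" using x y by (simp add: M.commute)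
      also have "\<dots> < e" by (intro r y)
      finally show ?thesis .
    qed
    then show "\<exists>\<delta>>0. \<forall>y. y \<in> carrier G \<and> d x y < \<delta> \<longrightarrow> d (inv x) (inv y) < e"
      using r(1) by blast
  qed auto
  ultimately show ?thesis
    using G by (simp add: topological_group_def MM.mtopology_prod_metric)
qed

lemma d_sum_topological_group: "topological_group AC_circle (Metric_space.mtopology (carrier AC_circle) d_sum)"
proof (rule topological_group_right_invariant_metric[OF group_AC_circle d_sum_metric])
  fix x y z assume "x \<in> carrier AC_circle" "y \<in> carrier AC_circle" "z \<in> carrier AC_circle"
  then show "d_sum (x \<otimes>\<^bsub>AC_circle\<^esub> z) (y \<otimes>\<^bsub>AC_circle\<^esub> z) = d_sum x y"
    by (simp add: AC_circle_mult d_sum_right_invariant)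
next
  fix x y and e :: real assume xy: "x \<in> carrier AC_circle" "y \<in> carrier AC_circle" and "0 < e"
  then show "\<exists>r>0. \<forall>y'\<in>carrier AC_circle. d_sum y y' < r \<longrightarrow>
      d_sum (x \<otimes>\<^bsub>AC_circle\<^esub> y) (x \<otimes>\<^bsub>AC_circle\<^esub> y') < e"
    using d_sum_left_continuous[OF xy \<open>0 < e\<close>] by (simp add: AC_circle_mult)
qed

section \<open>The map \<open>Omega\<close> as a homeomorphism\<close>

lemma is_lift_Omega:
  assumes "is_lift K k"
  shows "is_lift (\<lambda>x. K x + c) (Omega (circle_cover c, k))"
  using is_lift_compose[OF is_lift_rotation[of c] assms] by (simp add: Omega_def comp_def)

lemma Omega_in_AC_circle:
  assumes "h \<in> circle" "k \<in> AC_circle_fix"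
  shows "Omega (h, k) \<in> carrier AC_circle"
proof -
  obtain c where c: "h = circle_cover c" using circle_cover_surj[OF assms(1)] by blast
  obtain K where "is_lift K k" using AC_circle_fix_D(1)[OF assms(2)] AC_circle_iff by blast
  then show ?thesis unfolding c AC_circle_iff using is_lift_Omega by blast
qed

lemma Omega_at_1: "h \<in> circle \<Longrightarrow> k \<in> AC_circle_fix \<Longrightarrow> Omega (h, k) 1 = h"
  by (simp add: Omega_def compose_def rotation_def AC_circle_fix_D)

text \<open>A rotation shifts a lift by a constant, which the density does not see.\<close>

lemma d_star_Omega:
  assumes "h \<in> circle" "k \<in> AC_circle_fix" "h' \<in> circle" "k' \<in> AC_circle_fix"
  shows "d_star (Omega (h, k)) (Omega (h', k')) = d_star k k'"
proof -
  obtain c c' where c: "h = circle_cover c" "h' = circle_cover c'" using assms circle_cover_surj by metis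
  obtain K \<kappa> where K: "is_lift K k" "has_density K \<kappa>" using AC_circle_obtain[OF AC_circle_fix_D(1)[OF assms(2)]] .
  obtain K' \<kappa>' where K': "is_lift K' k'" "has_density K' \<kappa>'" using AC_circle_obtain[OF AC_circle_fix_D(1)[OF assms(4)]] .
  have "ennreal (d_star (Omega (h, k)) (Omega (h', k'))) = ennreal (d_star k k')"
    unfolding ennreal_d_star[OF K K'] c
    by (rule ennreal_d_star[OF is_lift_Omega[OF K(1)] has_density_shift[OF K(2)]
          is_lift_Omega[OF K'(1)] has_density_shift[OF K'(2)]])
  then show ?thesis by (simp add: d_star_nonneg)
qed

lemma d_sum_Omega:
  assumes "h \<in> circle" "k \<in> AC_circle_fix" "h' \<in> circle" "k' \<in> AC_circle_fix"
  shows "d_sum (Omega (h, k)) (Omega (h', k')) \<le> d_circle h h' + 2 * d_star k k'"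
    and "d_circle h h' + d_star k k' \<le> d_sum (Omega (h, k)) (Omega (h', k'))"
  using d_sum_le[of "Omega (h, k)" "Omega (h', k')"] d_sum_ge[of "Omega (h, k)" "Omega (h', k')"] assms
  by (simp_all add: Omega_in_AC_circle Omega_at_1 d_star_Omega)

text \<open>The lower bound in \<open>d_sum_Omega\<close> gives injectivity. For surjectivity,
  rotating \<open>f\<close> back by its value at 1 yields the component in the stabiliser.\<close>

theorem Omega_bij_betw: "bij_betw Omega (circle \<times> AC_circle_fix) (carrier AC_circle)"
proof (rule bij_betw_imageI)
  show "inj_on Omega (circle \<times> AC_circle_fix)"
  proof (rule inj_onI, clarify)
    fix h k h' k' assume hk: "h \<in> circle" "k \<in> AC_circle_fix" "h' \<in> circle" "k' \<in> AC_circle_fix"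
      and eq: "Omega (h, k) = Omega (h', k')"
    have "d_circle h h' + d_star k k' \<le> 0"
      using d_sum_Omega(2)[OF hk] Metric_space.zero[OF d_sum_metric, of "Omega (h, k)" "Omega (h, k)"]
        Omega_in_AC_circle[OF hk(1,2)] by (simp add: eq)
    then have "d_circle h h' = 0" "d_star k k' = 0"
      using circle.nonneg[of h h'] d_star_nonneg[of k k'] by linarith+
    then show "h = h' \<and> k = k'"
      using hk Metric_space.zero[OF d_star_metric, of k k'] by simp
  qed
  show "Omega ` (circle \<times> AC_circle_fix) = carrier AC_circle"
  proof
    show "Omega ` (circle \<times> AC_circle_fix) \<subseteq> carrier AC_circle" using Omega_in_AC_circle by auto
    show "carrier AC_circle \<subseteq> Omega ` (circle \<times> AC_circle_fix)"
    proof
      fix f assume "f \<in> carrier AC_circle"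
      then obtain F where F: "is_lift F f" using AC_circle_iff by blast
      define k where "k = compose circle (rotation (circle_cover (- F 0))) f"
      have k: "is_lift (\<lambda>x. F x + - F 0) k"
        using is_lift_compose[OF is_lift_rotation[of "- F 0"] F] by (simp add: k_def comp_def)
      have "k 1 = 1" using is_liftD(3)[OF k, of 0] by simp
      then have "k \<in> AC_circle_fix" using k AC_circle_iff by (auto simp: AC_circle_fix_def)
      moreover have "Omega (circle_cover (F 0), k) = f"
      proof (rule is_lift_eqI)
        show "is_lift F (Omega (circle_cover (F 0), k))" using is_lift_Omega[OF k, of "F 0"] by simp
      qed (rule F)
      ultimately show "f \<in> Omega ` (circle \<times> AC_circle_fix)"
        by (metis SigmaI circle_cover_in_circle image_eqI)
    qed
  qed
qed

lemma mtopology_circle: "circle.mtopology = top_of_set circle"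
proof (rule topology_eq[THEN iffD2], intro allI)
  fix U
  have ball: "(\<exists>r>0. circle.mball x r \<subseteq> U) \<longleftrightarrow> (\<exists>e>0. \<forall>y\<in>circle. dist y x < e \<longrightarrow> y \<in> U)" if x: "x \<in> circle" for x
  proof
    assume "\<exists>r>0. circle.mball x r \<subseteq> U"
    then obtain r where r: "r > 0" "circle.mball x r \<subseteq> U" by blast
    have "y \<in> U" if "y \<in> circle" "dist y x < r" for y
      using d_circle_le_dist[OF x that(1)] that r(2) x by (auto simp: circle.mball_def dist_commute)
    then show "\<exists>e>0. \<forall>y\<in>circle. dist y x < e \<longrightarrow> y \<in> U" using r(1) by blast
  next
    assume "\<exists>e>0. \<forall>y\<in>circle. dist y x < e \<longrightarrow> y \<in> U"
    then obtain e where e: "e > 0" "\<And>y. y \<in> circle \<Longrightarrow> dist y x < e \<Longrightarrow> y \<in> U" by blast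
    have "y \<in> U" if "y \<in> circle.mball x (e / (2 * pi))" for y
    proof (rule e(2))
      show "y \<in> circle" using that by simp
      have "2 * pi * d_circle x y < e" using that by (simp add: field_simps)
      then show "dist y x < e" using dist_le_d_circle[OF x \<open>y \<in> circle\<close>] by (simp add: dist_commute)
    qed
    moreover have "0 < e / (2 * pi)" using e(1) by simp
    ultimately show "\<exists>r>0. circle.mball x r \<subseteq> U" by blast
  qed
  show "openin circle.mtopology U \<longleftrightarrow> openin (top_of_set circle) U"
    unfolding circle.openin_mtopology openin_euclidean_subtopology_iff using ball by (meson subsetD)
qed

theorem Omega_homeomorphic_map:
  "homeomorphic_map (prod_topology (top_of_set circle) (Metric_space.mtopology AC_circle_fix d_star))
     (Metric_space.mtopology (carrier AC_circle) d_sum) Omega"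
proof -
  interpret K: Metric_space AC_circle_fix d_star by (rule d_star_metric)
  interpret G: Metric_space "carrier AC_circle" d_sum by (rule d_sum_metric)
  interpret CK: Metric_space12 circle d_circle AC_circle_fix d_star ..
  let ?O = "inv_into (circle \<times> AC_circle_fix) Omega"
  have "homeomorphic_maps CK.Prod_metric.mtopology G.mtopology Omega ?O"
    unfolding homeomorphic_maps_def
  proof (intro conjI)
    show "continuous_map CK.Prod_metric.mtopology G.mtopology Omega"
      unfolding CK.Prod_metric.metric_continuous_map[OF d_sum_metric]
    proof (intro conjI ballI allI impI)
      show "Omega ` (circle \<times> AC_circle_fix) \<subseteq> carrier AC_circle"
        using Omega_bij_betw by (simp add: bij_betw_def)
      fix a and e :: real assume "a \<in> circle \<times> AC_circle_fix" "0 < e"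
      then obtain h k where a: "a = (h, k)" "h \<in> circle" "k \<in> AC_circle_fix" by auto
      \<comment> \<open>Each component is below \<open>e/3\<close>, and the one in the stabiliser
        counts twice.\<close>
      have "d_sum (Omega (h, k)) (Omega (h', k')) < e"
        if "h' \<in> circle" "k' \<in> AC_circle_fix" "prod_dist d_circle d_star (h, k) (h', k') < e/3" for h' k'
        using d_sum_Omega(1)[OF a(2,3) that(1,2)] CK.component_le_prod_metric(1)[of h h' k k']
          CK.component_le_prod_metric(2)[of k k' h h'] that(3) by linarith
      then show "\<exists>\<delta>>0. \<forall>x. x \<in> circle \<times> AC_circle_fix \<and> prod_dist d_circle d_star a x < \<delta> \<longrightarrow>
          d_sum (Omega a) (Omega x) < e"
        using \<open>0 < e\<close> a(1) by (intro exI[of _ "e/3"]) auto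
    qed
    show "continuous_map G.mtopology CK.Prod_metric.mtopology ?O"
      unfolding G.metric_continuous_map[OF CK.prod_metric]
    proof (intro conjI ballI allI impI)
      show "?O ` carrier AC_circle \<subseteq> circle \<times> AC_circle_fix"
        using bij_betw_inv_into[OF Omega_bij_betw] by (simp add: bij_betw_def)
      fix f and e :: real assume f: "f \<in> carrier AC_circle" and "0 < e"
      have "prod_dist d_circle d_star (?O f) (?O g) < e" if g: "g \<in> carrier AC_circle" "d_sum f g < e" for g
      proof -
        have "f \<in> Omega ` (circle \<times> AC_circle_fix)" "g \<in> Omega ` (circle \<times> AC_circle_fix)"
          using f g(1) Omega_bij_betw by (simp_all add: bij_betw_def)
        then obtain h k h' k' where hk: "h \<in> circle" "k \<in> AC_circle_fix" "Omega (h, k) = f"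
          and hk': "h' \<in> circle" "k' \<in> AC_circle_fix" "Omega (h', k') = g"
          by (elim imageE SigmaE) blast
        have O: "?O f = (h, k)" "?O g = (h', k')"
          unfolding hk(3)[symmetric] hk'(3)[symmetric]
          using hk(1,2) hk'(1,2) bij_betw_imp_inj_on[OF Omega_bij_betw] by (simp_all add: inv_into_f_f)
        have "prod_dist d_circle d_star (h, k) (h', k') \<le> d_circle h h' + d_star k k'"
          by (rule CK.prod_metric_le_components) (use hk hk' in auto)
        also have "\<dots> \<le> d_sum f g" using d_sum_Omega(2)[OF hk(1,2) hk'(1,2)] hk(3) hk'(3) by simp
        finally show ?thesis using g(2) O by simp
      qed
      then show "\<exists>\<delta>>0. \<forall>x. x \<in> carrier AC_circle \<and> d_sum f x < \<delta> \<longrightarrow> prod_dist d_circle d_star (?O f) (?O x) < e"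
        using \<open>0 < e\<close> by blast
    qed
  qed (use Omega_bij_betw in \<open>auto simp: bij_betw_def inv_into_f_f f_inv_into_f\<close>)
  then have "homeomorphic_map CK.Prod_metric.mtopology G.mtopology Omega"
    by (rule homeomorphic_maps_imp_map)
  then show ?thesis by (simp add: CK.mtopology_prod_metric mtopology_circle)
qed

lemma Omega_topology_d_sum: "Omega_topology (Metric_space.mtopology (carrier AC_circle) d_sum)"
  using Omega_homeomorphic_map Metric_space.topspace_mtopology[OF d_sum_metric] by (simp add: Omega_topology_def)

section \<open>Uniqueness of the topology, and separability\<close>

text \<open>A set open in \<open>S\<close> has an open preimage under \<open>f\<close>, and the open
  map into \<open>T\<close> sends this preimage back onto the set; the situation is symmetric in
  \<open>S\<close> and \<open>T\<close>.\<close>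

lemma homeomorphic_map_unique_topology:
  assumes "homeomorphic_map X S f" "homeomorphic_map X T f"
  shows "S = T"
proof -
  have le: "openin T U" if S: "homeomorphic_map X S f" and T: "homeomorphic_map X T f" and U: "openin S U" for S T U
  proof -
    have "f ` topspace X = topspace S" using homeomorphic_imp_surjective_map[OF S] .
    then have eq: "f ` {x \<in> topspace X. f x \<in> U} = U" using openin_subset[OF U] by (intro equalityI subsetI) force+
    moreover have "openin X {x \<in> topspace X. f x \<in> U}"
      using homeomorphic_imp_continuous_map[OF S] U by (rule openin_continuous_map_preimage)
    ultimately have "openin T (f ` {x \<in> topspace X. f x \<in> U})"
      using homeomorphic_imp_open_map[OF T] unfolding open_map_def by blast
    then show ?thesis unfolding eq .
  qed
  show ?thesis unfolding topology_eq using le assms by blast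
qed

lemma Omega_topology_unique: "Omega_topology S \<Longrightarrow> Omega_topology T \<Longrightarrow> S = T"
  unfolding Omega_topology_def using homeomorphic_map_unique_topology by blast

text \<open>Step functions approximate densities but need not be densities of group members. So for
  every step function, rational angle and precision, one group member that close is chosen whenever
  there is any; these countably many are dense by the triangle inequality.\<close>

theorem d_sum_separable: "separable_space (Metric_space.mtopology (carrier AC_circle) d_sum)"
proof -
  interpret G: Metric_space "carrier AC_circle" d_sum by (rule d_sum_metric)
  have "\<exists>\<phi>. \<forall>f\<in>carrier AC_circle. has_density (lift f) (\<phi> f)"
    by (intro bchoice ballI circle_liftD(5) is_liftD(1)[OF AC_circle_imp_is_lift])
  then obtain \<phi> where \<phi>: "\<And>f. f \<in> carrier AC_circle \<Longrightarrow> has_density (lift f) (\<phi> f)" by blast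
  define near where "near n q r m f \<longleftrightarrow> f \<in> carrier AC_circle \<and>
    L1_dist 0 1 (\<phi> f) (step_function n q) < ennreal (1 / real (Suc m)) \<and>
    d_circle (f 1) (circle_cover (of_rat r)) < 1 / real (Suc m)" for n q r m f
  define C where "C = (\<lambda>(n, q, r, m). SOME f. near n q r m f) ` {(n, q, r, m). \<exists>f. near n q r m f}"
  have "countable C" unfolding C_def by (intro countable_image countableI_type)
  moreover have sub: "C \<subseteq> carrier AC_circle"
    unfolding C_def
  proof clarify
    fix n q r m f assume "near n q r m f"
    then have "near n q r m (SOME f. near n q r m f)" by (rule someI[of "near n q r m"])
    then show "(SOME f. near n q r m f) \<in> carrier AC_circle" unfolding near_def by (rule conjunct1)
  qed
  moreover have "G.mtopology closure_of C = carrier AC_circle"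
  proof -
    have "\<exists>g\<in>C. g \<in> G.mball f e" if f: "f \<in> carrier AC_circle" and "0 < e" for f e
    proof -
      \<comment> \<open>Both \<open>d_circle\<close> at 1 and \<open>d_star\<close> come out at most
        \<open>2 / real (Suc m)\<close>, and \<open>d_star\<close> counts twice, which makes
        6.\<close>
      obtain m where m: "6 / e < real (Suc m)" using reals_Archimedean2 by (meson less_trans lessI of_nat_less_iff)
      have m': "6 / real (Suc m) < e" using m \<open>0 < e\<close> by (simp add: field_simps)
      note lf = AC_circle_imp_is_lift[OF f]
      note pf = \<phi>[OF f]
      have "(\<integral>\<^sup>+t. ennreal (\<phi> f t) * indicator {0..1} t \<partial>lborel) < \<infinity>"
        using has_density_unit[OF is_liftD(1)[OF lf] pf] by simp
      then obtain n q where nq: "L1_dist 0 1 (\<phi> f) (step_function n q) < ennreal (1 / real (Suc m))"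
        using step_functions_dense_in_L1[of "\<phi> f" "1 / real (Suc m)"] has_densityD(2,3)[OF pf] by auto
      obtain r where r: "lift f 0 < of_rat r" "of_rat r < lift f 0 + 1 / real (Suc m)"
        using of_rat_dense[of "lift f 0" "lift f 0 + 1 / real (Suc m)"] by auto
      have f1: "f 1 = circle_cover (lift f 0)" using is_liftD(3)[OF lf, of 0] by simp
      have "d_circle (f 1) (circle_cover (of_rat r)) < 1 / real (Suc m)"
        unfolding f1 using d_circle_cover_le[of "lift f 0" "of_rat r"] r by linarith
      then have "near n q r m f" using f nq by (simp add: near_def)
      then have ex: "\<exists>f. near n q r m f" by blast
      define g where "g = (SOME f. near n q r m f)"
      have gn: "near n q r m g" unfolding g_def by (rule someI_ex[OF ex])
      have gC: "g \<in> C"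
        unfolding C_def by (rule image_eqI[of _ _ "(n, q, r, m)"]) (use ex g_def in auto)
      have g: "g \<in> carrier AC_circle" using gn by (simp add: near_def)
      note lg = AC_circle_imp_is_lift[OF g]
      note pg = \<phi>[OF g]
      note [measurable] = has_densityD(2)[OF pf] has_densityD(2)[OF pg]
      have "ennreal (d_star f g) \<le> L1_dist 0 1 (\<phi> f) (step_function n q)
         + L1_dist 0 1 (step_function n q) (\<phi> g)"
        unfolding ennreal_d_star[OF lf pf lg pg] by (rule nn_integral_abs_triangle) measurable
      also have "\<dots> \<le> ennreal (1 / real (Suc m)) + ennreal (1 / real (Suc m))"
        using nq gn by (intro add_mono) (simp_all add: near_def abs_minus_commute less_imp_le)
      also have "\<dots> = ennreal (2 / real (Suc m))" by (simp flip: ennreal_plus)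
      finally have ds: "d_star f g \<le> 2 / real (Suc m)" by (subst (asm) ennreal_le_iff) auto
      have "f 1 \<in> circle" "g 1 \<in> circle"
        using AC_circle_in_circle[OF f one_in_circle] AC_circle_in_circle[OF g one_in_circle] .
      then have "d_circle (f 1) (g 1) \<le> d_circle (f 1) (circle_cover (of_rat r)) + d_circle (circle_cover (of_rat r)) (g 1)"
        by (intro circle.triangle) auto
      also have "\<dots> < 1 / real (Suc m) + 1 / real (Suc m)"
        using \<open>near n q r m f\<close> gn by (intro add_strict_mono) (simp_all add: near_def circle.commute)
      finally have "d_circle (f 1) (g 1) < 2 / real (Suc m)" by simp
      then have "d_sum f g < 2 / real (Suc m) + 2 * (2 / real (Suc m))"
        using d_sum_le[OF f g] ds by linarith
      also have "\<dots> = 6 / real (Suc m)" by simp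
      finally have "d_sum f g < e" using m' by linarith
      then show ?thesis using gC f g by auto
    qed
    then show ?thesis unfolding G.metric_closure_of by auto
  qed
  ultimately show ?thesis unfolding separable_space_def by auto
qed

subsection \<open>Completeness\<close>

text \<open>Convergence in mean gives convergence of integrals, by two triangle inequalities with 0
  as third function. A single index at finite distance shows that the limit has finite
  integral.\<close>

lemma nn_integral_L1_tendsto:
  fixes \<phi> :: "nat \<Rightarrow> real \<Rightarrow> real"
  assumes [measurable]: "\<And>n. \<phi> n \<in> borel_measurable borel" "\<phi>' \<in> borel_measurable borel"
    and nn: "\<And>n t. 0 \<le> \<phi> n t" "\<And>t. 0 \<le> \<phi>' t"
    and r: "\<And>n. 0 \<le> r n" "\<And>n. (\<integral>\<^sup>+t. ennreal (\<phi> n t) * indicator {a..b} t \<partial>lborel) = ennreal (r n)"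
    and lim: "(\<lambda>n. L1_dist a b (\<phi> n) \<phi>') \<longlonglongrightarrow> 0"
  obtains I where "0 \<le> I" "(\<integral>\<^sup>+t. ennreal (\<phi>' t) * indicator {a..b} t \<partial>lborel) = ennreal I" "r \<longlonglongrightarrow> I"
proof -
  let ?J = "\<integral>\<^sup>+t. ennreal (\<phi>' t) * indicator {a..b} t \<partial>lborel"
  let ?w = "\<lambda>n. L1_dist a b (\<phi> n) \<phi>'"
  have 1: "ennreal (r n) \<le> ?w n + ?J" for n
  proof -
    have "(\<integral>\<^sup>+t. ennreal \<bar>\<phi> n t - 0\<bar> * indicator {a..b} t \<partial>lborel)
      \<le> ?w n + (\<integral>\<^sup>+t. ennreal \<bar>\<phi>' t - 0\<bar> * indicator {a..b} t \<partial>lborel)"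
      by (rule nn_integral_abs_triangle) measurable
    then show ?thesis by (simp add: nn r)
  qed
  have 2: "?J \<le> ?w n + ennreal (r n)" for n
  proof -
    have "(\<integral>\<^sup>+t. ennreal \<bar>\<phi>' t - 0\<bar> * indicator {a..b} t \<partial>lborel)
      \<le> L1_dist a b \<phi>' (\<phi> n)
        + (\<integral>\<^sup>+t. ennreal \<bar>\<phi> n t - 0\<bar> * indicator {a..b} t \<partial>lborel)"
      by (rule nn_integral_abs_triangle) measurable
    then show ?thesis by (simp add: nn r abs_minus_commute)
  qed
  have ev: "\<forall>\<^sub>F n in sequentially. ?w n < ennreal e" if "0 < e" for e
    using lim that by (intro order_tendstoD) auto
  obtain n where "?w n < ennreal 1" using ev[of 1] by (auto simp: eventually_sequentially)
  then have "?w n + ennreal (r n) \<le> ennreal 1 + ennreal (r n)" by (intro add_right_mono less_imp_le)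
  also have "\<dots> < \<infinity>" by simp
  finally have "?w n + ennreal (r n) < \<infinity>" .
  then have "?J < \<infinity>" using 2[of n] by (rule le_less_trans[rotated])
  then obtain I where I: "0 \<le> I" "?J = ennreal I" by (cases ?J) auto
  have "r \<longlonglongrightarrow> I"
  proof (rule LIMSEQ_I)
    fix e :: real assume "0 < e"
    then obtain N where N: "\<And>n. n \<ge> N \<Longrightarrow> ?w n < ennreal (e/2)"
      using ev[of "e/2"] by (auto simp: eventually_sequentially)
    have "norm (r n - I) < e" if "n \<ge> N" for n
    proof -
      have "ennreal (r n) \<le> ennreal (e/2) + ennreal I"
        unfolding I(2)[symmetric] by (rule order_trans[OF 1 add_right_mono[OF less_imp_le[OF N[OF that]]]])
      also have "\<dots> = ennreal (e/2 + I)" using \<open>0 < e\<close> I(1) by simp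
      finally have a: "r n \<le> e/2 + I" using \<open>0 < e\<close> I(1) by (subst (asm) ennreal_le_iff) auto
      have "ennreal I \<le> ennreal (e/2) + ennreal (r n)"
        unfolding I(2)[symmetric] by (rule order_trans[OF 2 add_right_mono[OF less_imp_le[OF N[OF that]]]])
      also have "\<dots> = ennreal (e/2 + r n)" using \<open>0 < e\<close> r(1) by simp
      finally have "I \<le> e/2 + r n" using \<open>0 < e\<close> r(1)[of n] by (subst (asm) ennreal_le_iff) auto
      then show ?thesis using a \<open>0 < e\<close> by (simp add: abs_less_iff)
    qed
    then show "\<exists>N. \<forall>n\<ge>N. norm (r n - I) < e" by blast
  qed
  with I show thesis by (rule that)
qed

text \<open>The limit density is found on one period, extended periodically and integrated. Since
  all \<open>F n\<close> vanish at 0, convergence of increments is convergence of values. The limit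
  is monotone but perhaps not injective, so it is not yet claimed to be a
  \<open>circle_lift\<close>.\<close>

lemma circle_lift_L1_limit:
  fixes F :: "nat \<Rightarrow> real \<Rightarrow> real"
  assumes F: "\<And>n. circle_lift (F n)" "\<And>n. has_density (F n) (\<phi> n)" "\<And>n. F n 0 = 0"
    and cauchy: "\<And>e. e > 0 \<Longrightarrow> \<exists>N. \<forall>i\<ge>N. \<forall>j\<ge>N.
      L1_dist 0 1 (\<phi> i) (\<phi> j) < ennreal e"
  obtains F' \<phi>' where "has_density F' \<phi>'" "\<And>x. F' (x + 1) = F' x + 1" "\<And>x. (\<lambda>n. F n x) \<longlonglongrightarrow> F' x"
    "(\<lambda>n. L1_dist 0 1 (\<phi> n) \<phi>') \<longlonglongrightarrow> 0"
proof -
  note [measurable] = has_densityD(2)[OF F(2)]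
  obtain \<phi>0 where \<phi>0[measurable]: "\<phi>0 \<in> borel_measurable borel" and nn0: "\<And>t. 0 \<le> \<phi>0 t"
    and lim0: "(\<lambda>n. L1_dist 0 1 (\<phi> n) \<phi>0) \<longlonglongrightarrow> 0"
  proof (rule L1_Icc_complete[of \<phi> 0 1])
    show "(\<integral>\<^sup>+t. ennreal (\<phi> n t) * indicator {0..1} t \<partial>lborel) < \<infinity>" for n
      by (simp add: has_density_unit[OF F(1,2)])
  qed (use cauchy has_densityD(2,3)[OF F(2)] in auto)
  \<comment> \<open>Periodic extension. On the unit interval it can differ from
    \<open>\<phi>0\<close> only at 1, where \<open>frac\<close> is 0.\<close>
  define \<phi>' where "\<phi>' t = \<phi>0 (frac t)" for t
  have [measurable]: "\<phi>' \<in> borel_measurable borel"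
    unfolding \<phi>'_def frac_def by measurable
  have nn': "0 \<le> \<phi>' t" for t by (simp add: \<phi>'_def nn0)
  have w0: "L1_dist 0 1 (\<phi> n) \<phi>'
     = L1_dist 0 1 (\<phi> n) \<phi>0" for n
  proof (rule nn_integral_cong_AE)
    show "AE t in lborel. ennreal \<bar>\<phi> n t - \<phi>' t\<bar> * indicator {0..1} t = ennreal \<bar>\<phi> n t - \<phi>0 t\<bar> * indicator {0..1} t"
      using AE_lborel_singleton[of "1::real"]
    proof eventually_elim
      case (elim t)
      then have "t \<in> {0..1} \<Longrightarrow> frac t = t" by (simp add: frac_eq)
      then show ?case by (auto simp: \<phi>'_def indicator_def)
    qed
  qed
  have lim: "(\<lambda>n. L1_dist 0 1 (\<phi> n) \<phi>') \<longlonglongrightarrow> 0"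
    using lim0 by (simp only: w0)
  have limN: "(\<lambda>n. L1_dist (- real N) (real N) (\<phi> n) \<phi>') \<longlonglongrightarrow> 0" for N
  proof -
    have "L1_dist (- real N) (real N) (\<phi> n) \<phi>'
      = of_nat (2 * N) * L1_dist 0 1 (\<phi> n) \<phi>'" for n
    proof (rule nn_integral_AE_periodic_symmetric)
      show "AE t in lborel. ennreal \<bar>\<phi> n (t + 1) - \<phi>' (t + 1)\<bar> = ennreal \<bar>\<phi> n t - \<phi>' t\<bar>"
        using has_density_AE_periodic[OF F(2) circle_liftD(4)[OF F(1)], of n]
        by eventually_elim (simp add: \<phi>'_def frac_1_eq)
    qed measurable
    moreover have "(\<lambda>n. of_nat (2 * N) * L1_dist 0 1 (\<phi> n) \<phi>') \<longlonglongrightarrow> of_nat (2 * N) * 0"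
      by (rule ennreal_tendsto_cmult[OF _ lim]) (simp add: ennreal_of_nat_eq_real_of_nat)
    ultimately show ?thesis by simp
  qed
  have limab: "(\<lambda>n. L1_dist a b (\<phi> n) \<phi>') \<longlonglongrightarrow> 0" for a b
  proof -
    obtain N :: nat where N: "max \<bar>a\<bar> \<bar>b\<bar> \<le> real N" using real_arch_simple by blast
    show ?thesis
    proof (rule tendsto_sandwich[OF _ _ tendsto_const limN[of N]])
      show "\<forall>\<^sub>F n in sequentially. L1_dist a b (\<phi> n) \<phi>'
        \<le> L1_dist (- real N) (real N) (\<phi> n) \<phi>'"
        using N by (intro always_eventually allI nn_integral_mono mult_left_mono) (auto simp: indicator_def)
    qed simp
  qed
  have incr: "\<exists>I\<ge>0. (\<integral>\<^sup>+t. ennreal (\<phi>' t) * indicator {a..b} t \<partial>lborel) = ennreal I \<and> (\<lambda>n. F n b - F n a) \<longlonglongrightarrow> I"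
    if "a \<le> b" for a b
  proof (rule nn_integral_L1_tendsto[of \<phi> \<phi>' "\<lambda>n. F n b - F n a" a b])
    show "0 \<le> F n b - F n a" for n using has_densityD(1)[OF F(2)] that by (simp add: monoD)
    show "(\<integral>\<^sup>+t. ennreal (\<phi> n t) * indicator {a..b} t \<partial>lborel) = ennreal (F n b - F n a)" for n
      by (rule has_densityD(4)[OF F(2) that])
  qed (use limab nn' has_densityD(3)[OF F(2)] in auto)
  have "convergent (\<lambda>n. F n x)" for x
  proof (cases "0 \<le> x")
    case True
    then show ?thesis using incr[OF True] F(3) by (auto simp: convergent_def)
  next
    case False
    then obtain I where "(\<lambda>n. F n 0 - F n x) \<longlonglongrightarrow> I" using incr[of x 0] by auto
    from tendsto_minus[OF this] show ?thesis using F(3) by (auto simp: convergent_def)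
  qed
  then obtain F' where F': "\<And>x. (\<lambda>n. F n x) \<longlonglongrightarrow> F' x" unfolding convergent_def by metis
  show thesis
  proof (rule that[OF _ _ F' lim])
    show "F' (x + 1) = F' x + 1" for x
    proof (rule LIMSEQ_unique[OF F'])
      show "(\<lambda>n. F n (x + 1)) \<longlonglongrightarrow> F' x + 1"
        by (simp add: circle_liftD(4)[OF F(1)] tendsto_add F')
    qed
    have I: "0 \<le> F' b - F' a \<and> (\<integral>\<^sup>+t. ennreal (\<phi>' t) * indicator {a..b} t \<partial>lborel) = ennreal (F' b - F' a)"
      if ab: "a \<le> b" for a b
    proof -
      obtain I where I: "0 \<le> I" "(\<integral>\<^sup>+t. ennreal (\<phi>' t) * indicator {a..b} t \<partial>lborel) = ennreal I"
        "(\<lambda>n. F n b - F n a) \<longlonglongrightarrow> I" using incr[OF ab] by blast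
      have "(\<lambda>n. F n b - F n a) \<longlonglongrightarrow> F' b - F' a" by (intro tendsto_diff F')
      then have "I = F' b - F' a" using I(3) LIMSEQ_unique by blast
      then show ?thesis using I by simp
    qed
    then show "has_density F' \<phi>'"
      unfolding has_density_def mono_def using nn' by auto
  qed
qed

text \<open>Both functions commute with integer translations, so their difference is periodic, and
  over one period it is a difference of increments from a common value. The bound is uniform in
  \<open>x\<close>, as \<open>circle_lift_limit_inverse\<close> requires.\<close>

lemma degree_one_diff_le:
  assumes F: "\<And>x. F (x + 1) = F x + (1::real)" "\<And>x. G (x + 1) = G x + (1::real)" "F 0 = G 0"
    and dens: "has_density F \<phi>" "has_density G \<gamma>"
  shows "ennreal \<bar>F x - G x\<bar> \<le> L1_dist 0 1 \<phi> \<gamma>"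
proof -
  define y where "y = frac x"
  have y: "0 \<le> y" "y \<le> 1" by (simp_all add: y_def frac_lt_1 less_imp_le)
  have x: "x = y + of_int \<lfloor>x\<rfloor>" by (simp add: y_def frac_def)
  have "F x = F y + of_int \<lfloor>x\<rfloor>" "G x = G y + of_int \<lfloor>x\<rfloor>"
    using degree_one_add_int[of F y "\<lfloor>x\<rfloor>", OF F(1)] degree_one_add_int[of G y "\<lfloor>x\<rfloor>", OF F(2)]
    unfolding x[symmetric] .
  then have "ennreal \<bar>F x - G x\<bar> = ennreal \<bar>(F y - F 0) - (G y - G 0)\<bar>" using F(3) by simp
  also have "\<dots> \<le> L1_dist 0 y \<phi> \<gamma>"
    by (rule abs_diff_increment_le[OF dens y(1)])
  also have "\<dots> \<le> L1_dist 0 1 \<phi> \<gamma>"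
    using y(2) by (intro nn_integral_mono mult_left_mono) (auto simp: indicator_def)
  finally show ?thesis .
qed

text \<open>Continuity sends \<open>F' (H n x)\<close> to \<open>F' (H' x)\<close>, while uniform
  closeness of \<open>F'\<close> to \<open>F n\<close> sends it to \<open>x = F n (H n x)\<close>.
  Applied a second time with the roles of \<open>F\<close> and \<open>H\<close> exchanged, it makes
  the two limits mutually inverse.\<close>

lemma circle_lift_limit_inverse:
  fixes F H :: "nat \<Rightarrow> real \<Rightarrow> real"
  assumes F: "\<And>n. circle_lift (F n)" "\<And>n. has_density (F n) (\<phi> n)" "\<And>n. F n 0 = 0"
    and F': "has_density F' \<phi>'" "\<And>x. F' (x + 1) = F' x + 1" "\<And>x. (\<lambda>n. F n x) \<longlonglongrightarrow> F' x"
      "(\<lambda>n. L1_dist 0 1 (\<phi> n) \<phi>') \<longlonglongrightarrow> 0"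
    and H: "\<And>x. (\<lambda>n. H n x) \<longlonglongrightarrow> H' x" "\<And>n x. F n (H n x) = x"
  shows "F' (H' x) = x"
proof -
  have F'0: "F' 0 = 0" using F'(3)[of 0] F(3) by (simp add: LIMSEQ_const_iff)
  have "isCont F' (H' x)"
    using locally_absolutely_continuous_imp_continuous_on[OF has_density_imp_locally_absolutely_continuous[OF F'(1)]]
    by (simp add: continuous_on_eq_continuous_at)
  then have "(\<lambda>n. F' (H n x)) \<longlonglongrightarrow> F' (H' x)" using H(1) by (rule isCont_tendsto_compose)
  moreover have "(\<lambda>n. F' (H n x)) \<longlonglongrightarrow> x"
  proof (rule LIMSEQ_I)
    fix e :: real assume "0 < e"
    then have "\<forall>\<^sub>F n in sequentially. L1_dist 0 1 (\<phi> n) \<phi>' < ennreal e"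
      using F'(4) by (intro order_tendstoD) auto
    then obtain N where N: "\<And>n. n \<ge> N \<Longrightarrow> L1_dist 0 1 (\<phi> n) \<phi>' < ennreal e"
      by (auto simp: eventually_sequentially)
    have "norm (F' (H n x) - x) < e" if "n \<ge> N" for n
    proof -
      have "ennreal \<bar>F n (H n x) - F' (H n x)\<bar> \<le> L1_dist 0 1 (\<phi> n) \<phi>'"
        by (rule degree_one_diff_le) (simp_all add: circle_liftD(4)[OF F(1)] F F'0 F')
      also have "\<dots> < ennreal e" by (rule N[OF that])
      finally show ?thesis using \<open>0 < e\<close> by (simp add: H(2) ennreal_less_iff abs_minus_commute)
    qed
    then show "\<exists>N. \<forall>n\<ge>N. norm (F' (H n x) - x) < e" by blast
  qed
  ultimately show ?thesis by (rule LIMSEQ_unique)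
qed

section \<open>A complete metric on the stabiliser of 1\<close>

lemma AC_circle_fix_lift:
  assumes "k \<in> AC_circle_fix"
  shows "is_lift (lift k) k" and "lift k 0 = 0"
    and "is_lift (inv_into UNIV (lift k)) (inv\<^bsub>AC_circle\<^esub> k)" and "inv_into UNIV (lift k) 0 = 0"
    and "inv\<^bsub>AC_circle\<^esub> k \<in> AC_circle_fix"
proof -
  note k = AC_circle_fix_D[OF assms]
  show l: "is_lift (lift k) k" by (rule AC_circle_imp_is_lift[OF k(1)])
  have "circle_cover (lift k 0) = circle_cover 0" using is_liftD(3)[OF l, of 0] k(2) by simp
  then obtain n :: int where "lift k 0 = 0 + of_int n" unfolding circle_cover_eq_iff by blast
  then show l0: "lift k 0 = 0" using is_lift_lift(2)[OF l] by auto
  show li: "is_lift (inv_into UNIV (lift k)) (inv\<^bsub>AC_circle\<^esub> k)"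
    unfolding AC_circle_inv[OF k(1)] by (rule is_lift_inv[OF l])
  show i0: "inv_into UNIV (lift k) 0 = 0"
    using l0 circle_liftD(3)[OF is_liftD(1)[OF l]] by (metis bij_is_inj inv_f_f)
  have "inv\<^bsub>AC_circle\<^esub> k \<in> carrier AC_circle" using li AC_circle_iff by blast
  moreover have "(inv\<^bsub>AC_circle\<^esub> k) 1 = 1" using is_liftD(3)[OF li, of 0] i0 by simp
  ultimately show "inv\<^bsub>AC_circle\<^esub> k \<in> AC_circle_fix" by (simp add: AC_circle_fix_def)
qed

text \<open>\<open>d_star\<close> alone is not complete: densities equal to \<open>1/n\<close> on
  half of the period converge to one that vanishes there, whose integral is not injective. The
  distance of the inverses rules this out.\<close>

definition d_star2 :: "(complex \<Rightarrow> complex) \<Rightarrow> (complex \<Rightarrow> complex) \<Rightarrow> real"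
  where "d_star2 f g = d_star f g + d_star (inv\<^bsub>AC_circle\<^esub> f) (inv\<^bsub>AC_circle\<^esub> g)"

lemma d_star2_metric: "Metric_space AC_circle_fix d_star2"
proof
  interpret K: Metric_space AC_circle_fix d_star by (rule d_star_metric)
  fix f g h
  show "0 \<le> d_star2 f g" by (simp add: d_star2_def d_star_nonneg)
  show "d_star2 f g = d_star2 g f" by (simp add: d_star2_def d_star_sym)
  assume f: "f \<in> AC_circle_fix" and g: "g \<in> AC_circle_fix"
  show "d_star2 f g = 0 \<longleftrightarrow> f = g"
  proof
    assume "d_star2 f g = 0"
    then have "d_star f g = 0"
      using d_star_nonneg[of f g] d_star_nonneg[of "inv\<^bsub>AC_circle\<^esub> f" "inv\<^bsub>AC_circle\<^esub> g"]
      unfolding d_star2_def by linarith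
    then show "f = g" using K.zero[OF f g] by simp
  qed (simp add: d_star2_def d_star_refl)
  assume h: "h \<in> AC_circle_fix"
  show "d_star2 f h \<le> d_star2 f g + d_star2 g h"
    using K.triangle[OF f g h] K.triangle[OF AC_circle_fix_lift(5)[OF f] AC_circle_fix_lift(5)[OF g] AC_circle_fix_lift(5)[OF h]]
    by (simp add: d_star2_def)
qed

text \<open>Read off from the continuity of inversion in the whole group; the radius is halved
  because on the stabiliser \<open>d_sum\<close> is at most twice \<open>d_star\<close>.\<close>

lemma d_star_inv_continuous:
  assumes f: "f \<in> AC_circle_fix" and "0 < e"
  obtains r where "r > 0" "\<And>g. g \<in> AC_circle_fix \<Longrightarrow> d_star f g < r \<Longrightarrow>
    d_star (inv\<^bsub>AC_circle\<^esub> f) (inv\<^bsub>AC_circle\<^esub> g) < e"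
proof -
  have c: "continuous_map (Metric_space.mtopology (carrier AC_circle) d_sum)
     (Metric_space.mtopology (carrier AC_circle) d_sum) (\<lambda>x. inv\<^bsub>AC_circle\<^esub> x)"
    using d_sum_topological_group by (simp add: topological_group_def)
  note c[unfolded Metric_space.metric_continuous_map[OF d_sum_metric d_sum_metric], THEN conjunct2]
  from bspec[OF this AC_circle_fix_D(1)[OF f], rule_format, OF \<open>0 < e\<close>]
  obtain r where r: "r > 0" "\<And>g. g \<in> carrier AC_circle \<Longrightarrow> d_sum f g < r \<Longrightarrow>
    d_sum (inv\<^bsub>AC_circle\<^esub> f) (inv\<^bsub>AC_circle\<^esub> g) < e"
    by blast
  have "d_star (inv\<^bsub>AC_circle\<^esub> f) (inv\<^bsub>AC_circle\<^esub> g) < e" if g: "g \<in> AC_circle_fix" "d_star f g < r/2" for g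
  proof -
    have "d_sum f g \<le> 2 * d_star f g"
      using d_sum_le[OF AC_circle_fix_D(1)[OF f] AC_circle_fix_D(1)[OF g(1)]]
        AC_circle_fix_D(2)[OF f] AC_circle_fix_D(2)[OF g(1)] by simp
    then have "d_sum (inv\<^bsub>AC_circle\<^esub> f) (inv\<^bsub>AC_circle\<^esub> g) < e"
      using g by (intro r AC_circle_fix_D) auto
    moreover have "d_star (inv\<^bsub>AC_circle\<^esub> f) (inv\<^bsub>AC_circle\<^esub> g) \<le> d_sum (inv\<^bsub>AC_circle\<^esub> f) (inv\<^bsub>AC_circle\<^esub> g)"
      using d_sum_ge[OF AC_circle_fix_D(1)[OF AC_circle_fix_lift(5)[OF f]] AC_circle_fix_D(1)[OF AC_circle_fix_lift(5)[OF g(1)]]]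
        circle.nonneg[of "(inv\<^bsub>AC_circle\<^esub> f) 1" "(inv\<^bsub>AC_circle\<^esub> g) 1"] by linarith
    ultimately show ?thesis by linarith
  qed
  then show thesis using that[of "r/2"] r(1) by simp
qed

text \<open>Near each point the added term is small because inversion is continuous for
  \<open>d_star\<close>; conversely \<open>d_star\<close> is at most \<open>d_star2\<close>.\<close>

lemma mtopology_d_star2: "Metric_space.mtopology AC_circle_fix d_star2 = Metric_space.mtopology AC_circle_fix d_star"
proof (rule topology_eq[THEN iffD2], intro allI)
  interpret K: Metric_space AC_circle_fix d_star by (rule d_star_metric)
  interpret K2: Metric_space AC_circle_fix d_star2 by (rule d_star2_metric)
  fix U
  have ball: "(\<exists>r>0. K2.mball x r \<subseteq> U) \<longleftrightarrow> (\<exists>r>0. K.mball x r \<subseteq> U)" if x: "x \<in> AC_circle_fix" for x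
  proof
    assume "\<exists>r>0. K2.mball x r \<subseteq> U"
    then obtain r where r: "r > 0" "K2.mball x r \<subseteq> U" by blast
    obtain s where s: "s > 0" "\<And>g. g \<in> AC_circle_fix \<Longrightarrow> d_star x g < s \<Longrightarrow>
      d_star (inv\<^bsub>AC_circle\<^esub> x) (inv\<^bsub>AC_circle\<^esub> g) < r/2"
      using d_star_inv_continuous[OF x, of "r/2"] r(1) by auto
    have "K.mball x (min s (r/2)) \<subseteq> K2.mball x r"
    proof
      fix y assume "y \<in> K.mball x (min s (r/2))"
      then have y: "y \<in> AC_circle_fix" "d_star x y < s" "d_star x y < r/2" by auto
      then show "y \<in> K2.mball x r" using s(2)[OF y(1,2)] x by (simp add: d_star2_def)
    qed
    then show "\<exists>r>0. K.mball x r \<subseteq> U" using r s(1) by (intro exI[of _ "min s (r/2)"]) auto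
  next
    assume "\<exists>r>0. K.mball x r \<subseteq> U"
    then obtain r where r: "r > 0" "K.mball x r \<subseteq> U" by blast
    have "K2.mball x r \<subseteq> K.mball x r"
    proof
      fix y assume y: "y \<in> K2.mball x r"
      have "d_star x y \<le> d_star2 x y"
        using d_star_nonneg[of "inv\<^bsub>AC_circle\<^esub> x" "inv\<^bsub>AC_circle\<^esub> y"]
        unfolding d_star2_def by linarith
      then show "y \<in> K.mball x r" using y by auto
    qed
    then show "\<exists>r>0. K2.mball x r \<subseteq> U" using r by blast
  qed
  show "openin K2.mtopology U \<longleftrightarrow> openin K.mtopology U"
    unfolding K.openin_mtopology K2.openin_mtopology using ball by (meson subsetD)
qed

theorem d_star2_mcomplete: "Metric_space.mcomplete AC_circle_fix d_star2"
proof -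
  interpret K2: Metric_space AC_circle_fix d_star2 by (rule d_star2_metric)
  show ?thesis
    unfolding K2.mcomplete_def
  proof (intro allI impI)
    fix \<sigma> assume "K2.MCauchy \<sigma>"
    then have \<sigma>: "\<And>n. \<sigma> n \<in> AC_circle_fix"
      and cauchy: "\<And>e. e > 0 \<Longrightarrow> \<exists>N. \<forall>i j. N \<le> i \<longrightarrow> N \<le> j \<longrightarrow> d_star2 (\<sigma> i) (\<sigma> j) < e"
      unfolding K2.MCauchy_def by auto
    define F where "F n = lift (\<sigma> n)" for n
    define H where "H n = inv_into UNIV (lift (\<sigma> n))" for n
    define \<tau> where "\<tau> n = inv\<^bsub>AC_circle\<^esub> (\<sigma> n)" for n
    have F: "is_lift (F n) (\<sigma> n)" "F n 0 = 0" for n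
      using AC_circle_fix_lift(1,2)[OF \<sigma>] by (simp_all add: F_def)
    have H: "is_lift (H n) (\<tau> n)" "H n 0 = 0" for n
      using AC_circle_fix_lift(3,4)[OF \<sigma>] by (simp_all add: H_def \<tau>_def)
    have "\<exists>\<phi>. has_density (F n) \<phi>" for n by (rule circle_liftD(5)[OF is_liftD(1)[OF F(1)]])
    then obtain \<phi> where \<phi>: "\<And>n. has_density (F n) (\<phi> n)" by metis
    have "\<exists>\<phi>. has_density (H n) \<phi>" for n by (rule circle_liftD(5)[OF is_liftD(1)[OF H(1)]])
    then obtain \<eta> where \<eta>: "\<And>n. has_density (H n) (\<eta> n)" by metis
    have bF: "bij (F n)" for n by (rule circle_liftD(3)[OF is_liftD(1)[OF F(1)]])
    have FH: "F n (H n x) = x" for n x using bF[of n] by (simp add: F_def H_def bij_is_surj surj_f_inv_f)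
    have HF: "H n (F n x) = x" for n x using bF[of n] by (simp add: F_def H_def bij_is_inj)
    have cF: "\<exists>N. \<forall>i\<ge>N. \<forall>j\<ge>N. L1_dist 0 1 (\<phi> i) (\<phi> j) < ennreal e"
      if e: "e > 0" for e
    proof -
      obtain N where N: "\<And>i j. N \<le> i \<Longrightarrow> N \<le> j \<Longrightarrow> d_star2 (\<sigma> i) (\<sigma> j) < e" using cauchy[OF e] by blast
      have "d_star (\<sigma> i) (\<sigma> j) < e" if "N \<le> i" "N \<le> j" for i j
        using N[OF that] d_star_nonneg[of "\<tau> i" "\<tau> j"] by (simp add: d_star2_def \<tau>_def)
      then show ?thesis
        unfolding ennreal_d_star[OF F(1) \<phi> F(1) \<phi>, symmetric] using that by (auto simp: ennreal_less_iff d_star_nonneg)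
    qed
    have cH: "\<exists>N. \<forall>i\<ge>N. \<forall>j\<ge>N. L1_dist 0 1 (\<eta> i) (\<eta> j) < ennreal e"
      if e: "e > 0" for e
    proof -
      obtain N where N: "\<And>i j. N \<le> i \<Longrightarrow> N \<le> j \<Longrightarrow> d_star2 (\<sigma> i) (\<sigma> j) < e" using cauchy[OF e] by blast
      have "d_star (\<tau> i) (\<tau> j) < e" if "N \<le> i" "N \<le> j" for i j
        using N[OF that] d_star_nonneg[of "\<sigma> i" "\<sigma> j"] by (simp add: d_star2_def \<tau>_def)
      then show ?thesis
        unfolding ennreal_d_star[OF H(1) \<eta> H(1) \<eta>, symmetric] using that by (auto simp: ennreal_less_iff d_star_nonneg)
    qed
    note lF = is_liftD(1)[OF F(1)] and lH = is_liftD(1)[OF H(1)]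
    obtain F' \<phi>' where F': "has_density F' \<phi>'" "\<And>x. F' (x + 1) = F' x + 1" "\<And>x. (\<lambda>n. F n x) \<longlonglongrightarrow> F' x"
      "(\<lambda>n. L1_dist 0 1 (\<phi> n) \<phi>') \<longlonglongrightarrow> 0"
      using circle_lift_L1_limit[OF lF \<phi> F(2) cF] by blast
    obtain H' \<eta>' where H': "has_density H' \<eta>'" "\<And>x. H' (x + 1) = H' x + 1" "\<And>x. (\<lambda>n. H n x) \<longlonglongrightarrow> H' x"
      "(\<lambda>n. L1_dist 0 1 (\<eta> n) \<eta>') \<longlonglongrightarrow> 0"
      using circle_lift_L1_limit[OF lH \<eta> H(2) cH] by blast
    have FH': "F' (H' x) = x" for x by (rule circle_lift_limit_inverse[OF lF \<phi> F(2) F' H'(3) FH])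
    have HF': "H' (F' x) = x" for x by (rule circle_lift_limit_inverse[OF lH \<eta> H(2) H' F'(3) HF])
    have inj: "inj F'" by (rule inj_on_inverseI[of _ H']) (rule HF')
    have surj: "surj F'" by (rule surjI[of _ H']) (rule FH')
    have inv: "inv_into UNIV F' = H'" using HF' FH' by (rule inv_equality)
    \<comment> \<open>The pointwise limit of lifts is only monotone; the inverse \<open>H'\<close>
      makes it strictly so, and the density of \<open>H'\<close> makes the inverse absolutely
      continuous.\<close>
    have "strict_mono F'" using has_densityD(1)[OF F'(1)] inj by (simp add: strict_mono_iff_mono)
    then have cl: "circle_lift F'" using surj F'(1,2) H'(1) inv by (auto simp: circle_lift_def)
    then obtain k where k: "is_lift F' k" by (rule is_lift_exists)
    have "F' 0 = 0" using F'(3)[of 0] F(2) by (simp add: LIMSEQ_const_iff)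
    then have "k 1 = 1" using is_liftD(3)[OF k, of 0] by simp
    then have kK: "k \<in> AC_circle_fix" using k AC_circle_iff by (auto simp: AC_circle_fix_def)
    have ki: "is_lift H' (inv\<^bsub>AC_circle\<^esub> k)"
      unfolding AC_circle_inv[OF AC_circle_fix_D(1)[OF kK]] inv[symmetric] by (rule is_lift_inv[OF k])
    have "\<forall>\<^sub>F n in sequentially. \<sigma> n \<in> AC_circle_fix \<and> d_star2 (\<sigma> n) k < e" if "e > 0" for e
    proof -
      have "\<forall>\<^sub>F n in sequentially. ennreal (d_star (\<sigma> n) k) < ennreal (e/2)"
        unfolding ennreal_d_star[OF F(1) \<phi> k F'(1)] using F'(4) \<open>e > 0\<close> by (intro order_tendstoD) auto
      moreover have "\<forall>\<^sub>F n in sequentially. ennreal (d_star (\<tau> n) (inv\<^bsub>AC_circle\<^esub> k)) < ennreal (e/2)"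
        unfolding ennreal_d_star[OF H(1) \<eta> ki H'(1)] using H'(4) \<open>e > 0\<close> by (intro order_tendstoD) auto
      ultimately show ?thesis
      proof eventually_elim
        case (elim n)
        then have "d_star (\<sigma> n) k < e/2" "d_star (\<tau> n) (inv\<^bsub>AC_circle\<^esub> k) < e/2"
          by (simp_all add: ennreal_less_iff d_star_nonneg)
        then show ?case using \<sigma> by (simp add: d_star2_def \<tau>_def)
      qed
    qed
    then have "limitin K2.mtopology \<sigma> k sequentially" using kK by (simp add: K2.limitin_metric)
    then show "\<exists>x. limitin K2.mtopology \<sigma> x sequentially" by blast
  qed
qed

lemma completely_metrizable_AC_circle_fix: "completely_metrizable_space (Metric_space.mtopology AC_circle_fix d_star)"
  using Metric_space.completely_metrizable_space_mtopology[OF d_star2_metric d_star2_mcomplete]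
  by (simp only: mtopology_d_star2)

text \<open>Complete metrizability is inherited from the two factors and carried over by
  \<open>Omega\<close>; completeness of \<open>d_sum\<close> itself is not asserted.\<close>

lemma completely_metrizable_AC_circle: "completely_metrizable_space (Metric_space.mtopology (carrier AC_circle) d_sum)"
proof -
  have "completely_metrizable_space (top_of_set circle)"
    by (rule completely_metrizable_space_closedin[OF completely_metrizable_space_euclidean])
      (simp add: circle_def)
  then have "completely_metrizable_space
      (prod_topology (top_of_set circle) (Metric_space.mtopology AC_circle_fix d_star))"
    using completely_metrizable_AC_circle_fix by (simp add: completely_metrizable_space_prod_topology)
  then show ?thesis
    using homeomorphic_completely_metrizable_space homeomorphic_map_imp_homeomorphic_space[OF Omega_homeomorphic_map]
    by blast
qed

theorem proposition20:
  shows "Metric_space AC_circle_fix d_star \<and>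
    bij_betw Omega (circle \<times> AC_circle_fix) (carrier AC_circle) \<and>
    (\<exists>!T. Omega_topology T) \<and>
    (\<forall>T. Omega_topology T \<longrightarrow>
      polish_group AC_circle T \<and>
      compatible_metric T (\<lambda>f g. d_infty f g + d_star f g))"
proof (intro conjI allI impI)
  let ?T = "Metric_space.mtopology (carrier AC_circle) d_sum"
  show "Metric_space AC_circle_fix d_star" by (rule d_star_metric)
  show "bij_betw Omega (circle \<times> AC_circle_fix) (carrier AC_circle)" by (rule Omega_bij_betw)
  show "\<exists>!T. Omega_topology T"
    using Omega_topology_d_sum Omega_topology_unique by blast
  fix T assume "Omega_topology T"
  \<comment> \<open>Uniqueness reduces every admissible topology to the one of \<open>d_sum\<close>,
    for which all claims are established.\<close>
  then have T: "T = ?T" using Omega_topology_d_sum by (rule Omega_topology_unique)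
  show "polish_group AC_circle T"
    unfolding T polish_group_def
    using d_sum_topological_group d_sum_separable completely_metrizable_AC_circle by blast
  have "(\<lambda>f g. d_infty f g + d_star f g) = d_sum" by (simp add: d_sum_def fun_eq_iff)
  then show "compatible_metric T (\<lambda>f g. d_infty f g + d_star f g)"
    unfolding T compatible_metric_def
    using d_sum_metric Metric_space.topspace_mtopology[OF d_sum_metric] by simp
qed

end
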